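(* Let $H$ be a cocommutative weak Hopf algebra in $\mathcal{C}$ and $(A,\varphi_A)$ a commutative left $H$-module algebra. Then there is a bijective correspondence between the second Sweedler cohomology group $H^{2}_{\varphi_A}(H,A)$ and the set of equivalence classes of weak crossed products $A\otimes_\alpha H$, where $\alpha\in Reg_{\varphi_A}(H^2,A)$ satisfies the 2-cocycle condition and the normal condition.
   Context: Throughout, $\mathcal{C}$ is a strict symmetric monoidal category with tensor product $\otimes$, unit object $K$, symmetry $c$, and equalizers (hence every idempotent $q:Y\to Y$ splits: $q=i\circ p$ with $p\circ i=id$). For an object $P$ and a morphism $f$, $P\otimes f$ means $id_P\otimes f$ (likewise $f\otimes P$). Algebras $(A,\eta_A,\mu_A)$ are unital associative, coalgebras $(D,\varepsilon_D,\delta_D)$ counital coassociative, all in $\mathcal{C}$; $A$ is commutative if $\mu_A\circ c_{A,A}=\mu_A$, $D$ is cocommutative if $c_{D,D}\circ\delta_D=\delta_D$. For coalgebras $D,E$: $\varepsilon_{D\otimes E}=\varepsilon_D\otimes\varepsilon_E$, $\delta_{D\otimes E}=(D\otimes c_{D,E}\otimes E)\circ(\delta_D\otimes\delta_E)$; $H^n$ is the $n$-fold tensor power with the resulting coalgebra structure. For morphisms $f,g:B\to A$ from a coalgebra to an algebra, $f\wedge g=\mu_A\circ(f\otimes g)\circ\delta_B$. A weak Hopf algebra $H$ is an algebra and coalgebra in $\mathcal{C}$ with: (a1) $\delta_H\circ\mu_H=(\mu_H\otimes\mu_H)\circ\delta_{H\otimes H}$; (a2) $\varepsilon_H\circ\mu_H\circ(\mu_H\otimes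 H)=(\varepsilon_H\otimes\varepsilon_H)\circ(\mu_H\otimes\mu_H)\circ(H\otimes\delta_H\otimes H)=(\varepsilon_H\otimes\varepsilon_H)\circ(\mu_H\otimes\mu_H)\circ(H\otimes(c_{H,H}\circ\delta_H)\otimes H)$; (a3) $(\delta_H\otimes H)\circ\delta_H\circ\eta_H=(H\otimes\mu_H\otimes H)\circ(\delta_H\otimes\delta_H)\circ(\eta_H\otimes\eta_H)=(H\otimes(\mu_H\circ c_{H,H})\otimes H)\circ(\delta_H\otimes\delta_H)\circ(\eta_H\otimes\eta_H)$; (a4) there is an antipode $\lambda_H:H\to H$ with $id_H\wedge\lambda_H=\Pi_H^L$, $\lambda_H\wedge id_H=\Pi_H^R$, $\lambda_H\wedge id_H\wedge\lambda_H=\lambda_H$, where $\Pi_H^L=((\varepsilon_H\circ\mu_H)\otimes H)\circ(H\otimes c_{H,H})\circ((\delta_H\circ\eta_H)\otimes H)$ and $\Pi_H^R=(H\otimes(\varepsilon_H\circ\mu_H))\circ(c_{H,H}\otimes H)\circ(H\otimes(\delta_H\circ\eta_H))$. A left $H$-module algebra is an algebra $A$ with $\varphi_A:H\otimes A\to A$ such that (b1) $\varphi_A\circ(\eta_H\otimes A)=id_A$; (b2) $\varphi_A\circ(H\otimes\mu_A)=\mu_A\circ(\varphi_A\otimes\varphi_A)\circ(H\otimes c_{H,A}\otimes A)\circ(\delta_H\otimes A\otimes A)$; (b3-1) $\varphi_A\circ(\mu_H\otimes A)=\varphi_A\circ(H\otimes\varphi_A)$; (b6) $\varphi_A\circ(\Pi_H^L\otimes\eta_A)=\varphi_A\circ(H\otimes\eta_A)$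 (equivalently (b4) $\varphi_A\circ(\Pi_H^L\otimes A)=\mu_A\circ((\varphi_A\circ(H\otimes\eta_A))\otimes A)$). It is commutative if $A$ is. Let $u_1=\varphi_A\circ(H\otimes\eta_A)$ and, for $n\ge2$, $u_n=\varphi_A\circ(m_H^n\otimes\eta_A)$, where $m^n_H:H^n\to H$ is the iterated product. For $n\ge1$, $Reg_{\varphi_A}(H^n,A)$ is the set of morphisms $\sigma:H^n\to A$ for which there is $\sigma^{-1}:H^n\to A$ with $\sigma\wedge\sigma^{-1}=\sigma^{-1}\wedge\sigma=u_n$, $\sigma\wedge\sigma^{-1}\wedge\sigma=\sigma$, $\sigma^{-1}\wedge\sigma\wedge\sigma^{-1}=\sigma^{-1}$; for $A$ commutative it is an abelian group under $\wedge$ with neutral element $u_n$. Sweedler cohomology (degree 2). For $h\in Reg_{\varphi_A}(H,A)$: $\partial_{1,0}(h)=\varphi_A\circ(H\otimes h)$, $\partial_{1,1}(h)=h\circ\mu_H$, $\partial_{1,2}(h)=h\circ\mu_H\circ(H\otimes\Pi_H^L)$. For $\sigma\in Reg_{\varphi_A}(H^2,A)$: $\partial_{2,0}(\sigma)=\varphi_A\circ(H\otimes\sigma)$, $\partial_{2,1}(\sigma)=\sigma\circ(\mu_H\otimes H)$, $\partial_{2,2}(\sigma)=\sigma\circ(H\otimes\mu_H)$, $\partial_{2,3}(\sigma)=\sigma\circ(H\otimes(\mu_H\circ(H\otimes\Pi_H^L)))$. The coboundaries are $D^1_{\varphi_A}(h)=\partial_{1,0}(h)\wedge\partial_{1,1}(h)^{-1}\wedge\partial_{1,2}(h)$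 and $D^2_{\varphi_A}(\sigma)=\partial_{2,0}(\sigma)\wedge\partial_{2,1}(\sigma)^{-1}\wedge\partial_{2,2}(\sigma)\wedge\partial_{2,3}(\sigma)^{-1}$, with values in $Reg_{\varphi_A}(H^2,A)$ and $Reg_{\varphi_A}(H^3,A)$ respectively, and $H^2_{\varphi_A}(H,A)=Ker(D^2_{\varphi_A})/Im(D^1_{\varphi_A})$. For $\alpha\in Reg_{\varphi_A}(H^2,A)$: the 2-cocycle condition is $\partial_{2,3}(\alpha)\wedge\partial_{2,1}(\alpha)=\partial_{2,0}(\alpha)\wedge\partial_{2,2}(\alpha)$; the normal condition is $\alpha\circ(\eta_H\otimes H)=\alpha\circ(H\otimes\eta_H)=u_1$. Weak crossed products. Let $\psi_H^A=(\varphi_A\otimes H)\circ(H\otimes c_{H,A})\circ(\delta_H\otimes A):H\otimes A\to A\otimes H$ and let $\nabla_{A\otimes H}=(\mu_A\otimes H)\circ(A\otimes\psi_H^A)\circ(A\otimes H\otimes\eta_A)$, an idempotent, split as $\nabla_{A\otimes H}=i_{A\otimes H}\circ p_{A\otimes H}$ through an object $A\times H$. For $\alpha$ satisfying the 2-cocycle and normal conditions, put $\sigma^A_{H,\alpha}=(\alpha\otimes\mu_H)\circ\delta_{H^2}$; the weak crossed product $A\otimes_\alpha H$ is $A\otimes H$ with the (associative) product $\mu_{A\otimes_\alpha H}=(\mu_A\otimes H)\circ(\mu_A\otimes\sigma^A_{H,\alpha})\circ(A\otimes\psi_H^A\otimes H)$ and preunit $\nu=\nabla_{A\otimes H}\circ(\eta_A\otimes\eta_H)$.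 Its associated algebra $A\times_\alpha H$ is $A\times H$ with unit $p_{A\otimes H}\circ\nu$ and product $p_{A\otimes H}\circ\mu_{A\otimes_\alpha H}\circ(i_{A\otimes H}\otimes i_{A\otimes H})$; it carries the left $A$-action $p_{A\otimes H}\circ(\mu_A\otimes H)\circ(A\otimes i_{A\otimes H})$ and the right $H$-coaction $(p_{A\otimes H}\otimes H)\circ(A\otimes\delta_H)\circ i_{A\otimes H}$. $A\otimes_\alpha H$ and $A\otimes_\beta H$ are equivalent if there is an isomorphism $\omega:A\times_\alpha H\to A\times_\beta H$ which is a morphism of algebras, of left $A$-modules and of right $H$-comodules. *)

theory Defs
  imports "HOL-Algebra.Coset"
begin

section \<open>Strict symmetric monoidal categories with equalizers\<close>

text \<open>Categories are presented with arrows only: an object is identified with its identity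
  arrow, so \<open>Dom f\<close> and \<open>Cod f\<close> are the identities of the source and target of \<open>f\<close>.  The tensor
  product of arrows restricts to objects, and whiskering \<open>P \<otimes> f\<close>, i.e. \<open>id\<^sub>P \<otimes> f\<close>, is literally the
  tensor of \<open>P\<close> with \<open>f\<close>.  All operations are meaningful on the carrier \<open>Arr\<close> only.\<close>

record 'm smcat =
  Arr :: "'m set"
  Dom :: "'m \<Rightarrow> 'm"
  Cod :: "'m \<Rightarrow> 'm"
  Comp :: "'m \<Rightarrow> 'm \<Rightarrow> 'm"  (infixr "\<cdot>\<index>" 55)
  Tensor :: "'m \<Rightarrow> 'm \<Rightarrow> 'm"  (infixr "\<^bold>\<otimes>\<index>" 65)
  TUnit :: "'m"
  Symm :: "'m \<Rightarrow> 'm \<Rightarrow> 'm"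

definition Obj :: "'m smcat \<Rightarrow> 'm set" where
  "Obj C = {X \<in> Arr C. Dom C X = X \<and> Cod C X = X}"

definition Hom :: "'m smcat \<Rightarrow> 'm \<Rightarrow> 'm \<Rightarrow> 'm set" where
  "Hom C X Y = {f \<in> Arr C. Dom C f = X \<and> Cod C f = Y}"

locale category =
  fixes C :: "'m smcat" (structure)
  assumes Dom_Obj: "f \<in> Arr C \<Longrightarrow> Dom C f \<in> Obj C"
    and Cod_Obj: "f \<in> Arr C \<Longrightarrow> Cod C f \<in> Obj C"
    and comp_Hom: "\<lbrakk>f \<in> Hom C X Y; g \<in> Hom C Y Z\<rbrakk> \<Longrightarrow> g \<cdot> f \<in> Hom C X Z"
    and comp_id_right: "f \<in> Hom C X Y \<Longrightarrow> f \<cdot> X = f"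
    and comp_id_left: "f \<in> Hom C X Y \<Longrightarrow> Y \<cdot> f = f"
    and comp_assoc: "\<lbrakk>f \<in> Hom C W X; g \<in> Hom C X Y; h \<in> Hom C Y Z\<rbrakk>
          \<Longrightarrow> (h \<cdot> g) \<cdot> f = h \<cdot> (g \<cdot> f)"

text \<open>Preservation of identities by the tensor product is the case of \<open>tensor_Hom\<close> in which
  \<open>f\<close> and \<open>g\<close> are objects.  The second hexagon and \<open>c\<^sub>K\<^sub>,\<^sub>X = id\<close> follow from the axioms below.\<close>

locale strict_symmetric_monoidal_category = category C for C :: "'m smcat" (structure) +
  assumes tensor_Hom: "\<lbrakk>f \<in> Hom C X Y; g \<in> Hom C X' Y'\<rbrakk>
            \<Longrightarrow> f \<^bold>\<otimes> g \<in> Hom C (X \<^bold>\<otimes> X') (Y \<^bold>\<otimes> Y')"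
    and interchange: "\<lbrakk>f \<in> Hom C X Y; g \<in> Hom C Y Z; f' \<in> Hom C X' Y'; g' \<in> Hom C Y' Z'\<rbrakk>
          \<Longrightarrow> (g \<cdot> f) \<^bold>\<otimes> (g' \<cdot> f') = (g \<^bold>\<otimes> g') \<cdot> (f \<^bold>\<otimes> f')"
    and tensor_assoc: "\<lbrakk>f \<in> Arr C; g \<in> Arr C; h \<in> Arr C\<rbrakk>
          \<Longrightarrow> (f \<^bold>\<otimes> g) \<^bold>\<otimes> h = f \<^bold>\<otimes> (g \<^bold>\<otimes> h)"
    and TUnit_Obj: "TUnit C \<in> Obj C"
    and tensor_unit_left: "f \<in> Arr C \<Longrightarrow> TUnit C \<^bold>\<otimes> f = f"
    and tensor_unit_right: "f \<in> Arr C \<Longrightarrow> f \<^bold>\<otimes> TUnit C = f"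
    and Symm_Hom: "\<lbrakk>X \<in> Obj C; Y \<in> Obj C\<rbrakk> \<Longrightarrow> Symm C X Y \<in> Hom C (X \<^bold>\<otimes> Y) (Y \<^bold>\<otimes> X)"
    and Symm_natural: "\<lbrakk>f \<in> Hom C X Y; g \<in> Hom C X' Y'\<rbrakk>
          \<Longrightarrow> Symm C Y Y' \<cdot> (f \<^bold>\<otimes> g) = (g \<^bold>\<otimes> f) \<cdot> Symm C X X'"
    and Symm_Symm: "\<lbrakk>X \<in> Obj C; Y \<in> Obj C\<rbrakk> \<Longrightarrow> Symm C Y X \<cdot> Symm C X Y = X \<^bold>\<otimes> Y"
    and Symm_hexagon: "\<lbrakk>X \<in> Obj C; Y \<in> Obj C; Z \<in> Obj C\<rbrakk>
          \<Longrightarrow> Symm C X (Y \<^bold>\<otimes> Z) = (Y \<^bold>\<otimes> Symm C X Z) \<cdot> (Symm C X Y \<^bold>\<otimes> Z)"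

definition is_equalizer :: "'m smcat \<Rightarrow> 'm \<Rightarrow> 'm \<Rightarrow> 'm \<Rightarrow> bool" where
  "is_equalizer C f g e \<longleftrightarrow>
     e \<in> Hom C (Dom C e) (Dom C f) \<and> Comp C f e = Comp C g e \<and>
     (\<forall>Z. \<forall>h \<in> Hom C Z (Dom C f). Comp C f h = Comp C g h \<longrightarrow>
        (\<exists>!k. k \<in> Hom C Z (Dom C e) \<and> Comp C e k = h))"

locale ssm_category_with_equalizers = strict_symmetric_monoidal_category C
  for C :: "'m smcat" (structure) +
  assumes equalizers: "\<lbrakk>f \<in> Hom C X Y; g \<in> Hom C X Y\<rbrakk> \<Longrightarrow> \<exists>e. is_equalizer C f g e"
begin

abbreviation "K \<equiv> TUnit C"
abbreviation "c \<equiv> Symm C"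

definition is_iso :: "'m \<Rightarrow> 'm \<Rightarrow> 'm \<Rightarrow> bool" where
  "is_iso X Y f \<longleftrightarrow> f \<in> Hom C X Y \<and> (\<exists>g \<in> Hom C Y X. g \<cdot> f = X \<and> f \<cdot> g = Y)"

text \<open>\<open>q = i \<circ> p\<close> is a splitting of the idempotent \<open>q\<close> on \<open>Y\<close>; the intermediate object is \<open>Dom i\<close>.\<close>

definition splits :: "'m \<Rightarrow> 'm \<Rightarrow> 'm \<Rightarrow> 'm \<Rightarrow> bool" where
  "splits Y q i p \<longleftrightarrow>
     i \<in> Hom C (Dom C i) Y \<and> p \<in> Hom C Y (Dom C i) \<and> i \<cdot> p = q \<and> p \<cdot> i = Dom C i"

definition is_algebra :: "'m \<Rightarrow> 'm \<Rightarrow> 'm \<Rightarrow> bool" where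
  "is_algebra A \<eta> \<mu> \<longleftrightarrow>
     A \<in> Obj C \<and> \<eta> \<in> Hom C K A \<and> \<mu> \<in> Hom C (A \<^bold>\<otimes> A) A \<and>
     \<mu> \<cdot> (\<eta> \<^bold>\<otimes> A) = A \<and> \<mu> \<cdot> (A \<^bold>\<otimes> \<eta>) = A \<and>
     \<mu> \<cdot> (\<mu> \<^bold>\<otimes> A) = \<mu> \<cdot> (A \<^bold>\<otimes> \<mu>)"

definition is_coalgebra :: "'m \<Rightarrow> 'm \<Rightarrow> 'm \<Rightarrow> bool" where
  "is_coalgebra D \<epsilon> \<delta> \<longleftrightarrow>
     D \<in> Obj C \<and> \<epsilon> \<in> Hom C D K \<and> \<delta> \<in> Hom C D (D \<^bold>\<otimes> D) \<and>
     (\<epsilon> \<^bold>\<otimes> D) \<cdot> \<delta> = D \<and> (D \<^bold>\<otimes> \<epsilon>) \<cdot> \<delta> = D \<and>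
     (\<delta> \<^bold>\<otimes> D) \<cdot> \<delta> = (D \<^bold>\<otimes> \<delta>) \<cdot> \<delta>"

text \<open>The coproduct of the tensor product coalgebra.\<close>

definition tensor_comult :: "'m \<Rightarrow> 'm \<Rightarrow> 'm \<Rightarrow> 'm \<Rightarrow> 'm" where
  "tensor_comult D \<delta>\<^sub>D E \<delta>\<^sub>E = (D \<^bold>\<otimes> c D E \<^bold>\<otimes> E) \<cdot> (\<delta>\<^sub>D \<^bold>\<otimes> \<delta>\<^sub>E)"

text \<open>The convolution \<open>f \<and> g\<close> of morphisms from a coalgebra with coproduct \<open>\<delta>\<close> to an algebra with
  product \<open>\<mu>\<close>.\<close>

definition conv :: "'m \<Rightarrow> 'm \<Rightarrow> 'm \<Rightarrow> 'm \<Rightarrow> 'm" where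
  "conv \<delta> \<mu> f g = \<mu> \<cdot> (f \<^bold>\<otimes> g) \<cdot> \<delta>"

end


section \<open>Weak Hopf algebras\<close>

record 'm alg =
  carrier_obj :: 'm
  unit_mor :: 'm
  mult_mor :: 'm

record 'm bialg = "'m alg" +
  counit_mor :: 'm
  comult_mor :: 'm

locale bialg_data = ssm_category_with_equalizers C
  for C :: "'m smcat" (structure) +
  fixes \<H> :: "'m bialg"
begin

abbreviation "H \<equiv> carrier_obj \<H>"
abbreviation "\<eta>\<^sub>H \<equiv> unit_mor \<H>"
abbreviation "\<mu>\<^sub>H \<equiv> mult_mor \<H>"
abbreviation "\<epsilon>\<^sub>H \<equiv> counit_mor \<H>"
abbreviation "\<delta>\<^sub>H \<equiv> comult_mor \<H>"

definition \<Pi>L :: 'm where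
  "\<Pi>L = ((\<epsilon>\<^sub>H \<cdot> \<mu>\<^sub>H) \<^bold>\<otimes> H) \<cdot> (H \<^bold>\<otimes> c H H) \<cdot> ((\<delta>\<^sub>H \<cdot> \<eta>\<^sub>H) \<^bold>\<otimes> H)"

definition \<Pi>R :: 'm where
  "\<Pi>R = (H \<^bold>\<otimes> (\<epsilon>\<^sub>H \<cdot> \<mu>\<^sub>H)) \<cdot> (c H H \<^bold>\<otimes> H) \<cdot> (H \<^bold>\<otimes> (\<delta>\<^sub>H \<cdot> \<eta>\<^sub>H))"

definition is_antipode :: "'m \<Rightarrow> bool" where
  "is_antipode s \<longleftrightarrow> s \<in> Hom C H H \<and>
     conv \<delta>\<^sub>H \<mu>\<^sub>H H s = \<Pi>L \<and>
     conv \<delta>\<^sub>H \<mu>\<^sub>H s H = \<Pi>R \<and>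
     conv \<delta>\<^sub>H \<mu>\<^sub>H (conv \<delta>\<^sub>H \<mu>\<^sub>H s H) s = s"

text \<open>Tensor powers \<open>H\<^sup>n\<close>, their coproducts and the iterated products \<open>H\<^sup>n \<rightarrow> H\<close>.  Only \<open>n \<ge> 1\<close>
  is used; the values at \<open>0\<close> merely make the functions total.\<close>

fun Hpow :: "nat \<Rightarrow> 'm" where
  "Hpow 0 = K"
| "Hpow (Suc 0) = H"
| "Hpow (Suc (Suc n)) = Hpow (Suc n) \<^bold>\<otimes> H"

fun \<delta>pow :: "nat \<Rightarrow> 'm" where
  "\<delta>pow 0 = K"
| "\<delta>pow (Suc 0) = \<delta>\<^sub>H"
| "\<delta>pow (Suc (Suc n)) = tensor_comult (Hpow (Suc n)) (\<delta>pow (Suc n)) H \<delta>\<^sub>H"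

fun mpow :: "nat \<Rightarrow> 'm" where
  "mpow 0 = \<eta>\<^sub>H"
| "mpow (Suc 0) = H"
| "mpow (Suc (Suc n)) = \<mu>\<^sub>H \<cdot> (mpow (Suc n) \<^bold>\<otimes> H)"

end

locale weak_hopf_algebra = bialg_data C \<H>
  for C :: "'m smcat" (structure) and \<H> :: "'m bialg" +
  assumes H_algebra: "is_algebra H \<eta>\<^sub>H \<mu>\<^sub>H"
    and H_coalgebra: "is_coalgebra H \<epsilon>\<^sub>H \<delta>\<^sub>H"
    and a1: "\<delta>\<^sub>H \<cdot> \<mu>\<^sub>H = (\<mu>\<^sub>H \<^bold>\<otimes> \<mu>\<^sub>H) \<cdot> tensor_comult H \<delta>\<^sub>H H \<delta>\<^sub>H"
    and a2: "\<epsilon>\<^sub>H \<cdot> \<mu>\<^sub>H \<cdot> (\<mu>\<^sub>H \<^bold>\<otimes> H) =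
               (\<epsilon>\<^sub>H \<^bold>\<otimes> \<epsilon>\<^sub>H) \<cdot> (\<mu>\<^sub>H \<^bold>\<otimes> \<mu>\<^sub>H) \<cdot> (H \<^bold>\<otimes> \<delta>\<^sub>H \<^bold>\<otimes> H)"
    and a2': "\<epsilon>\<^sub>H \<cdot> \<mu>\<^sub>H \<cdot> (\<mu>\<^sub>H \<^bold>\<otimes> H) =
               (\<epsilon>\<^sub>H \<^bold>\<otimes> \<epsilon>\<^sub>H) \<cdot> (\<mu>\<^sub>H \<^bold>\<otimes> \<mu>\<^sub>H) \<cdot> (H \<^bold>\<otimes> (c H H \<cdot> \<delta>\<^sub>H) \<^bold>\<otimes> H)"
    and a3: "(\<delta>\<^sub>H \<^bold>\<otimes> H) \<cdot> \<delta>\<^sub>H \<cdot> \<eta>\<^sub>H =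
               (H \<^bold>\<otimes> \<mu>\<^sub>H \<^bold>\<otimes> H) \<cdot> (\<delta>\<^sub>H \<^bold>\<otimes> \<delta>\<^sub>H) \<cdot> (\<eta>\<^sub>H \<^bold>\<otimes> \<eta>\<^sub>H)"
    and a3': "(\<delta>\<^sub>H \<^bold>\<otimes> H) \<cdot> \<delta>\<^sub>H \<cdot> \<eta>\<^sub>H =
               (H \<^bold>\<otimes> (\<mu>\<^sub>H \<cdot> c H H) \<^bold>\<otimes> H) \<cdot> (\<delta>\<^sub>H \<^bold>\<otimes> \<delta>\<^sub>H) \<cdot> (\<eta>\<^sub>H \<^bold>\<otimes> \<eta>\<^sub>H)"
    and a4: "\<exists>s. is_antipode s"

locale cocommutative_weak_hopf_algebra = weak_hopf_algebra C \<H>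
  for C :: "'m smcat" (structure) and \<H> :: "'m bialg" +
  assumes cocommutative: "c H H \<cdot> \<delta>\<^sub>H = \<delta>\<^sub>H"


section \<open>Module algebras, Sweedler cohomology and weak crossed products\<close>

record 'm module_alg = "'m alg" +
  action_mor :: 'm

text \<open>A weak crossed product is given by its product and its preunit on \<open>A \<otimes> H\<close>.\<close>

record 'm crossed_prod =
  cp_mult :: 'm
  cp_preunit :: 'm

locale module_data = bialg_data C \<H>
  for C :: "'m smcat" (structure) and \<H> :: "'m bialg" +
  fixes \<A> :: "'m module_alg"
begin

abbreviation "A \<equiv> carrier_obj \<A>"
abbreviation "\<eta>\<^sub>A \<equiv> unit_mor \<A>"
abbreviation "\<mu>\<^sub>A \<equiv> mult_mor \<A>"
abbreviation "\<phi>\<^sub>A \<equiv> action_mor \<A>"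

subsection \<open>Cohomology\<close>

definition u :: "nat \<Rightarrow> 'm" where
  "u n = \<phi>\<^sub>A \<cdot> (mpow n \<^bold>\<otimes> \<eta>\<^sub>A)"

definition convn :: "nat \<Rightarrow> 'm \<Rightarrow> 'm \<Rightarrow> 'm" where
  "convn n = conv (\<delta>pow n) \<mu>\<^sub>A"

text \<open>The inverse of the group \<open>Reg n\<close> is the \<open>\<sigma>\<^sup>-\<^sup>1\<close> required to exist for its elements.\<close>

definition Reg :: "nat \<Rightarrow> 'm monoid" where
  "Reg n = \<lparr>carrier = {\<sigma> \<in> Hom C (Hpow n) A. \<exists>\<tau> \<in> Hom C (Hpow n) A.
                 convn n \<sigma> \<tau> = u n \<and> convn n \<tau> \<sigma> = u n \<and>
                 convn n (convn n \<sigma> \<tau>) \<sigma> = \<sigma> \<and> convn n (convn n \<tau> \<sigma>) \<tau> = \<tau>},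
            mult = convn n,
            one = u n\<rparr>"

definition d10 :: "'m \<Rightarrow> 'm" where "d10 h = \<phi>\<^sub>A \<cdot> (H \<^bold>\<otimes> h)"
definition d11 :: "'m \<Rightarrow> 'm" where "d11 h = h \<cdot> \<mu>\<^sub>H"
definition d12 :: "'m \<Rightarrow> 'm" where "d12 h = h \<cdot> \<mu>\<^sub>H \<cdot> (H \<^bold>\<otimes> \<Pi>L)"

definition d20 :: "'m \<Rightarrow> 'm" where "d20 \<sigma> = \<phi>\<^sub>A \<cdot> (H \<^bold>\<otimes> \<sigma>)"
definition d21 :: "'m \<Rightarrow> 'm" where "d21 \<sigma> = \<sigma> \<cdot> (\<mu>\<^sub>H \<^bold>\<otimes> H)"
definition d22 :: "'m \<Rightarrow> 'm" where "d22 \<sigma> = \<sigma> \<cdot> (H \<^bold>\<otimes> \<mu>\<^sub>H)"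
definition d23 :: "'m \<Rightarrow> 'm" where "d23 \<sigma> = \<sigma> \<cdot> (H \<^bold>\<otimes> (\<mu>\<^sub>H \<cdot> (H \<^bold>\<otimes> \<Pi>L)))"

definition D1 :: "'m \<Rightarrow> 'm" where
  "D1 h = d10 h \<otimes>\<^bsub>Reg 2\<^esub> (inv\<^bsub>Reg 2\<^esub> (d11 h)) \<otimes>\<^bsub>Reg 2\<^esub> d12 h"

definition D2 :: "'m \<Rightarrow> 'm" where
  "D2 \<sigma> = d20 \<sigma> \<otimes>\<^bsub>Reg 3\<^esub> (inv\<^bsub>Reg 3\<^esub> (d21 \<sigma>)) \<otimes>\<^bsub>Reg 3\<^esub> d22 \<sigma> \<otimes>\<^bsub>Reg 3\<^esub> (inv\<^bsub>Reg 3\<^esub> (d23 \<sigma>))"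

definition Z2 :: "'m monoid" where
  "Z2 = (Reg 2)\<lparr>carrier := kernel (Reg 2) (Reg 3) D2\<rparr>"

definition B2 :: "'m set" where
  "B2 = D1 ` carrier (Reg 1)"

definition H2 :: "'m set monoid" where
  "H2 = Z2 Mod B2"

definition is_cocycle :: "'m \<Rightarrow> bool" where
  "is_cocycle \<alpha> \<longleftrightarrow> convn 3 (d23 \<alpha>) (d21 \<alpha>) = convn 3 (d20 \<alpha>) (d22 \<alpha>)"

definition is_normal :: "'m \<Rightarrow> bool" where
  "is_normal \<alpha> \<longleftrightarrow> \<alpha> \<cdot> (\<eta>\<^sub>H \<^bold>\<otimes> H) = u 1 \<and> \<alpha> \<cdot> (H \<^bold>\<otimes> \<eta>\<^sub>H) = u 1"

definition normal_cocycles :: "'m set" where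
  "normal_cocycles = {\<alpha> \<in> carrier (Reg 2). is_cocycle \<alpha> \<and> is_normal \<alpha>}"

subsection \<open>Weak crossed products\<close>

definition \<psi> :: 'm where
  "\<psi> = (\<phi>\<^sub>A \<^bold>\<otimes> H) \<cdot> (H \<^bold>\<otimes> c H A) \<cdot> (\<delta>\<^sub>H \<^bold>\<otimes> A)"

definition nabla :: 'm where
  "nabla = (\<mu>\<^sub>A \<^bold>\<otimes> H) \<cdot> (A \<^bold>\<otimes> \<psi>) \<cdot> (A \<^bold>\<otimes> H \<^bold>\<otimes> \<eta>\<^sub>A)"

text \<open>One splitting of the idempotent \<open>nabla\<close> is fixed for all cocycles; splittings exist because
  of the equalizers (equalize \<open>nabla\<close> with the identity) and are unique up to isomorphism.\<close>

definition nabla_splitting :: "'m \<times> 'm" where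
  "nabla_splitting = (SOME (i, p). splits (A \<^bold>\<otimes> H) nabla i p)"

definition i_AH :: 'm where "i_AH = fst nabla_splitting"
definition p_AH :: 'm where "p_AH = snd nabla_splitting"
definition AxH :: 'm where "AxH = Dom C i_AH"

definition sigma :: "'m \<Rightarrow> 'm" where
  "sigma \<alpha> = (\<alpha> \<^bold>\<otimes> \<mu>\<^sub>H) \<cdot> \<delta>pow 2"

definition weak_crossed_product :: "'m \<Rightarrow> 'm crossed_prod" where
  "weak_crossed_product \<alpha> =
     \<lparr>cp_mult = (\<mu>\<^sub>A \<^bold>\<otimes> H) \<cdot> (\<mu>\<^sub>A \<^bold>\<otimes> sigma \<alpha>) \<cdot> (A \<^bold>\<otimes> \<psi> \<^bold>\<otimes> H),
      cp_preunit = nabla \<cdot> (\<eta>\<^sub>A \<^bold>\<otimes> \<eta>\<^sub>H)\<rparr>"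

definition associated_algebra :: "'m crossed_prod \<Rightarrow> 'm alg" where
  "associated_algebra P =
     \<lparr>carrier_obj = AxH,
      unit_mor = p_AH \<cdot> cp_preunit P,
      mult_mor = p_AH \<cdot> cp_mult P \<cdot> (i_AH \<^bold>\<otimes> i_AH)\<rparr>"

definition left_action :: 'm where
  "left_action = p_AH \<cdot> (\<mu>\<^sub>A \<^bold>\<otimes> H) \<cdot> (A \<^bold>\<otimes> i_AH)"

definition right_coaction :: 'm where
  "right_coaction = (p_AH \<^bold>\<otimes> H) \<cdot> (A \<^bold>\<otimes> \<delta>\<^sub>H) \<cdot> i_AH"

definition algebra_morphism :: "'m alg \<Rightarrow> 'm alg \<Rightarrow> 'm \<Rightarrow> bool" where
  "algebra_morphism R S \<omega> \<longleftrightarrow>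
     \<omega> \<in> Hom C (carrier_obj R) (carrier_obj S) \<and>
     \<omega> \<cdot> unit_mor R = unit_mor S \<and>
     \<omega> \<cdot> mult_mor R = mult_mor S \<cdot> (\<omega> \<^bold>\<otimes> \<omega>)"

definition equivalent :: "'m crossed_prod \<Rightarrow> 'm crossed_prod \<Rightarrow> bool" where
  "equivalent P Q \<longleftrightarrow>
     (\<exists>\<omega>. is_iso AxH AxH \<omega> \<and>
          algebra_morphism (associated_algebra P) (associated_algebra Q) \<omega> \<and>
          \<omega> \<cdot> left_action = left_action \<cdot> (A \<^bold>\<otimes> \<omega>) \<and>
          right_coaction \<cdot> \<omega> = (\<omega> \<^bold>\<otimes> H) \<cdot> right_coaction)"

definition crossed_products :: "'m crossed_prod set" where
  "crossed_products = weak_crossed_product ` normal_cocycles"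

definition equivalence_rel :: "('m crossed_prod \<times> 'm crossed_prod) set" where
  "equivalence_rel = {(P, Q). P \<in> crossed_products \<and> Q \<in> crossed_products \<and> equivalent P Q}"

definition crossed_product_classes :: "'m crossed_prod set set" where
  "crossed_product_classes = crossed_products // equivalence_rel"

end

locale left_module_algebra =
  weak_hopf_algebra C \<H> + module_data C \<H> \<A>
  for C :: "'m smcat" (structure) and \<H> :: "'m bialg" and \<A> :: "'m module_alg" +
  assumes A_algebra: "is_algebra A \<eta>\<^sub>A \<mu>\<^sub>A"
    and action_Hom: "\<phi>\<^sub>A \<in> Hom C (H \<^bold>\<otimes> A) A"
    and b1: "\<phi>\<^sub>A \<cdot> (\<eta>\<^sub>H \<^bold>\<otimes> A) = A"
    and b2: "\<phi>\<^sub>A \<cdot> (H \<^bold>\<otimes> \<mu>\<^sub>A) =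
               \<mu>\<^sub>A \<cdot> (\<phi>\<^sub>A \<^bold>\<otimes> \<phi>\<^sub>A) \<cdot> (H \<^bold>\<otimes> c H A \<^bold>\<otimes> A) \<cdot> (\<delta>\<^sub>H \<^bold>\<otimes> A \<^bold>\<otimes> A)"
    and b3: "\<phi>\<^sub>A \<cdot> (\<mu>\<^sub>H \<^bold>\<otimes> A) = \<phi>\<^sub>A \<cdot> (H \<^bold>\<otimes> \<phi>\<^sub>A)"
    and b6: "\<phi>\<^sub>A \<cdot> (\<Pi>L \<^bold>\<otimes> \<eta>\<^sub>A) = \<phi>\<^sub>A \<cdot> (H \<^bold>\<otimes> \<eta>\<^sub>A)"

locale commutative_left_module_algebra = left_module_algebra C \<H> \<A>
  for C :: "'m smcat" (structure) and \<H> :: "'m bialg" and \<A> :: "'m module_alg" +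
  assumes commutative: "\<mu>\<^sub>A \<cdot> c A A = \<mu>\<^sub>A"

end

theory Submission
  imports Defs
begin

text \<open>A cocommutative coalgebra \<open>D\<close> is used as a stage of definition: comultiplicative morphisms
  \<open>D \<rightarrow> H\<close> behave like elements of \<open>H\<close>, morphisms \<open>D \<rightarrow> A\<close> like elements of \<open>A\<close>, and tuples of them may
  be permuted and duplicated freely.  An identity between morphisms out of \<open>H\<^sup>n\<close> thus becomes an
  equation about the tautological elements of \<open>H\<^sup>n\<close>, and string diagrams are replaced by algebra.

  Every cocycle \<open>\<alpha>\<close> is made normal by the coboundary of \<open>h(x) = \<alpha>\<^sup>-\<^sup>1(\<Pi>\<^sup>L x, x)\<close>.  An \<open>A\<close>-linear and
  \<open>H\<close>-colinear isomorphism between crossed products has the form \<open>a \<otimes> x \<mapsto> a h(x\<^sub>1) \<otimes> x\<^sub>2\<close> for a unique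
  \<open>h\<close> in \<open>Reg 1\<close>, and comparing coefficients shows that it is multiplicative from the product of \<open>\<alpha>\<close>
  to that of \<open>\<beta>\<close> exactly if \<open>\<alpha> = D1 h \<and> \<beta>\<close>.  Hence two normal cocycles give equivalent crossed
  products exactly if they are cohomologous.\<close>

section \<open>Arrow calculus\<close>

text \<open>In a weak Hopf algebra the unit need not be comultiplicative nor the counit
  multiplicative. Setting a variable to 1 is harmless only where the variable occurs once; where it
  occurs twice, one of the projections \<open>\<Pi>L\<close>, \<open>\<Pi>R\<close> appears. Most of
  the work on \<open>H\<close> consists in controlling these projections. The normalizing cochain
  has a classical model: over a Hopf algebra the cocycle condition at (1, 1, x) shows that sigma(1,
  x) is the constant sigma(1, 1) times eps(x), and one divides by that constant. Here sigma(Pi^L x,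
  x) takes the place of sigma(1, x), and it depends on Pi^L x only. The three factors of
  \<open>D1\<close> are dictated by crossed products: twisting by \<open>h\<close> the result, the
  right or the left factor of a product multiplies the cochain by h(x y), by x h(y) or by h(x), and
  relative to \<open>u 2\<close> the last is \<open>d12 h\<close>. Thus multiplicativity of a twist
  alone is the coboundary equation. An equivalence must also preserve the unit; this is a condition
  on \<open>h\<close> at Pi^L, and it is the normality of both cocycles that enforces it.\<close>

context category
begin

text \<open>Memberships in hom sets are split into conditions on \<open>Arr\<close>, \<open>Dom\<close> and \<open>Cod\<close>, which rewriting can
  decide without guessing intermediate objects.\<close>

lemma Hom_iff [simp]: "f \<in> Hom C X Y \<longleftrightarrow> f \<in> Arr C \<and> Dom C f = X \<and> Cod C f = Y"
  by (simp add: Hom_def)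

lemma Obj_simps [simp]:
  assumes "X \<in> Obj C"
  shows "X \<in> Arr C" "Dom C X = X" "Cod C X = X"
  using assms by (simp_all add: Obj_def)

lemma Dom_Cod_Obj [simp]:
  assumes "f \<in> Arr C"
  shows "Dom C f \<in> Obj C" "Cod C f \<in> Obj C"
  using assms by (simp_all add: Dom_Obj Cod_Obj)

lemma comp_typing [simp]:
  assumes "f \<in> Arr C" "g \<in> Arr C" "Cod C f = Dom C g"
  shows "g \<cdot> f \<in> Arr C" "Dom C (g \<cdot> f) = Dom C f" "Cod C (g \<cdot> f) = Cod C g"
  using comp_Hom [of f "Dom C f" "Cod C f" g "Cod C g"] assms by auto

lemma comp_id [simp]:
  shows "\<lbrakk>X \<in> Obj C; f \<in> Arr C; Cod C f = X\<rbrakk> \<Longrightarrow> X \<cdot> f = f"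
    and "\<lbrakk>X \<in> Obj C; f \<in> Arr C; Dom C f = X\<rbrakk> \<Longrightarrow> f \<cdot> X = f"
  using comp_id_left [of f "Dom C f" X] comp_id_right [of f X "Cod C f"] by simp_all

text \<open>Composites are kept right-associated. A factor to be rewritten in the middle of a
  composite is first bracketed by hand, which accounts for the many explicit uses of this
  rule.\<close>

lemma comp_assoc' [simp]:
  "\<lbrakk>f \<in> Arr C; g \<in> Arr C; h \<in> Arr C; Cod C f = Dom C g; Cod C g = Dom C h\<rbrakk>
    \<Longrightarrow> (h \<cdot> g) \<cdot> f = h \<cdot> (g \<cdot> f)"
  using comp_assoc [of f "Dom C f" "Dom C g" g "Dom C h" h "Cod C h"] by simp

end

section \<open>Consequences of the axioms of a symmetry\<close>

context ssm_category_with_equalizers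
begin

lemma tensor_typing [simp]:
  assumes "f \<in> Arr C" "g \<in> Arr C"
  shows "f \<^bold>\<otimes> g \<in> Arr C" "Dom C (f \<^bold>\<otimes> g) = Dom C f \<^bold>\<otimes> Dom C g"
    "Cod C (f \<^bold>\<otimes> g) = Cod C f \<^bold>\<otimes> Cod C g"
  using tensor_Hom [of f "Dom C f" "Cod C f" g "Dom C g" "Cod C g"] assms by auto

lemma tensor_Obj [simp]:
  assumes "X \<in> Obj C" "Y \<in> Obj C"
  shows "X \<^bold>\<otimes> Y \<in> Obj C"
  unfolding Obj_def using assms by simp

lemma Symm_typing [simp]:
  assumes "X \<in> Obj C" "Y \<in> Obj C"
  shows "c X Y \<in> Arr C" "Dom C (c X Y) = X \<^bold>\<otimes> Y" "Cod C (c X Y) = Y \<^bold>\<otimes> X"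
  using Symm_Hom assms by auto

declare TUnit_Obj [simp] tensor_assoc [simp] tensor_unit_left [simp] tensor_unit_right [simp]

lemma interchange':
  "\<lbrakk>f \<in> Arr C; g \<in> Arr C; f' \<in> Arr C; g' \<in> Arr C; Cod C f = Dom C g; Cod C f' = Dom C g'\<rbrakk>
    \<Longrightarrow> (g \<^bold>\<otimes> g') \<cdot> (f \<^bold>\<otimes> f') = (g \<cdot> f) \<^bold>\<otimes> (g' \<cdot> f')"
  using interchange [of f "Dom C f" "Cod C f" g "Cod C g" f' "Dom C f'" "Cod C f'" g' "Cod C g'"]
  by auto

text \<open>Interchange at the head of a right-associated composite, where the tail \<open>k\<close>
  hides the redex of \<open>interchange'\<close>.\<close>

lemma interchange_comp:
  assumes "f \<in> Arr C" "g \<in> Arr C" "f' \<in> Arr C" "g' \<in> Arr C" "Cod C f = Dom C g" "Cod C f' = Dom C g'"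
    and "k \<in> Arr C" "Cod C k = Dom C f \<^bold>\<otimes> Dom C f'"
  shows "(g \<^bold>\<otimes> g') \<cdot> ((f \<^bold>\<otimes> f') \<cdot> k) = ((g \<cdot> f) \<^bold>\<otimes> (g' \<cdot> f')) \<cdot> k"
proof -
  have "(g \<^bold>\<otimes> g') \<cdot> ((f \<^bold>\<otimes> f') \<cdot> k) = ((g \<^bold>\<otimes> g') \<cdot> (f \<^bold>\<otimes> f')) \<cdot> k"
    using assms by simp
  then show ?thesis using assms interchange' by simp
qed

lemma Symm_natural':
  "\<lbrakk>f \<in> Arr C; g \<in> Arr C; Cod C f = Y; Cod C g = Y'\<rbrakk>
    \<Longrightarrow> c Y Y' \<cdot> (f \<^bold>\<otimes> g) = (g \<^bold>\<otimes> f) \<cdot> c (Dom C f) (Dom C g)"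
  using Symm_natural [of f "Dom C f" Y g "Dom C g" Y'] by auto

text \<open>The hexagon at \<open>Y = Z = K\<close> makes \<open>c X K\<close> idempotent; being
  invertible, it is the identity.\<close>

lemma Symm_unit [simp]:
  assumes "X \<in> Obj C"
  shows "c K X = X" "c X K = X"
proof -
  have *: "c X K = X" if X: "X \<in> Obj C" for X
  proof -
    let ?s = "c X K" and ?t = "c K X"
    have [simp]: "?s \<cdot> ?s = ?s" using Symm_hexagon [of X K K, symmetric] X by simp
    have [simp]: "?t \<cdot> ?s = X" using Symm_Symm [of X K] X by simp
    have "X = ?t \<cdot> (?s \<cdot> ?s)" by simp
    also have "\<dots> = (?t \<cdot> ?s) \<cdot> ?s" using X by (subst comp_assoc') simp_all
    also have "\<dots> = ?s" using X by simp
    finally show ?thesis ..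
  qed
  show "c X K = X" using * assms .
  then show "c K X = X" using Symm_Symm [of X K] assms by simp
qed

text \<open>Both sides are inverse to \<open>c Z (X \<otimes> Y)\<close>, the right one by the first
  hexagon.\<close>

lemma Symm_hexagon':
  assumes "X \<in> Obj C" "Y \<in> Obj C" "Z \<in> Obj C"
  shows "c (X \<^bold>\<otimes> Y) Z = (c X Z \<^bold>\<otimes> Y) \<cdot> (X \<^bold>\<otimes> c Y Z)"
proof -
  let ?a = "c (X \<^bold>\<otimes> Y) Z" and ?b = "c Z (X \<^bold>\<otimes> Y)"
    and ?d = "(c X Z \<^bold>\<otimes> Y) \<cdot> (X \<^bold>\<otimes> c Y Z)"
  have "?b \<cdot> ?d = ((X \<^bold>\<otimes> c Z Y) \<cdot> (c Z X \<^bold>\<otimes> Y)) \<cdot> ?d"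
    using Symm_hexagon [of Z X Y] assms by simp
  also have "\<dots> = (X \<^bold>\<otimes> c Z Y) \<cdot> ((c Z X \<^bold>\<otimes> Y) \<cdot> (c X Z \<^bold>\<otimes> Y)) \<cdot> (X \<^bold>\<otimes> c Y Z)"
    using assms by simp
  also have "(c Z X \<^bold>\<otimes> Y) \<cdot> (c X Z \<^bold>\<otimes> Y) = X \<^bold>\<otimes> Z \<^bold>\<otimes> Y"
    using assms Symm_Symm [of X Z] by (simp add: interchange')
  also have "(X \<^bold>\<otimes> c Z Y) \<cdot> (X \<^bold>\<otimes> Z \<^bold>\<otimes> Y) \<cdot> (X \<^bold>\<otimes> c Y Z) = X \<^bold>\<otimes> Y \<^bold>\<otimes> Z"
    using assms Symm_Symm [of Y Z] by (simp add: interchange')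
  finally have 1: "?b \<cdot> ?d = X \<^bold>\<otimes> Y \<^bold>\<otimes> Z" .
  have 2: "?a \<cdot> ?b = Z \<^bold>\<otimes> X \<^bold>\<otimes> Y" using Symm_Symm [of Z "X \<^bold>\<otimes> Y"] assms by simp
  have "?a = ?a \<cdot> (?b \<cdot> ?d)" unfolding 1 using assms by simp
  also have "\<dots> = (?a \<cdot> ?b) \<cdot> ?d" using assms by simp
  also have "\<dots> = ?d" unfolding 2 using assms by simp
  finally show ?thesis .
qed

text \<open>\<open>pr \<delta> f g\<close> is the pair \<open>(f, g)\<close> of generalized elements at the coalgebra with coproduct \<open>\<delta>\<close>.
  Comultiplicative morphisms are the elements that may be duplicated; they need not be counital,
  so that an element \<open>x\<close> carries its domain of definition, the scalar \<open>\<epsilon> \<cdot> x\<close>.\<close>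

definition pr :: "'m \<Rightarrow> 'm \<Rightarrow> 'm \<Rightarrow> 'm" where
  "pr \<delta> f g = (f \<^bold>\<otimes> g) \<cdot> \<delta>"

definition comultiplicative :: "'m \<Rightarrow> 'm \<Rightarrow> 'm \<Rightarrow> bool" where
  "comultiplicative \<delta> \<delta>' f \<longleftrightarrow> f \<in> Hom C (Dom C \<delta>) (Dom C \<delta>') \<and> \<delta>' \<cdot> f = pr \<delta> f f"

end

section \<open>Generalized elements at a cocommutative coalgebra\<close>

locale stage = ssm_category_with_equalizers C for C :: "'m smcat" (structure) +
  fixes D \<epsilon> \<delta>
  assumes D_Obj [simp]: "D \<in> Obj C"
    and counit_typing [simp]: "\<epsilon> \<in> Arr C" "Dom C \<epsilon> = D" "Cod C \<epsilon> = K"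
    and comult_typing [simp]: "\<delta> \<in> Arr C" "Dom C \<delta> = D" "Cod C \<delta> = D \<^bold>\<otimes> D"
    and counit: "(\<epsilon> \<^bold>\<otimes> D) \<cdot> \<delta> = D"
    and coassoc: "(\<delta> \<^bold>\<otimes> D) \<cdot> \<delta> = (D \<^bold>\<otimes> \<delta>) \<cdot> \<delta>"
    and cocomm: "c D D \<cdot> \<delta> = \<delta>"
begin

lemma pr_typing [simp]:
  assumes "f \<in> Arr C" "g \<in> Arr C" "Dom C f = D" "Dom C g = D"
  shows "pr \<delta> f g \<in> Arr C" "Dom C (pr \<delta> f g) = D" "Cod C (pr \<delta> f g) = Cod C f \<^bold>\<otimes> Cod C g"
  using assms by (simp_all add: pr_def)

lemma tensor_pr [simp]:
  assumes "f \<in> Arr C" "g \<in> Arr C" "Dom C f = D" "Dom C g = D"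
    and "p \<in> Arr C" "q \<in> Arr C" "Dom C p = Cod C f" "Dom C q = Cod C g"
  shows "(p \<^bold>\<otimes> q) \<cdot> pr \<delta> f g = pr \<delta> (p \<cdot> f) (q \<cdot> g)"
  using assms by (simp add: pr_def interchange_comp)

lemma pr_assoc [simp]:
  assumes "f \<in> Arr C" "g \<in> Arr C" "k \<in> Arr C" "Dom C f = D" "Dom C g = D" "Dom C k = D"
  shows "pr \<delta> (pr \<delta> f g) k = pr \<delta> f (pr \<delta> g k)"
proof -
  have "pr \<delta> (pr \<delta> f g) k = ((f \<^bold>\<otimes> g) \<^bold>\<otimes> k) \<cdot> ((\<delta> \<^bold>\<otimes> D) \<cdot> \<delta>)"
    using assms by (simp add: pr_def interchange_comp del: tensor_assoc)
  also have "\<dots> = (f \<^bold>\<otimes> (g \<^bold>\<otimes> k)) \<cdot> ((D \<^bold>\<otimes> \<delta>) \<cdot> \<delta>)"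
    using assms by (simp add: coassoc)
  also have "\<dots> = pr \<delta> f (pr \<delta> g k)"
    using assms by (simp add: pr_def interchange_comp)
  finally show ?thesis .
qed

text \<open>Since \<open>pr_assoc\<close> nests tuples to the right, a left tensor factor that
  consumes two entries is no longer an instance of \<open>tensor_pr\<close>.\<close>

lemma tensor_pr2 [simp]:
  assumes "f \<in> Arr C" "g \<in> Arr C" "k \<in> Arr C" "Dom C f = D" "Dom C g = D" "Dom C k = D"
    and "p \<in> Arr C" "q \<in> Arr C" "Dom C p = Cod C f \<^bold>\<otimes> Cod C g" "Dom C q = Cod C k"
  shows "(p \<^bold>\<otimes> q) \<cdot> pr \<delta> f (pr \<delta> g k) = pr \<delta> (p \<cdot> pr \<delta> f g) (q \<cdot> k)"
proof -
  have "(p \<^bold>\<otimes> q) \<cdot> pr \<delta> (pr \<delta> f g) k = pr \<delta> (p \<cdot> pr \<delta> f g) (q \<cdot> k)"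
    using assms by (intro tensor_pr) simp_all
  then show ?thesis using assms by (simp only: pr_assoc)
qed

text \<open>Naturality moves the symmetry onto the coproduct, where cocommutativity absorbs it. This
  is what allows the entries of a tuple to be permuted.\<close>

lemma Symm_pr [simp]:
  assumes "f \<in> Arr C" "g \<in> Arr C" "Dom C f = D" "Dom C g = D" "Cod C f = X" "Cod C g = Y"
  shows "c X Y \<cdot> pr \<delta> f g = pr \<delta> g f"
proof -
  have [simp]: "X \<in> Obj C" "Y \<in> Obj C" using assms by auto
  have "c X Y \<cdot> pr \<delta> f g = (c X Y \<cdot> (f \<^bold>\<otimes> g)) \<cdot> \<delta>"
    using assms by (simp add: pr_def)
  also have "\<dots> = (g \<^bold>\<otimes> f) \<cdot> (c D D \<cdot> \<delta>)"
    using assms by (simp add: Symm_natural')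
  finally show ?thesis by (simp add: cocomm pr_def)
qed

text \<open>The second law is the first with the entries exchanged, which is why the locale states
  the counit law on one side.\<close>

lemma pr_counit [simp]:
  assumes "f \<in> Arr C" "Dom C f = D"
  shows "pr \<delta> \<epsilon> f = f" "pr \<delta> f \<epsilon> = f"
proof -
  show *: "pr \<delta> \<epsilon> f = f"
  proof -
    have "pr \<delta> \<epsilon> f = (K \<^bold>\<otimes> f) \<cdot> ((\<epsilon> \<^bold>\<otimes> D) \<cdot> \<delta>)"
      using assms by (simp add: pr_def interchange_comp del: tensor_unit_left)
    then show ?thesis using assms by (simp add: counit)
  qed
  show "pr \<delta> f \<epsilon> = f"
    using Symm_pr [of \<epsilon> f K "Cod C f"] * assms by simp
qed

text \<open>A morphism \<open>D \<rightarrow> K\<close> is a scalar. With the next two rules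
  scalars, such as values of a counit, move freely inside a tuple and out of a morphism applied to
  it.\<close>

lemma scalar_pr_right:
  assumes "e \<in> Arr C" "f \<in> Arr C" "Dom C e = D" "Dom C f = D" "Cod C e = K"
  shows "pr \<delta> f e = pr \<delta> e f"
  using Symm_pr [of e f K "Cod C f"] assms by simp

lemma scalar_pr_left_commute:
  assumes "e \<in> Arr C" "f \<in> Arr C" "g \<in> Arr C" "Dom C e = D" "Dom C f = D" "Dom C g = D" "Cod C e = K"
  shows "pr \<delta> f (pr \<delta> e g) = pr \<delta> e (pr \<delta> f g)"
proof -
  have "pr \<delta> (pr \<delta> f e) g = pr \<delta> (pr \<delta> e f) g"
    using assms scalar_pr_right [of e f] by simp
  then show ?thesis using assms by (simp only: pr_assoc)
qed

lemma scalar_comp: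
  assumes "e \<in> Arr C" "f \<in> Arr C" "Dom C e = D" "Dom C f = D" "Cod C e = K"
    and "p \<in> Arr C" "Dom C p = Cod C f"
  shows "p \<cdot> pr \<delta> e f = pr \<delta> e (p \<cdot> f)"
proof -
  have "(K \<^bold>\<otimes> p) \<cdot> pr \<delta> e f = pr \<delta> (K \<cdot> e) (p \<cdot> f)"
    using assms by (intro tensor_pr) simp_all
  then show ?thesis using assms by simp
qed

text \<open>Change of stage along \<open>k\<close>: substitution commutes with duplication because
  \<open>k\<close> is comultiplicative.\<close>

lemma pr_comp:
  assumes "comultiplicative \<delta>' \<delta> k" "f \<in> Arr C" "g \<in> Arr C" "Dom C f = D" "Dom C g = D"
    "\<delta>' \<in> Arr C" "Cod C \<delta>' = Dom C \<delta>' \<^bold>\<otimes> Dom C \<delta>'"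
  shows "pr \<delta> f g \<cdot> k = pr \<delta>' (f \<cdot> k) (g \<cdot> k)"
  using assms by (simp add: pr_def comultiplicative_def interchange_comp)

lemma comultiplicative_id: "comultiplicative \<delta> \<delta> D"
  by (simp add: comultiplicative_def pr_def)

end

section \<open>Tensor products of cocommutative coalgebras\<close>

context ssm_category_with_equalizers
begin

text \<open>Both sides permute \<open>D D E E\<close> into \<open>E D E D\<close>, moving either the
  second \<open>D\<close> past both copies of \<open>E\<close> or the first \<open>E\<close> past
  both copies of \<open>D\<close>. After expansion by the hexagons they differ only in the order of
  two disjoint swaps.\<close>

lemma middle_perm:
  assumes [simp]: "D \<in> Obj C" "E \<in> Obj C"
  shows "(c D E \<^bold>\<otimes> E \<^bold>\<otimes> D) \<cdot> (D \<^bold>\<otimes> c D (E \<^bold>\<otimes> E)) = (E \<^bold>\<otimes> D \<^bold>\<otimes> c D E) \<cdot> (c (D \<^bold>\<otimes> D) E \<^bold>\<otimes> E)"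
proof -
  let ?S = "c D E"
  have 1: "(?S \<^bold>\<otimes> E \<^bold>\<otimes> D) \<cdot> (D \<^bold>\<otimes> E \<^bold>\<otimes> ?S) = ?S \<^bold>\<otimes> ?S"
    using interchange' [of "D \<^bold>\<otimes> E" ?S ?S "E \<^bold>\<otimes> D"] by simp
  have 2: "(E \<^bold>\<otimes> D \<^bold>\<otimes> ?S) \<cdot> (?S \<^bold>\<otimes> D \<^bold>\<otimes> E) = ?S \<^bold>\<otimes> ?S"
    using interchange' [of ?S "E \<^bold>\<otimes> D" "D \<^bold>\<otimes> E" ?S] by simp
  have 3: "D \<^bold>\<otimes> c D (E \<^bold>\<otimes> E) = (D \<^bold>\<otimes> E \<^bold>\<otimes> ?S) \<cdot> (D \<^bold>\<otimes> ?S \<^bold>\<otimes> E)"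
    by (simp add: Symm_hexagon interchange')
  have 4: "c (D \<^bold>\<otimes> D) E \<^bold>\<otimes> E = (?S \<^bold>\<otimes> D \<^bold>\<otimes> E) \<cdot> (D \<^bold>\<otimes> ?S \<^bold>\<otimes> E)"
    using interchange' [of "D \<^bold>\<otimes> ?S" "?S \<^bold>\<otimes> D" E E] by (simp add: Symm_hexagon')
  have "(?S \<^bold>\<otimes> E \<^bold>\<otimes> D) \<cdot> (D \<^bold>\<otimes> c D (E \<^bold>\<otimes> E)) = ((?S \<^bold>\<otimes> E \<^bold>\<otimes> D) \<cdot> (D \<^bold>\<otimes> E \<^bold>\<otimes> ?S)) \<cdot> (D \<^bold>\<otimes> ?S \<^bold>\<otimes> E)"
    unfolding 3 by simp
  also have "\<dots> = ((E \<^bold>\<otimes> D \<^bold>\<otimes> ?S) \<cdot> (?S \<^bold>\<otimes> D \<^bold>\<otimes> E)) \<cdot> (D \<^bold>\<otimes> ?S \<^bold>\<otimes> E)"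
    unfolding 1 2 ..
  also have "\<dots> = (E \<^bold>\<otimes> D \<^bold>\<otimes> ?S) \<cdot> (c (D \<^bold>\<otimes> D) E \<^bold>\<otimes> E)"
    unfolding 4 by simp
  finally show ?thesis .
qed

text \<open>The hexagons expand the block swap into four elementary swaps; the one applied first
  cancels against the given swap.\<close>

lemma double_swap:
  assumes [simp]: "D \<in> Obj C" "E \<in> Obj C"
  shows "c (D \<^bold>\<otimes> E) (D \<^bold>\<otimes> E) \<cdot> (D \<^bold>\<otimes> c D E \<^bold>\<otimes> E) = (D \<^bold>\<otimes> c D E \<^bold>\<otimes> E) \<cdot> (c D D \<^bold>\<otimes> c E E)"
proof -
  have 1: "c (D \<^bold>\<otimes> E) (D \<^bold>\<otimes> E) = (D \<^bold>\<otimes> c (D \<^bold>\<otimes> E) E) \<cdot> (c (D \<^bold>\<otimes> E) D \<^bold>\<otimes> E)"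
    using Symm_hexagon [of "D \<^bold>\<otimes> E" D E] by simp
  have 2: "c (D \<^bold>\<otimes> E) D \<^bold>\<otimes> E = (c D D \<^bold>\<otimes> E \<^bold>\<otimes> E) \<cdot> (D \<^bold>\<otimes> c E D \<^bold>\<otimes> E)"
    using interchange' [of "D \<^bold>\<otimes> c E D" "c D D \<^bold>\<otimes> E" E E] by (simp add: Symm_hexagon')
  have 3: "D \<^bold>\<otimes> c (D \<^bold>\<otimes> E) E = (D \<^bold>\<otimes> c D E \<^bold>\<otimes> E) \<cdot> (D \<^bold>\<otimes> D \<^bold>\<otimes> c E E)"
    by (simp add: Symm_hexagon' interchange')
  have 4: "(D \<^bold>\<otimes> c E D \<^bold>\<otimes> E) \<cdot> (D \<^bold>\<otimes> c D E \<^bold>\<otimes> E) = D \<^bold>\<otimes> D \<^bold>\<otimes> E \<^bold>\<otimes> E"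
    by (simp add: interchange' Symm_Symm)
  have 5: "(D \<^bold>\<otimes> D \<^bold>\<otimes> c E E) \<cdot> (c D D \<^bold>\<otimes> E \<^bold>\<otimes> E) = c D D \<^bold>\<otimes> c E E"
    using interchange' [of "c D D" "D \<^bold>\<otimes> D" "E \<^bold>\<otimes> E" "c E E"] by simp
  have "c (D \<^bold>\<otimes> E) (D \<^bold>\<otimes> E) \<cdot> (D \<^bold>\<otimes> c D E \<^bold>\<otimes> E) =
     (D \<^bold>\<otimes> c D E \<^bold>\<otimes> E) \<cdot> ((D \<^bold>\<otimes> D \<^bold>\<otimes> c E E) \<cdot> (c D D \<^bold>\<otimes> E \<^bold>\<otimes> E)) \<cdot> ((D \<^bold>\<otimes> c E D \<^bold>\<otimes> E) \<cdot> (D \<^bold>\<otimes> c D E \<^bold>\<otimes> E))"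
    unfolding 1 2 3 by simp
  then show ?thesis unfolding 4 5 by simp
qed

lemma whisker_comp:
  assumes "f \<in> Arr C" "g \<in> Arr C" "Cod C f = Dom C g" "X \<in> Obj C" "Y \<in> Obj C"
  shows "X \<^bold>\<otimes> (g \<cdot> f) \<^bold>\<otimes> Y = (X \<^bold>\<otimes> g \<^bold>\<otimes> Y) \<cdot> (X \<^bold>\<otimes> f \<^bold>\<otimes> Y)"
  using assms by (simp add: interchange')

text \<open>This is how variables are adjoined: the tensor product of two stages is a context with
  one variable from each.\<close>

lemma stage_tensor:
  assumes "stage C D \<epsilon> \<delta>" "stage C E \<epsilon>' \<delta>'"
  shows "stage C (D \<^bold>\<otimes> E) (\<epsilon> \<^bold>\<otimes> \<epsilon>') (tensor_comult D \<delta> E \<delta>')"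
proof -
  interpret D: stage C D \<epsilon> \<delta> by fact
  interpret E: stage C E \<epsilon>' \<delta>' by fact
  let ?S = "c D E" and ?\<Delta> = "tensor_comult D \<delta> E \<delta>'"
  note d = tensor_comult_def
  have cu: "(\<epsilon> \<^bold>\<otimes> \<epsilon>' \<^bold>\<otimes> D \<^bold>\<otimes> E) \<cdot> (D \<^bold>\<otimes> ?S \<^bold>\<otimes> E) = \<epsilon> \<^bold>\<otimes> D \<^bold>\<otimes> \<epsilon>' \<^bold>\<otimes> E"
    using Symm_natural' [of D \<epsilon>' D K, symmetric] interchange' [of ?S "\<epsilon>' \<^bold>\<otimes> D" E E]
    by (simp add: interchange')
  have "(\<epsilon> \<^bold>\<otimes> \<epsilon>' \<^bold>\<otimes> D \<^bold>\<otimes> E) \<cdot> ?\<Delta> = ((\<epsilon> \<^bold>\<otimes> \<epsilon>' \<^bold>\<otimes> D \<^bold>\<otimes> E) \<cdot> (D \<^bold>\<otimes> ?S \<^bold>\<otimes> E)) \<cdot> (\<delta> \<^bold>\<otimes> \<delta>')"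
    by (simp add: d)
  also have "\<dots> = D \<^bold>\<otimes> E" unfolding cu
    using interchange' [of \<delta> "\<epsilon> \<^bold>\<otimes> D" \<delta>' "\<epsilon>' \<^bold>\<otimes> E"] by (simp add: D.counit E.counit)
  finally have counit: "((\<epsilon> \<^bold>\<otimes> \<epsilon>') \<^bold>\<otimes> D \<^bold>\<otimes> E) \<cdot> ?\<Delta> = D \<^bold>\<otimes> E" by simp
  have "c (D \<^bold>\<otimes> E) (D \<^bold>\<otimes> E) \<cdot> ?\<Delta> = (c (D \<^bold>\<otimes> E) (D \<^bold>\<otimes> E) \<cdot> (D \<^bold>\<otimes> ?S \<^bold>\<otimes> E)) \<cdot> (\<delta> \<^bold>\<otimes> \<delta>')"
    by (simp add: d)
  also have "\<dots> = (D \<^bold>\<otimes> ?S \<^bold>\<otimes> E) \<cdot> ((c D D \<^bold>\<otimes> c E E) \<cdot> (\<delta> \<^bold>\<otimes> \<delta>'))"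
    by (simp add: double_swap)
  also have "\<dots> = ?\<Delta>" by (simp add: interchange' D.cocomm E.cocomm d)
  finally have cocomm: "c (D \<^bold>\<otimes> E) (D \<^bold>\<otimes> E) \<cdot> ?\<Delta> = ?\<Delta>" .
  \<comment> \<open>On the two sides of coassociativity \<open>l1\<close> and \<open>r1\<close> move
    the coproducts to the right of the symmetries; \<open>perm\<close> compares the permutations
    that remain.\<close>
  have l1: "(\<delta> \<^bold>\<otimes> \<delta>' \<^bold>\<otimes> D \<^bold>\<otimes> E) \<cdot> (D \<^bold>\<otimes> ?S \<^bold>\<otimes> E)
      = (D \<^bold>\<otimes> D \<^bold>\<otimes> c D (E \<^bold>\<otimes> E) \<^bold>\<otimes> E) \<cdot> ((\<delta> \<^bold>\<otimes> D) \<^bold>\<otimes> (\<delta>' \<^bold>\<otimes> E))"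
  proof -
    have "(\<delta> \<^bold>\<otimes> (\<delta>' \<^bold>\<otimes> D) \<^bold>\<otimes> E) \<cdot> (D \<^bold>\<otimes> ?S \<^bold>\<otimes> E) = \<delta> \<^bold>\<otimes> ((\<delta>' \<^bold>\<otimes> D) \<cdot> ?S) \<^bold>\<otimes> E"
      by (simp add: interchange' del: tensor_assoc)
    also have "(\<delta>' \<^bold>\<otimes> D) \<cdot> ?S = c D (E \<^bold>\<otimes> E) \<cdot> (D \<^bold>\<otimes> \<delta>')"
      using Symm_natural' [of D \<delta>' D "E \<^bold>\<otimes> E"] by simp
    also have "\<delta> \<^bold>\<otimes> (c D (E \<^bold>\<otimes> E) \<cdot> (D \<^bold>\<otimes> \<delta>')) \<^bold>\<otimes> E
       = ((D \<^bold>\<otimes> D) \<^bold>\<otimes> c D (E \<^bold>\<otimes> E) \<^bold>\<otimes> E) \<cdot> (\<delta> \<^bold>\<otimes> (D \<^bold>\<otimes> \<delta>') \<^bold>\<otimes> E)"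
      by (simp add: interchange' del: tensor_assoc)
    finally show ?thesis by simp
  qed
  have r1: "(D \<^bold>\<otimes> E \<^bold>\<otimes> \<delta> \<^bold>\<otimes> \<delta>') \<cdot> (D \<^bold>\<otimes> ?S \<^bold>\<otimes> E)
      = (D \<^bold>\<otimes> c (D \<^bold>\<otimes> D) E \<^bold>\<otimes> E \<^bold>\<otimes> E) \<cdot> ((D \<^bold>\<otimes> \<delta>) \<^bold>\<otimes> (E \<^bold>\<otimes> \<delta>'))"
  proof -
    have "(D \<^bold>\<otimes> (E \<^bold>\<otimes> \<delta>) \<^bold>\<otimes> \<delta>') \<cdot> (D \<^bold>\<otimes> ?S \<^bold>\<otimes> E) = D \<^bold>\<otimes> ((E \<^bold>\<otimes> \<delta>) \<cdot> ?S) \<^bold>\<otimes> \<delta>'"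
      by (simp add: interchange' del: tensor_assoc)
    also have "(E \<^bold>\<otimes> \<delta>) \<cdot> ?S = c (D \<^bold>\<otimes> D) E \<cdot> (\<delta> \<^bold>\<otimes> E)"
      using Symm_natural' [of \<delta> E "D \<^bold>\<otimes> D" E] by simp
    also have "D \<^bold>\<otimes> (c (D \<^bold>\<otimes> D) E \<cdot> (\<delta> \<^bold>\<otimes> E)) \<^bold>\<otimes> \<delta>'
       = (D \<^bold>\<otimes> c (D \<^bold>\<otimes> D) E \<^bold>\<otimes> (E \<^bold>\<otimes> E)) \<cdot> (D \<^bold>\<otimes> (\<delta> \<^bold>\<otimes> E) \<^bold>\<otimes> \<delta>')"
      by (simp add: interchange' del: tensor_assoc)
    finally show ?thesis by simp
  qed
  have perm: "(D \<^bold>\<otimes> ?S \<^bold>\<otimes> E \<^bold>\<otimes> D \<^bold>\<otimes> E) \<cdot> (D \<^bold>\<otimes> D \<^bold>\<otimes> c D (E \<^bold>\<otimes> E) \<^bold>\<otimes> E)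
    = (D \<^bold>\<otimes> E \<^bold>\<otimes> D \<^bold>\<otimes> ?S \<^bold>\<otimes> E) \<cdot> (D \<^bold>\<otimes> c (D \<^bold>\<otimes> D) E \<^bold>\<otimes> E \<^bold>\<otimes> E)"
  proof -
    have "(D \<^bold>\<otimes> ?S \<^bold>\<otimes> E \<^bold>\<otimes> D \<^bold>\<otimes> E) \<cdot> (D \<^bold>\<otimes> D \<^bold>\<otimes> c D (E \<^bold>\<otimes> E) \<^bold>\<otimes> E)
      = D \<^bold>\<otimes> ((?S \<^bold>\<otimes> E \<^bold>\<otimes> D) \<cdot> (D \<^bold>\<otimes> c D (E \<^bold>\<otimes> E))) \<^bold>\<otimes> E"
      by (subst whisker_comp) simp_all
    also have "\<dots> = (D \<^bold>\<otimes> E \<^bold>\<otimes> D \<^bold>\<otimes> ?S \<^bold>\<otimes> E) \<cdot> (D \<^bold>\<otimes> c (D \<^bold>\<otimes> D) E \<^bold>\<otimes> E \<^bold>\<otimes> E)"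
      unfolding middle_perm [OF D.D_Obj E.D_Obj]
      by (subst whisker_comp) simp_all
    finally show ?thesis .
  qed
  have l2: "((\<delta> \<^bold>\<otimes> D) \<^bold>\<otimes> (\<delta>' \<^bold>\<otimes> E)) \<cdot> (\<delta> \<^bold>\<otimes> \<delta>') = ((\<delta> \<^bold>\<otimes> D) \<cdot> \<delta>) \<^bold>\<otimes> ((\<delta>' \<^bold>\<otimes> E) \<cdot> \<delta>')"
    by (subst interchange') simp_all
  have r2: "((D \<^bold>\<otimes> \<delta>) \<^bold>\<otimes> (E \<^bold>\<otimes> \<delta>')) \<cdot> (\<delta> \<^bold>\<otimes> \<delta>') = ((\<delta> \<^bold>\<otimes> D) \<cdot> \<delta>) \<^bold>\<otimes> ((\<delta>' \<^bold>\<otimes> E) \<cdot> \<delta>')"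
    by (subst interchange') (simp_all add: D.coassoc E.coassoc)
  have "(?\<Delta> \<^bold>\<otimes> D \<^bold>\<otimes> E) \<cdot> ?\<Delta> = ((D \<^bold>\<otimes> ?S \<^bold>\<otimes> E) \<^bold>\<otimes> (D \<^bold>\<otimes> E)) \<cdot> ((\<delta> \<^bold>\<otimes> \<delta>') \<^bold>\<otimes> (D \<^bold>\<otimes> E)) \<cdot> (D \<^bold>\<otimes> ?S \<^bold>\<otimes> E) \<cdot> (\<delta> \<^bold>\<otimes> \<delta>')"
    by (subst interchange_comp [of "\<delta> \<^bold>\<otimes> \<delta>'" "D \<^bold>\<otimes> ?S \<^bold>\<otimes> E" "D \<^bold>\<otimes> E" "D \<^bold>\<otimes> E"]) (simp_all add: d)
  also have "\<dots> = (D \<^bold>\<otimes> ?S \<^bold>\<otimes> E \<^bold>\<otimes> D \<^bold>\<otimes> E) \<cdot> ((\<delta> \<^bold>\<otimes> \<delta>' \<^bold>\<otimes> D \<^bold>\<otimes> E) \<cdot> (D \<^bold>\<otimes> ?S \<^bold>\<otimes> E)) \<cdot> (\<delta> \<^bold>\<otimes> \<delta>')"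
    by simp
  also have "\<dots> = ((D \<^bold>\<otimes> ?S \<^bold>\<otimes> E \<^bold>\<otimes> D \<^bold>\<otimes> E) \<cdot> (D \<^bold>\<otimes> D \<^bold>\<otimes> c D (E \<^bold>\<otimes> E) \<^bold>\<otimes> E)) \<cdot> (((\<delta> \<^bold>\<otimes> D) \<^bold>\<otimes> (\<delta>' \<^bold>\<otimes> E)) \<cdot> (\<delta> \<^bold>\<otimes> \<delta>'))"
    unfolding l1 by simp
  also have "\<dots> = ((D \<^bold>\<otimes> E \<^bold>\<otimes> D \<^bold>\<otimes> ?S \<^bold>\<otimes> E) \<cdot> (D \<^bold>\<otimes> c (D \<^bold>\<otimes> D) E \<^bold>\<otimes> E \<^bold>\<otimes> E)) \<cdot> (((D \<^bold>\<otimes> \<delta>) \<^bold>\<otimes> (E \<^bold>\<otimes> \<delta>')) \<cdot> (\<delta> \<^bold>\<otimes> \<delta>'))"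
    unfolding perm l2 r2 ..
  also have "\<dots> = (D \<^bold>\<otimes> E \<^bold>\<otimes> D \<^bold>\<otimes> ?S \<^bold>\<otimes> E) \<cdot> ((D \<^bold>\<otimes> E \<^bold>\<otimes> \<delta> \<^bold>\<otimes> \<delta>') \<cdot> (D \<^bold>\<otimes> ?S \<^bold>\<otimes> E)) \<cdot> (\<delta> \<^bold>\<otimes> \<delta>')"
    unfolding r1 by simp
  also have "\<dots> = ((D \<^bold>\<otimes> E) \<^bold>\<otimes> (D \<^bold>\<otimes> ?S \<^bold>\<otimes> E)) \<cdot> ((D \<^bold>\<otimes> E) \<^bold>\<otimes> (\<delta> \<^bold>\<otimes> \<delta>')) \<cdot> (D \<^bold>\<otimes> ?S \<^bold>\<otimes> E) \<cdot> (\<delta> \<^bold>\<otimes> \<delta>')"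
    by simp
  also have "\<dots> = ((D \<^bold>\<otimes> E) \<^bold>\<otimes> ?\<Delta>) \<cdot> ?\<Delta>"
    by (subst interchange_comp [of "D \<^bold>\<otimes> E" "D \<^bold>\<otimes> E" "\<delta> \<^bold>\<otimes> \<delta>'" "D \<^bold>\<otimes> ?S \<^bold>\<otimes> E"]) (simp_all add: d)
  finally have coassoc: "(?\<Delta> \<^bold>\<otimes> D \<^bold>\<otimes> E) \<cdot> ?\<Delta> = ((D \<^bold>\<otimes> E) \<^bold>\<otimes> ?\<Delta>) \<cdot> ?\<Delta>" .
  show ?thesis
  proof unfold_locales
    show "(\<epsilon> \<^bold>\<otimes> \<epsilon>') \<^bold>\<otimes> D \<^bold>\<otimes> E \<cdot> ?\<Delta> = D \<^bold>\<otimes> E" by (rule counit)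
    show "?\<Delta> \<^bold>\<otimes> D \<^bold>\<otimes> E \<cdot> ?\<Delta> = (D \<^bold>\<otimes> E) \<^bold>\<otimes> ?\<Delta> \<cdot> ?\<Delta>" by (rule coassoc)
    show "c (D \<^bold>\<otimes> E) (D \<^bold>\<otimes> E) \<cdot> ?\<Delta> = ?\<Delta>" by (rule cocomm)
  qed (simp_all add: d)
qed

lemma comultiplicative_comp:
  assumes "stage C D \<epsilon> \<delta>" "stage C E \<epsilon>' \<delta>'" "stage C F \<epsilon>'' \<delta>''"
    and "comultiplicative \<delta> \<delta>' k" "comultiplicative \<delta>' \<delta>'' f"
  shows "comultiplicative \<delta> \<delta>'' (f \<cdot> k)"
proof -
  interpret D: stage C D \<epsilon> \<delta> by fact
  interpret E: stage C E \<epsilon>' \<delta>' by fact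
  interpret F: stage C F \<epsilon>'' \<delta>'' by fact
  have [simp]: "k \<in> Arr C" "Dom C k = D" "Cod C k = E" "f \<in> Arr C" "Dom C f = E" "Cod C f = F"
    and eq: "\<delta>'' \<cdot> f = pr \<delta>' f f"
    using assms(4,5) by (simp_all add: comultiplicative_def)
  have "\<delta>'' \<cdot> (f \<cdot> k) = (\<delta>'' \<cdot> f) \<cdot> k" by simp
  also have "\<dots> = pr \<delta> (f \<cdot> k) (f \<cdot> k)"
    unfolding eq by (rule E.pr_comp [OF assms(4)]) simp_all
  finally show ?thesis by (simp add: comultiplicative_def)
qed

definition lproj :: "'m \<Rightarrow> 'm \<Rightarrow> 'm" where "lproj D \<epsilon> = D \<^bold>\<otimes> \<epsilon>"
definition rproj :: "'m \<Rightarrow> 'm \<Rightarrow> 'm" where "rproj \<epsilon> D = \<epsilon> \<^bold>\<otimes> D"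

lemma proj_typing [simp]:
  assumes "D \<in> Obj C" "\<epsilon> \<in> Arr C" "Cod C \<epsilon> = K"
  shows "lproj D \<epsilon> \<in> Arr C" "Dom C (lproj D \<epsilon>) = D \<^bold>\<otimes> Dom C \<epsilon>" "Cod C (lproj D \<epsilon>) = D"
    "rproj \<epsilon> D \<in> Arr C" "Dom C (rproj \<epsilon> D) = Dom C \<epsilon> \<^bold>\<otimes> D" "Cod C (rproj \<epsilon> D) = D"
  using assms by (simp_all add: lproj_def rproj_def)

end

section \<open>Products of stages\<close>

locale two_stages = ssm_category_with_equalizers C + D: stage C D \<epsilon> \<delta> + E: stage C E \<epsilon>' \<delta>'
  for C :: "'m smcat" (structure) and D \<epsilon> \<delta> E \<epsilon>' \<delta>'
begin

abbreviation "\<Delta> \<equiv> tensor_comult D \<delta> E \<delta>'"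

sublocale DE: stage C "D \<^bold>\<otimes> E" "\<epsilon> \<^bold>\<otimes> \<epsilon>'" \<Delta>
  by (rule stage_tensor) unfold_locales

lemma pr_tensor:
  assumes "a \<in> Arr C" "a' \<in> Arr C" "b \<in> Arr C" "b' \<in> Arr C"
    "Dom C a = D" "Dom C a' = D" "Dom C b = E" "Dom C b' = E"
  shows "pr \<Delta> (a \<^bold>\<otimes> b) (a' \<^bold>\<otimes> b') =
    (Cod C a \<^bold>\<otimes> c (Cod C a') (Cod C b) \<^bold>\<otimes> Cod C b') \<cdot> (pr \<delta> a a' \<^bold>\<otimes> pr \<delta>' b b')"
proof -
  let ?S = "Cod C a \<^bold>\<otimes> c (Cod C a') (Cod C b) \<^bold>\<otimes> Cod C b'"
  have "((a \<^bold>\<otimes> (b \<^bold>\<otimes> a')) \<^bold>\<otimes> b') \<cdot> ((D \<^bold>\<otimes> c D E) \<^bold>\<otimes> E) = (a \<^bold>\<otimes> ((b \<^bold>\<otimes> a') \<cdot> c D E)) \<^bold>\<otimes> b'"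
    using assms by (simp add: interchange' del: tensor_assoc)
  also have "(b \<^bold>\<otimes> a') \<cdot> c D E = c (Cod C a') (Cod C b) \<cdot> (a' \<^bold>\<otimes> b)"
    using assms by (simp add: Symm_natural')
  also have "(a \<^bold>\<otimes> (c (Cod C a') (Cod C b) \<cdot> (a' \<^bold>\<otimes> b))) \<^bold>\<otimes> b' =
      ((Cod C a \<^bold>\<otimes> c (Cod C a') (Cod C b)) \<^bold>\<otimes> Cod C b') \<cdot> ((a \<^bold>\<otimes> (a' \<^bold>\<otimes> b)) \<^bold>\<otimes> b')"
    using assms by (simp add: interchange' del: tensor_assoc)
  finally have 1: "(a \<^bold>\<otimes> b \<^bold>\<otimes> a' \<^bold>\<otimes> b') \<cdot> (D \<^bold>\<otimes> c D E \<^bold>\<otimes> E) = ?S \<cdot> (a \<^bold>\<otimes> a' \<^bold>\<otimes> b \<^bold>\<otimes> b')"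
    using assms by simp
  have 2: "(a \<^bold>\<otimes> a' \<^bold>\<otimes> b \<^bold>\<otimes> b') \<cdot> (\<delta> \<^bold>\<otimes> \<delta>') = pr \<delta> a a' \<^bold>\<otimes> pr \<delta>' b b'"
    using interchange' [of \<delta> "a \<^bold>\<otimes> a'" \<delta>' "b \<^bold>\<otimes> b'"] assms by (simp add: pr_def)
  have "pr \<Delta> (a \<^bold>\<otimes> b) (a' \<^bold>\<otimes> b') = ((a \<^bold>\<otimes> b \<^bold>\<otimes> a' \<^bold>\<otimes> b') \<cdot> (D \<^bold>\<otimes> c D E \<^bold>\<otimes> E)) \<cdot> (\<delta> \<^bold>\<otimes> \<delta>')"
    using assms by (simp add: pr_def tensor_comult_def)
  also have "\<dots> = ?S \<cdot> ((a \<^bold>\<otimes> a' \<^bold>\<otimes> b \<^bold>\<otimes> b') \<cdot> (\<delta> \<^bold>\<otimes> \<delta>'))"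
    unfolding 1 using assms by simp
  finally show ?thesis unfolding 2 .
qed

abbreviation "p \<equiv> lproj D \<epsilon>'"
abbreviation "q \<equiv> rproj \<epsilon> E"

lemma pr_id [simp]: "pr \<delta> D D = \<delta>" "pr \<delta>' E E = \<delta>'"
  by (simp_all add: pr_def)

lemma comultiplicative_proj:
  shows "comultiplicative \<Delta> \<delta> p" "comultiplicative \<Delta> \<delta>' q"
  using pr_tensor [of D D \<epsilon>' \<epsilon>'] pr_tensor [of \<epsilon> \<epsilon> E E]
    interchange' [of D \<delta> \<epsilon>' K] interchange' [of \<epsilon> K E \<delta>']
  by (simp_all add: comultiplicative_def lproj_def rproj_def interchange')

lemma pr_proj:
  assumes "f \<in> Arr C" "Dom C f = D" "g \<in> Arr C" "Dom C g = E"
  shows "pr \<Delta> (f \<cdot> p) (g \<cdot> q) = f \<^bold>\<otimes> g"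
proof -
  have "f \<cdot> p = f \<^bold>\<otimes> \<epsilon>'" "g \<cdot> q = \<epsilon> \<^bold>\<otimes> g"
    using assms interchange' [of D f \<epsilon>' K] interchange' [of \<epsilon> K E g]
    by (simp_all add: lproj_def rproj_def)
  then show ?thesis using pr_tensor [of f \<epsilon> \<epsilon>' g] assms by simp
qed

text \<open>Consequently a morphism out of \<open>D \<otimes> E\<close> is determined by its value
  at the pair of tautological elements.\<close>

lemma pr_proj_id: "pr \<Delta> p q = D \<^bold>\<otimes> E"
  using pr_proj [of D E] by simp

text \<open>If one entry depends on the variable from \<open>E\<close> alone, only that variable is
  duplicated. The variable from \<open>D\<close> is used once, so it can later be specialized to the
  unit, which is not comultiplicative.\<close>

lemma pr_rproj:
  assumes "F \<in> Arr C" "Dom C F = D \<^bold>\<otimes> E" "g \<in> Arr C" "Dom C g = E"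
  shows "pr \<Delta> F (g \<cdot> q) = (F \<^bold>\<otimes> g) \<cdot> (D \<^bold>\<otimes> \<delta>')"
proof -
  have "pr \<Delta> F (g \<cdot> q) = (F \<^bold>\<otimes> g) \<cdot> pr \<Delta> (D \<^bold>\<otimes> E) (\<epsilon> \<^bold>\<otimes> E)"
    using assms by (simp add: rproj_def)
  also have "pr \<Delta> (D \<^bold>\<otimes> E) (\<epsilon> \<^bold>\<otimes> E) = D \<^bold>\<otimes> \<delta>'"
    using pr_tensor [of D \<epsilon> E E] by simp
  finally show ?thesis .
qed

end

section \<open>Cocommutative weak bialgebras\<close>

text \<open>For cocommutative \<open>\<delta>\<close> the two forms of (a2) agree and one is
  recorded. The two forms of (a3) remain different; reversing the product exchanges them.\<close>

locale weak_bialgebra = stage C H \<epsilon> \<delta>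
  for C :: "'m smcat" (structure) and H \<epsilon> \<delta> +
  fixes \<eta> \<mu>
  assumes unit_typing [simp]: "\<eta> \<in> Arr C" "Dom C \<eta> = K" "Cod C \<eta> = H"
    and mult_typing [simp]: "\<mu> \<in> Arr C" "Dom C \<mu> = H \<^bold>\<otimes> H" "Cod C \<mu> = H"
    and unit_left: "\<mu> \<cdot> (\<eta> \<^bold>\<otimes> H) = H"
    and unit_right: "\<mu> \<cdot> (H \<^bold>\<otimes> \<eta>) = H"
    and assoc: "\<mu> \<cdot> (\<mu> \<^bold>\<otimes> H) = \<mu> \<cdot> (H \<^bold>\<otimes> \<mu>)"
    and comult_mult: "\<delta> \<cdot> \<mu> = (\<mu> \<^bold>\<otimes> \<mu>) \<cdot> tensor_comult H \<delta> H \<delta>"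
    and counit_mult: "\<epsilon> \<cdot> \<mu> \<cdot> (\<mu> \<^bold>\<otimes> H) = (\<epsilon> \<^bold>\<otimes> \<epsilon>) \<cdot> (\<mu> \<^bold>\<otimes> \<mu>) \<cdot> (H \<^bold>\<otimes> \<delta> \<^bold>\<otimes> H)"
    and comult_unit: "(\<delta> \<^bold>\<otimes> H) \<cdot> \<delta> \<cdot> \<eta> = (H \<^bold>\<otimes> \<mu> \<^bold>\<otimes> H) \<cdot> (\<delta> \<^bold>\<otimes> \<delta>) \<cdot> (\<eta> \<^bold>\<otimes> \<eta>)"
    and comult_unit': "(\<delta> \<^bold>\<otimes> H) \<cdot> \<delta> \<cdot> \<eta> = (H \<^bold>\<otimes> (\<mu> \<cdot> c H H) \<^bold>\<otimes> H) \<cdot> (\<delta> \<^bold>\<otimes> \<delta>) \<cdot> (\<eta> \<^bold>\<otimes> \<eta>)"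
begin

abbreviation "point d x \<equiv> comultiplicative d \<delta> x"

definition target :: 'm where
  "target = ((\<epsilon> \<cdot> \<mu>) \<^bold>\<otimes> H) \<cdot> (H \<^bold>\<otimes> c H H) \<cdot> ((\<delta> \<cdot> \<eta>) \<^bold>\<otimes> H)"

lemma target_typing [simp]: "target \<in> Arr C" "Dom C target = H" "Cod C target = H"
  by (simp_all add: target_def)

end

section \<open>The target projection, computed with elements\<close>

locale weak_bialgebra_stage = weak_bialgebra C H \<epsilon> \<delta> \<eta> \<mu> + S: stage C D e d
  for C :: "'m smcat" (structure) and H \<epsilon> \<delta> \<eta> \<mu> D e d
begin

lemma point_typing:
  assumes "point d x"
  shows "x \<in> Arr C" "Dom C x = D" "Cod C x = H" "\<delta> \<cdot> x = pr d x x"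
  using assms by (simp_all add: comultiplicative_def)

lemma point_mult:
  assumes "point d x" "point d y"
  shows "point d (\<mu> \<cdot> pr d x y)"
proof -
  note [simp] = point_typing [OF assms(1)] point_typing [OF assms(2)]
  have "\<delta> \<cdot> (\<mu> \<cdot> pr d x y) = (\<delta> \<cdot> \<mu>) \<cdot> pr d x y" by simp
  also have "\<dots> = pr d (\<mu> \<cdot> pr d x y) (\<mu> \<cdot> pr d x y)"
    unfolding comult_mult tensor_comult_def by simp
  finally show ?thesis by (simp add: comultiplicative_def)
qed

lemma mult_assoc:
  assumes "x \<in> Arr C" "Dom C x = D" "Cod C x = H" "y \<in> Arr C" "Dom C y = D" "Cod C y = H"
    "z \<in> Arr C" "Dom C z = D" "Cod C z = H"
  shows "\<mu> \<cdot> pr d (\<mu> \<cdot> pr d x y) z = \<mu> \<cdot> pr d x (\<mu> \<cdot> pr d y z)"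
proof -
  have "\<mu> \<cdot> pr d (\<mu> \<cdot> pr d x y) z = (\<mu> \<cdot> (\<mu> \<^bold>\<otimes> H)) \<cdot> pr d x (pr d y z)"
    using assms by simp
  also have "\<dots> = \<mu> \<cdot> pr d x (\<mu> \<cdot> pr d y z)"
    unfolding assoc using assms by simp
  finally show ?thesis .
qed

lemma counit_point:
  assumes "point d x"
  shows "pr d (\<epsilon> \<cdot> x) x = x"
proof -
  note [simp] = point_typing [OF assms(1)]
  have "pr d (\<epsilon> \<cdot> x) x = ((\<epsilon> \<^bold>\<otimes> H) \<cdot> \<delta>) \<cdot> x" by simp
  then show ?thesis unfolding counit by simp
qed

text \<open>Axiom (a2) at elements. The factor that it duplicates is the middle one, whence the
  requirement on \<open>y\<close>.\<close>

lemma counit_mult_point: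
  assumes "point d y" "x \<in> Arr C" "Dom C x = D" "Cod C x = H" "z \<in> Arr C" "Dom C z = D" "Cod C z = H"
  shows "\<epsilon> \<cdot> \<mu> \<cdot> pr d (\<mu> \<cdot> pr d x y) z = pr d (\<epsilon> \<cdot> \<mu> \<cdot> pr d x y) (\<epsilon> \<cdot> \<mu> \<cdot> pr d y z)"
proof -
  note [simp] = point_typing [OF assms(1)] assms(2-)
  have "\<epsilon> \<cdot> \<mu> \<cdot> pr d (\<mu> \<cdot> pr d x y) z = (\<epsilon> \<cdot> \<mu> \<cdot> (\<mu> \<^bold>\<otimes> H)) \<cdot> pr d x (pr d y z)"
    by simp
  also have "\<dots> = pr d (\<epsilon> \<cdot> \<mu> \<cdot> pr d x y) (\<epsilon> \<cdot> \<mu> \<cdot> pr d y z)"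
    unfolding counit_mult by simp
  finally show ?thesis .
qed

sublocale X: two_stages C H \<epsilon> \<delta> D e d by unfold_locales

text \<open>The unit is not comultiplicative, hence not an element.  Statements about it are obtained
  from statements about a generic element \<open>w\<close>, which lives at the stage \<open>H \<otimes> D\<close>, by precomposing with
  \<open>\<eta> \<otimes> D\<close>.  Elements \<open>g\<close> at \<open>D\<close> are transported to this stage as \<open>g \<cdot> lift\<close>.\<close>

abbreviation "w \<equiv> lproj H e"
abbreviation "lift \<equiv> rproj \<epsilon> D"
abbreviation "\<Delta> \<equiv> tensor_comult H \<delta> D d"

lemma point_w: "point \<Delta> w" and lift_comultiplicative: "comultiplicative \<Delta> d lift"
  by (rule X.comultiplicative_proj)+

lemma pr_lift:
  assumes "f \<in> Arr C" "Dom C f = D" "g \<in> Arr C" "Dom C g = D"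
  shows "pr \<Delta> (f \<cdot> lift) (g \<cdot> lift) = pr d f g \<cdot> lift"
  using S.pr_comp [OF lift_comultiplicative, of f g] assms by simp

lemma point_lift:
  assumes "point d x"
  shows "point \<Delta> (x \<cdot> lift)"
  by (rule comultiplicative_comp [OF _ _ _ lift_comultiplicative assms]) unfold_locales

text \<open>The unit may be substituted for \<open>w\<close> inside one entry as long as the other
  entry does not involve \<open>w\<close>; otherwise \<open>w\<close> would be duplicated.\<close>

lemma subst1_pr:
  assumes "F \<in> Arr C" "Dom C F = H \<^bold>\<otimes> D" "g \<in> Arr C" "Dom C g = D"
  shows "pr \<Delta> F (g \<cdot> lift) \<cdot> (\<eta> \<^bold>\<otimes> D) = pr d (F \<cdot> (\<eta> \<^bold>\<otimes> D)) g"
proof -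
  have "(H \<^bold>\<otimes> d) \<cdot> (\<eta> \<^bold>\<otimes> D) = (\<eta> \<^bold>\<otimes> D \<^bold>\<otimes> D) \<cdot> d"
    using interchange' [of \<eta> H D d] interchange' [of K \<eta> d "D \<^bold>\<otimes> D"] by simp
  moreover have "(F \<^bold>\<otimes> g) \<cdot> ((\<eta> \<^bold>\<otimes> D) \<^bold>\<otimes> D) = (F \<cdot> (\<eta> \<^bold>\<otimes> D)) \<^bold>\<otimes> g"
    using assms by (subst interchange') simp_all
  then have "(F \<^bold>\<otimes> g) \<cdot> ((\<eta> \<^bold>\<otimes> D) \<^bold>\<otimes> D) \<cdot> d = pr d (F \<cdot> (\<eta> \<^bold>\<otimes> D)) g"
    using assms comp_assoc' [of d "(\<eta> \<^bold>\<otimes> D) \<^bold>\<otimes> D" "F \<^bold>\<otimes> g"] by (simp add: pr_def)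
  ultimately show ?thesis using assms by (simp add: X.pr_rproj)
qed

lemma subst1_pr':
  assumes "F \<in> Arr C" "Dom C F = H \<^bold>\<otimes> D" "g \<in> Arr C" "Dom C g = D"
  shows "pr \<Delta> (g \<cdot> lift) F \<cdot> (\<eta> \<^bold>\<otimes> D) = pr d g (F \<cdot> (\<eta> \<^bold>\<otimes> D))"
proof -
  have "pr \<Delta> (g \<cdot> lift) F \<cdot> (\<eta> \<^bold>\<otimes> D) = (c (Cod C F) (Cod C g) \<cdot> pr \<Delta> F (g \<cdot> lift)) \<cdot> (\<eta> \<^bold>\<otimes> D)"
    using assms by simp
  also have "\<dots> = c (Cod C F) (Cod C g) \<cdot> pr d (F \<cdot> (\<eta> \<^bold>\<otimes> D)) g"
    using assms subst1_pr [OF assms] by (simp del: S.Symm_pr X.DE.Symm_pr)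
  finally show ?thesis using assms by simp
qed

lemma subst1_w:
  assumes "g \<in> Arr C" "Dom C g = D"
  shows "pr \<Delta> w (g \<cdot> lift) \<cdot> (\<eta> \<^bold>\<otimes> D) = \<eta> \<^bold>\<otimes> g"
  using X.pr_proj [of H g] interchange' [of \<eta> H D g] assms by simp

lemma subst1_mult:
  assumes "g \<in> Arr C" "Dom C g = D" "Cod C g = H"
  shows "\<mu> \<cdot> pr \<Delta> w (g \<cdot> lift) \<cdot> (\<eta> \<^bold>\<otimes> D) = g"
proof -
  have "\<mu> \<cdot> pr \<Delta> w (g \<cdot> lift) \<cdot> (\<eta> \<^bold>\<otimes> D) = (\<mu> \<cdot> (\<eta> \<^bold>\<otimes> H)) \<cdot> g"
    using assms interchange' [of K \<eta> g H] by (simp add: subst1_w)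
  then show ?thesis using assms by (simp add: unit_left)
qed

lemma subst1_mult':
  assumes "g \<in> Arr C" "Dom C g = D" "Cod C g = H"
  shows "\<mu> \<cdot> pr \<Delta> (g \<cdot> lift) w \<cdot> (\<eta> \<^bold>\<otimes> D) = g"
proof -
  have "pr \<Delta> (g \<cdot> lift) w \<cdot> (\<eta> \<^bold>\<otimes> D) = (c H H \<cdot> pr \<Delta> w (g \<cdot> lift)) \<cdot> (\<eta> \<^bold>\<otimes> D)"
    using assms by simp
  also have "\<dots> = c H H \<cdot> (\<eta> \<^bold>\<otimes> g)"
    using assms by (simp add: subst1_w del: X.DE.Symm_pr)
  also have "\<dots> = g \<^bold>\<otimes> \<eta>" using assms by (simp add: Symm_natural')
  also have "g \<^bold>\<otimes> \<eta> = (H \<^bold>\<otimes> \<eta>) \<cdot> g"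
    using interchange' [of g H K \<eta>] assms by simp
  finally have "pr \<Delta> (g \<cdot> lift) w \<cdot> (\<eta> \<^bold>\<otimes> D) = (H \<^bold>\<otimes> \<eta>) \<cdot> g" .
  then have "\<mu> \<cdot> pr \<Delta> (g \<cdot> lift) w \<cdot> (\<eta> \<^bold>\<otimes> D) = (\<mu> \<cdot> (H \<^bold>\<otimes> \<eta>)) \<cdot> g"
    using assms by simp
  then show ?thesis using assms by (simp add: unit_right)
qed

text \<open>The formula Pi^L(x) = eps(1_1 x) 1_2, with the two legs of the coproduct of 1
  represented by a generic \<open>w\<close> that is used twice and only then specialized.\<close>

lemma target_eval:
  assumes "g \<in> Arr C" "Dom C g = D" "Cod C g = H"
  shows "target \<cdot> g = pr \<Delta> (\<epsilon> \<cdot> \<mu> \<cdot> pr \<Delta> w (g \<cdot> lift)) w \<cdot> (\<eta> \<^bold>\<otimes> D)"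
proof -
  note [simp] = assms
  have [simp]: "\<delta> \<cdot> w = pr \<Delta> w w" using point_w by (simp add: comultiplicative_def)
  have "target \<cdot> g = ((\<epsilon> \<cdot> \<mu>) \<^bold>\<otimes> H) \<cdot> (H \<^bold>\<otimes> c H H) \<cdot> ((\<delta> \<^bold>\<otimes> H) \<cdot> (\<eta> \<^bold>\<otimes> g))"
    by (simp add: target_def interchange' [of K _ g H, simplified] interchange')
  also have "\<dots> = (((\<epsilon> \<cdot> \<mu>) \<^bold>\<otimes> H) \<cdot> (H \<^bold>\<otimes> c H H) \<cdot> (\<delta> \<^bold>\<otimes> H) \<cdot> pr \<Delta> w (g \<cdot> lift)) \<cdot> (\<eta> \<^bold>\<otimes> D)"
    by (simp add: subst1_w del: X.DE.tensor_pr X.DE.tensor_pr2 X.DE.Symm_pr)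
  also have "((\<epsilon> \<cdot> \<mu>) \<^bold>\<otimes> H) \<cdot> (H \<^bold>\<otimes> c H H) \<cdot> (\<delta> \<^bold>\<otimes> H) \<cdot> pr \<Delta> w (g \<cdot> lift)
     = pr \<Delta> (\<epsilon> \<cdot> \<mu> \<cdot> pr \<Delta> w (g \<cdot> lift)) w"
    by simp
  finally show ?thesis .
qed

lemma counit_point':
  assumes "point d x"
  shows "pr d x (\<epsilon> \<cdot> x) = x"
  using counit_point [OF assms] point_typing [OF assms] S.scalar_pr_right [of "\<epsilon> \<cdot> x" x] by simp

text \<open>The left side is eps(x w) eps(w y) at w = 1. By (a2), read backwards, this is eps(x w
  y), where \<open>w\<close> occurs once and can be set to 1.\<close>

lemma counit_target:
  assumes "x \<in> Arr C" "Dom C x = D" "Cod C x = H" "y \<in> Arr C" "Dom C y = D" "Cod C y = H"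
  shows "\<epsilon> \<cdot> \<mu> \<cdot> pr d x (target \<cdot> y) = \<epsilon> \<cdot> \<mu> \<cdot> pr d x y"
proof -
  note [simp] = assms
  interpret T: weak_bialgebra_stage C H \<epsilon> \<delta> \<eta> \<mu> "H \<^bold>\<otimes> D" "\<epsilon> \<^bold>\<otimes> e" \<Delta> by unfold_locales
  let ?x = "x \<cdot> lift" and ?y = "y \<cdot> lift"
  let ?s = "\<epsilon> \<cdot> \<mu> \<cdot> pr \<Delta> w ?y"
  have "pr d x (target \<cdot> y) = pr \<Delta> ?x (pr \<Delta> ?s w) \<cdot> (\<eta> \<^bold>\<otimes> D)"
    by (simp add: target_eval subst1_pr')
  also have "pr \<Delta> ?x (pr \<Delta> ?s w) = pr \<Delta> ?s (pr \<Delta> ?x w)"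
    by (rule X.DE.scalar_pr_left_commute) simp_all
  finally have "\<epsilon> \<cdot> \<mu> \<cdot> pr d x (target \<cdot> y) = (\<epsilon> \<cdot> \<mu> \<cdot> pr \<Delta> ?s (pr \<Delta> ?x w)) \<cdot> (\<eta> \<^bold>\<otimes> D)"
    by simp
  also have "\<epsilon> \<cdot> \<mu> \<cdot> pr \<Delta> ?s (pr \<Delta> ?x w) = pr \<Delta> ?s (\<epsilon> \<cdot> \<mu> \<cdot> pr \<Delta> ?x w)"
    by (simp add: X.DE.scalar_comp)
  also have "\<dots> = pr \<Delta> (\<epsilon> \<cdot> \<mu> \<cdot> pr \<Delta> ?x w) ?s"
    by (rule X.DE.scalar_pr_right) simp_all
  also have "\<dots> = \<epsilon> \<cdot> \<mu> \<cdot> pr \<Delta> (\<mu> \<cdot> pr \<Delta> ?x w) ?y"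
    by (rule T.counit_mult_point [symmetric]) (simp_all add: point_w)
  also have "(\<epsilon> \<cdot> \<mu> \<cdot> pr \<Delta> (\<mu> \<cdot> pr \<Delta> ?x w) ?y) \<cdot> (\<eta> \<^bold>\<otimes> D) = \<epsilon> \<cdot> \<mu> \<cdot> pr d x y"
    by (simp add: subst1_pr subst1_mult')
  finally show ?thesis .
qed

text \<open>The left side is eps(w z) w z at w = 1, and the element w z absorbs its own
  counit.\<close>

lemma target_mult:
  assumes "point d z"
  shows "\<mu> \<cdot> pr d (target \<cdot> z) z = z"
proof -
  note [simp] = point_typing [OF assms]
  interpret T: weak_bialgebra_stage C H \<epsilon> \<delta> \<eta> \<mu> "H \<^bold>\<otimes> D" "\<epsilon> \<^bold>\<otimes> e" \<Delta> by unfold_locales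
  let ?z = "z \<cdot> lift"
  let ?s = "\<epsilon> \<cdot> \<mu> \<cdot> pr \<Delta> w ?z"
  have "pr d (target \<cdot> z) z = pr \<Delta> (pr \<Delta> ?s w) ?z \<cdot> (\<eta> \<^bold>\<otimes> D)"
    by (simp add: target_eval subst1_pr del: X.DE.pr_assoc)
  then have "\<mu> \<cdot> pr d (target \<cdot> z) z = (\<mu> \<cdot> pr \<Delta> ?s (pr \<Delta> w ?z)) \<cdot> (\<eta> \<^bold>\<otimes> D)"
    by simp
  also have "\<mu> \<cdot> pr \<Delta> ?s (pr \<Delta> w ?z) = pr \<Delta> ?s (\<mu> \<cdot> pr \<Delta> w ?z)"
    by (simp add: X.DE.scalar_comp)
  also have "\<dots> = \<mu> \<cdot> pr \<Delta> w ?z"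
    by (rule T.counit_point) (intro T.point_mult point_w point_lift assms)
  also have "(\<mu> \<cdot> pr \<Delta> w ?z) \<cdot> (\<eta> \<^bold>\<otimes> D) = z"
    by (simp add: subst1_mult)
  finally show ?thesis .
qed

text \<open>By \<open>target_eval\<close>, \<open>target\<close> depends on its argument only
  through scalars eps(w x y), and by \<open>counit_target\<close> these do not change when y is
  replaced by Pi^L y.\<close>

lemma target_mult_target:
  assumes "x \<in> Arr C" "Dom C x = D" "Cod C x = H" "y \<in> Arr C" "Dom C y = D" "Cod C y = H"
  shows "target \<cdot> \<mu> \<cdot> pr d x (target \<cdot> y) = target \<cdot> \<mu> \<cdot> pr d x y"
proof -
  note [simp] = assms
  interpret T: weak_bialgebra_stage C H \<epsilon> \<delta> \<eta> \<mu> "H \<^bold>\<otimes> D" "\<epsilon> \<^bold>\<otimes> e" \<Delta> by unfold_locales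
  let ?x = "x \<cdot> lift" and ?y = "y \<cdot> lift"
  have "\<epsilon> \<cdot> \<mu> \<cdot> pr \<Delta> w (\<mu> \<cdot> pr \<Delta> ?x (target \<cdot> ?y)) = \<epsilon> \<cdot> \<mu> \<cdot> pr \<Delta> (\<mu> \<cdot> pr \<Delta> w ?x) (target \<cdot> ?y)"
    by (simp add: T.mult_assoc)
  also have "\<dots> = \<epsilon> \<cdot> \<mu> \<cdot> pr \<Delta> (\<mu> \<cdot> pr \<Delta> w ?x) ?y"
    by (rule T.counit_target) simp_all
  also have "\<dots> = \<epsilon> \<cdot> \<mu> \<cdot> pr \<Delta> w (\<mu> \<cdot> pr \<Delta> ?x ?y)"
    by (simp add: T.mult_assoc)
  finally have *: "\<epsilon> \<cdot> \<mu> \<cdot> pr \<Delta> w (\<mu> \<cdot> pr \<Delta> ?x (target \<cdot> ?y)) = \<epsilon> \<cdot> \<mu> \<cdot> pr \<Delta> w (\<mu> \<cdot> pr \<Delta> ?x ?y)" .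
  show ?thesis
    using target_eval [of "\<mu> \<cdot> pr d x (target \<cdot> y)"] target_eval [of "\<mu> \<cdot> pr d x y"] *
      pr_lift [of x "target \<cdot> y"] pr_lift [of x y]
    by simp
qed

end

context weak_bialgebra
begin

lemma target_target: "target \<cdot> target = target"
proof -
  interpret S1: weak_bialgebra_stage C H \<epsilon> \<delta> \<eta> \<mu> H \<epsilon> \<delta> by unfold_locales
  interpret T: weak_bialgebra_stage C H \<epsilon> \<delta> \<eta> \<mu> "H \<^bold>\<otimes> H" "\<epsilon> \<^bold>\<otimes> \<epsilon>" S1.\<Delta> by unfold_locales
  show ?thesis
    using S1.target_eval [of target] S1.target_eval [of H] T.counit_target [of S1.w S1.lift]
    by simp
qed

end

text \<open>The tautological elements \<open>w', z'\<close> of \<open>H \<otimes> H\<close> and \<open>v, w, z\<close> of \<open>H \<otimes> H \<otimes> H\<close>.  They are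
  parameters, hence atomic, to keep rewriting cheap.\<close>

locale weak_bialgebra_cube = weak_bialgebra C H \<epsilon> \<delta> \<eta> \<mu>
  for C :: "'m smcat" (structure) and H \<epsilon> \<delta> \<eta> \<mu> +
  fixes d1 d2 w' z' l v w z
  assumes d1_eq: "d1 = tensor_comult H \<delta> H \<delta>" and d2_eq: "d2 = tensor_comult H \<delta> (H \<^bold>\<otimes> H) d1"
    and w'_eq: "w' = lproj H \<epsilon>" and z'_eq: "z' = rproj \<epsilon> H"
    and v_eq: "v = lproj H (\<epsilon> \<^bold>\<otimes> \<epsilon>)" and l_eq: "l = rproj \<epsilon> (H \<^bold>\<otimes> H)"
    and w_eq: "w = w' \<cdot> l" and z_eq: "z = z' \<cdot> l"
begin

sublocale S1: weak_bialgebra_stage C H \<epsilon> \<delta> \<eta> \<mu> H \<epsilon> \<delta>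
  by unfold_locales

sublocale S2: weak_bialgebra_stage C H \<epsilon> \<delta> \<eta> \<mu> "H \<^bold>\<otimes> H" "\<epsilon> \<^bold>\<otimes> \<epsilon>" d1
  unfolding d1_eq by unfold_locales

sublocale S3: weak_bialgebra_stage C H \<epsilon> \<delta> \<eta> \<mu> "H \<^bold>\<otimes> H \<^bold>\<otimes> H" "\<epsilon> \<^bold>\<otimes> \<epsilon> \<^bold>\<otimes> \<epsilon>" d2
  unfolding d2_eq by unfold_locales

lemma points: "point d1 w'" "point d1 z'" "point d2 v" "point d2 w" "point d2 z"
  unfolding w_eq z_eq w'_eq z'_eq v_eq l_eq d2_eq
  using S1.point_w S1.lift_comultiplicative S2.point_w S2.point_lift [of "S1.w"] S2.point_lift [of "S1.lift"]
  by (simp_all add: d1_eq)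

lemma l_typing [simp]: "l \<in> Arr C" "Dom C l = H \<^bold>\<otimes> H \<^bold>\<otimes> H" "Cod C l = H \<^bold>\<otimes> H"
  by (simp_all add: l_eq)

lemmas coords [simp] = S2.point_typing [OF points(1)] S2.point_typing [OF points(2)]
  S3.point_typing [OF points(3)] S3.point_typing [OF points(4)] S3.point_typing [OF points(5)]

lemmas subst1 = S1.subst1_pr [folded d1_eq z'_eq] S1.subst1_pr' [folded d1_eq z'_eq]
lemmas subst2 = S2.subst1_pr [folded d2_eq l_eq] S2.subst1_pr' [folded d2_eq l_eq]
lemmas subst1_mult = S1.subst1_mult [folded d1_eq w'_eq z'_eq]
lemmas subst2_mult = S2.subst1_mult [folded d2_eq v_eq l_eq]
lemmas target_eval1 = S1.target_eval [folded d1_eq w'_eq z'_eq]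
lemmas target_eval2 = S2.target_eval [folded d2_eq v_eq l_eq]

lemma pr_lift2:
  assumes "f \<in> Arr C" "Dom C f = H \<^bold>\<otimes> H" "g \<in> Arr C" "Dom C g = H \<^bold>\<otimes> H"
  shows "pr d1 f g \<cdot> l = pr d2 (f \<cdot> l) (g \<cdot> l)"
  unfolding d2_eq l_eq using S2.pr_lift [OF assms] by simp

lemma lift_coords [simp]: "w' \<cdot> l = w" "z' \<cdot> l = z"
  by (simp_all add: w_eq z_eq)

lemma pr_coords: "pr d1 w' z' = H \<^bold>\<otimes> H" "pr d2 v (pr d2 w z) = H \<^bold>\<otimes> H \<^bold>\<otimes> H"
proof -
  show 1: "pr d1 w' z' = H \<^bold>\<otimes> H"
    unfolding d1_eq w'_eq z'_eq by (rule S1.X.pr_proj_id)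
  have "pr d2 w z = l" using pr_lift2 [of w' z'] by (simp add: 1)
  then show "pr d2 v (pr d2 w z) = H \<^bold>\<otimes> H \<^bold>\<otimes> H"
    unfolding d2_eq v_eq l_eq using S2.X.pr_proj_id by simp
qed

lemma eq_coords2:
  assumes "f \<in> Arr C" "g \<in> Arr C" "Dom C f = H \<^bold>\<otimes> H" "Dom C g = H \<^bold>\<otimes> H"
    "f \<cdot> pr d1 w' z' = g \<cdot> pr d1 w' z'"
  shows "f = g"
  using assms unfolding pr_coords by simp

lemma eq_coords3:
  assumes "f \<in> Arr C" "g \<in> Arr C" "Dom C f = H \<^bold>\<otimes> H \<^bold>\<otimes> H" "Dom C g = H \<^bold>\<otimes> H \<^bold>\<otimes> H"
    "f \<cdot> pr d2 v (pr d2 w z) = g \<cdot> pr d2 v (pr d2 w z)"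
  shows "f = g"
  using assms unfolding pr_coords by simp

lemma unit_unit: "\<eta> \<^bold>\<otimes> \<eta> \<^bold>\<otimes> H = (\<eta> \<^bold>\<otimes> H \<^bold>\<otimes> H) \<cdot> (\<eta> \<^bold>\<otimes> H)"
  using interchange' [of K \<eta> "\<eta> \<^bold>\<otimes> H" "H \<^bold>\<otimes> H"] by simp

text \<open>Axiom (a3): once \<open>v\<close> and \<open>w\<close> are specialized to the unit, \<open>(v, vw, w)\<close> and \<open>(v, wv, w)\<close> may be
  replaced by \<open>(w, w, w)\<close>.\<close>

lemma comult_unit_subst:
  assumes m: "m = \<mu> \<or> m = \<mu> \<cdot> c H H"
    and P: "P \<in> Arr C" "Dom C P = H \<^bold>\<otimes> H \<^bold>\<otimes> H \<^bold>\<otimes> H"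
  shows "(P \<cdot> pr d2 v (pr d2 (m \<cdot> pr d2 v w) (pr d2 w z))) \<cdot> (\<eta> \<^bold>\<otimes> \<eta> \<^bold>\<otimes> H)
    = (P \<cdot> pr d1 w' (pr d1 w' (pr d1 w' z'))) \<cdot> (\<eta> \<^bold>\<otimes> H)"
proof -
  have [simp]: "m \<in> Arr C" "Dom C m = H \<^bold>\<otimes> H" "Cod C m = H" using m by auto
  let ?Q = "(H \<^bold>\<otimes> m \<^bold>\<otimes> H) \<cdot> (\<delta> \<^bold>\<otimes> \<delta>)"
  have cu: "(\<delta> \<^bold>\<otimes> H) \<cdot> \<delta> \<cdot> \<eta> = ?Q \<cdot> (\<eta> \<^bold>\<otimes> \<eta>)"
    using m comult_unit comult_unit' by auto
  have "pr d2 v (pr d2 (m \<cdot> pr d2 v w) (pr d2 w z)) = (H \<^bold>\<otimes> m \<^bold>\<otimes> H \<^bold>\<otimes> H) \<cdot> (\<delta> \<^bold>\<otimes> \<delta> \<^bold>\<otimes> H) \<cdot> pr d2 v (pr d2 w z)"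
    by simp
  also have "\<dots> = ((H \<^bold>\<otimes> m \<^bold>\<otimes> H) \<^bold>\<otimes> H) \<cdot> ((\<delta> \<^bold>\<otimes> \<delta>) \<^bold>\<otimes> H)"
    unfolding pr_coords by simp
  also have "\<dots> = ?Q \<^bold>\<otimes> H"
    by (subst interchange') simp_all
  finally have 1: "pr d2 v (pr d2 (m \<cdot> pr d2 v w) (pr d2 w z)) = ?Q \<^bold>\<otimes> H" .
  have "pr d1 w' (pr d1 w' (pr d1 w' z')) = (\<delta> \<^bold>\<otimes> H \<^bold>\<otimes> H) \<cdot> (\<delta> \<^bold>\<otimes> H) \<cdot> pr d1 w' z'"
    by simp
  also have "\<dots> = ((\<delta> \<^bold>\<otimes> H) \<^bold>\<otimes> H) \<cdot> (\<delta> \<^bold>\<otimes> H)"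
    unfolding pr_coords by simp
  also have "\<dots> = ((\<delta> \<^bold>\<otimes> H) \<cdot> \<delta>) \<^bold>\<otimes> H"
    by (subst interchange') simp_all
  finally have 2: "pr d1 w' (pr d1 w' (pr d1 w' z')) = ((\<delta> \<^bold>\<otimes> H) \<cdot> \<delta>) \<^bold>\<otimes> H" .
  have "(?Q \<^bold>\<otimes> H) \<cdot> ((\<eta> \<^bold>\<otimes> \<eta>) \<^bold>\<otimes> H) = (?Q \<cdot> (\<eta> \<^bold>\<otimes> \<eta>)) \<^bold>\<otimes> H"
    by (subst interchange') simp_all
  also have "\<dots> = (((\<delta> \<^bold>\<otimes> H) \<cdot> \<delta>) \<^bold>\<otimes> H) \<cdot> (\<eta> \<^bold>\<otimes> H)"
    unfolding cu [symmetric] by (subst interchange') simp_all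
  finally have 3: "(?Q \<^bold>\<otimes> H) \<cdot> (\<eta> \<^bold>\<otimes> \<eta> \<^bold>\<otimes> H) = (((\<delta> \<^bold>\<otimes> H) \<cdot> \<delta>) \<^bold>\<otimes> H) \<cdot> (\<eta> \<^bold>\<otimes> H)" by simp
  have "(P \<cdot> (?Q \<^bold>\<otimes> H)) \<cdot> (\<eta> \<^bold>\<otimes> \<eta> \<^bold>\<otimes> H) = P \<cdot> ((?Q \<^bold>\<otimes> H) \<cdot> (\<eta> \<^bold>\<otimes> \<eta> \<^bold>\<otimes> H))"
    by (rule comp_assoc') (simp_all add: P)
  also have "\<dots> = (P \<cdot> (((\<delta> \<^bold>\<otimes> H) \<cdot> \<delta>) \<^bold>\<otimes> H)) \<cdot> (\<eta> \<^bold>\<otimes> H)"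
    unfolding 3 by (rule comp_assoc' [symmetric]) (simp_all add: P)
  finally show ?thesis unfolding 1 2 .
qed

text \<open>In Sweedler notation, 1_1 z \<otimes> 1_2 = z_1 \<otimes> Pi^L z_2. The triple (v z,
  eps(w v z), w) is evaluated at v = w = 1 in two ways: (a3) merges the two units into one, after
  which the scalar is absorbed; or \<open>v\<close> is set to 1 first and \<open>target\<close>
  appears.\<close>

lemma comult_unit_mult: "(\<mu> \<^bold>\<otimes> H) \<cdot> (H \<^bold>\<otimes> c H H) \<cdot> ((\<delta> \<cdot> \<eta>) \<^bold>\<otimes> H) = (H \<^bold>\<otimes> target) \<cdot> \<delta>"
proof -
  define vz where "vz = \<mu> \<cdot> pr d2 v z"
  have vz: "point d2 vz" unfolding vz_def by (intro S3.point_mult points)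
  note [simp] = S3.point_typing [OF vz]
  define wz where "wz = \<mu> \<cdot> pr d1 w' z'"
  have wz: "point d1 wz" unfolding wz_def by (intro S2.point_mult points)
  note [simp] = S2.point_typing [OF wz]
  \<comment> \<open>\<open>P\<close> sends a tuple (a, b, d, z) to (a z, eps(b z), d).\<close>
  define P where "P = (\<mu> \<^bold>\<otimes> (\<epsilon> \<cdot> \<mu>) \<^bold>\<otimes> H) \<cdot> (H \<^bold>\<otimes> c H H \<^bold>\<otimes> c H H) \<cdot> (H \<^bold>\<otimes> H \<^bold>\<otimes> c H H \<^bold>\<otimes> H) \<cdot> (H \<^bold>\<otimes> H \<^bold>\<otimes> H \<^bold>\<otimes> \<delta>)"
  have [simp]: "P \<in> Arr C" "Dom C P = H \<^bold>\<otimes> H \<^bold>\<otimes> H \<^bold>\<otimes> H" "Cod C P = H \<^bold>\<otimes> H" by (simp_all add: P_def)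
  let ?E = "pr d2 vz (pr d2 (\<epsilon> \<cdot> \<mu> \<cdot> pr d2 w vz) w)"
  have assoc: "\<mu> \<cdot> pr d2 (\<mu> \<cdot> pr d2 w v) z = \<mu> \<cdot> pr d2 w vz"
    unfolding vz_def by (rule S3.mult_assoc) simp_all
  have P1: "P \<cdot> pr d2 v (pr d2 ((\<mu> \<cdot> c H H) \<cdot> pr d2 v w) (pr d2 w z)) = ?E"
    using assoc by (simp add: vz_def [symmetric] P_def)
  have P2: "P \<cdot> pr d1 w' (pr d1 w' (pr d1 w' z')) = pr d1 (pr d1 wz (\<epsilon> \<cdot> wz)) w'"
    by (simp add: wz_def P_def)
  have "?E \<cdot> (\<eta> \<^bold>\<otimes> \<eta> \<^bold>\<otimes> H) = pr d1 (pr d1 wz (\<epsilon> \<cdot> wz)) w' \<cdot> (\<eta> \<^bold>\<otimes> H)"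
    unfolding P1 [symmetric] P2 [symmetric] by (rule comult_unit_subst) simp_all
  also have "pr d1 (pr d1 wz (\<epsilon> \<cdot> wz)) w' = pr d1 wz w'"
    by (simp only: S2.counit_point' [OF wz])
  also have "\<dots> = (\<mu> \<^bold>\<otimes> H) \<cdot> (H \<^bold>\<otimes> c H H) \<cdot> (\<delta> \<^bold>\<otimes> H) \<cdot> pr d1 w' z'"
    by (simp add: wz_def)
  also have "\<dots> = (\<mu> \<^bold>\<otimes> H) \<cdot> (H \<^bold>\<otimes> c H H) \<cdot> (\<delta> \<^bold>\<otimes> H)"
    unfolding pr_coords by simp
  also have "\<dots> \<cdot> (\<eta> \<^bold>\<otimes> H) = (\<mu> \<^bold>\<otimes> H) \<cdot> (H \<^bold>\<otimes> c H H) \<cdot> ((\<delta> \<cdot> \<eta>) \<^bold>\<otimes> H)"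
    by (simp add: interchange')
  finally have 1: "?E \<cdot> (\<eta> \<^bold>\<otimes> \<eta> \<^bold>\<otimes> H) = (\<mu> \<^bold>\<otimes> H) \<cdot> (H \<^bold>\<otimes> c H H) \<cdot> ((\<delta> \<cdot> \<eta>) \<^bold>\<otimes> H)" .
  \<comment> \<open>Written as a function of the pair (v z, w), \<open>?E\<close> contains
    \<open>v\<close> only once, so that \<open>v\<close> can be set to the unit on its own.\<close>
  let ?R = "(H \<^bold>\<otimes> (\<epsilon> \<cdot> \<mu> \<cdot> c H H) \<^bold>\<otimes> H) \<cdot> (\<delta> \<^bold>\<otimes> \<delta>)"
  have "?E = ?R \<cdot> pr d2 vz w" by simp
  then have "?E \<cdot> (\<eta> \<^bold>\<otimes> H \<^bold>\<otimes> H) = (?R \<cdot> pr d2 vz w) \<cdot> (\<eta> \<^bold>\<otimes> H \<^bold>\<otimes> H)"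
    by (simp only:)
  also have "\<dots> = ?R \<cdot> (pr d2 vz w \<cdot> (\<eta> \<^bold>\<otimes> H \<^bold>\<otimes> H))"
    by (rule comp_assoc') simp_all
  also have "pr d2 vz w \<cdot> (\<eta> \<^bold>\<otimes> H \<^bold>\<otimes> H) = pr d1 z' w'"
    using subst2(1) [of vz w'] subst2_mult [of z'] by (simp add: vz_def)
  also have "?R \<cdot> pr d1 z' w' = pr d1 (H \<cdot> z') (pr d1 (\<epsilon> \<cdot> \<mu> \<cdot> pr d1 w' (H \<cdot> z')) w')"
    by simp
  finally have 2: "?E \<cdot> (\<eta> \<^bold>\<otimes> H \<^bold>\<otimes> H) = \<dots>" .
  have "?E \<cdot> (\<eta> \<^bold>\<otimes> \<eta> \<^bold>\<otimes> H) = (?E \<cdot> (\<eta> \<^bold>\<otimes> H \<^bold>\<otimes> H)) \<cdot> (\<eta> \<^bold>\<otimes> H)"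
    unfolding unit_unit by (rule comp_assoc' [symmetric]) simp_all
  also have "\<dots> = pr \<delta> H (pr d1 (\<epsilon> \<cdot> \<mu> \<cdot> pr d1 w' (H \<cdot> z')) w' \<cdot> (\<eta> \<^bold>\<otimes> H))"
    unfolding 2 by (rule subst1(2)) simp_all
  also have "pr d1 (\<epsilon> \<cdot> \<mu> \<cdot> pr d1 w' (H \<cdot> z')) w' \<cdot> (\<eta> \<^bold>\<otimes> H) = target \<cdot> H"
    by (rule target_eval1 [symmetric]) simp_all
  also have "pr \<delta> H (target \<cdot> H) = (H \<^bold>\<otimes> target) \<cdot> \<delta>" by (simp add: pr_def)
  finally show ?thesis using 1 by simp
qed

end

context weak_bialgebra
begin

lemma cube: "weak_bialgebra_cube C H \<epsilon> \<delta> \<eta> \<mu> (tensor_comult H \<delta> H \<delta>)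
  (tensor_comult H \<delta> (H \<^bold>\<otimes> H) (tensor_comult H \<delta> H \<delta>)) (lproj H \<epsilon>) (rproj \<epsilon> H)
  (rproj \<epsilon> (H \<^bold>\<otimes> H)) (lproj H (\<epsilon> \<^bold>\<otimes> \<epsilon>)) (lproj H \<epsilon> \<cdot> rproj \<epsilon> (H \<^bold>\<otimes> H)) (rproj \<epsilon> H \<cdot> rproj \<epsilon> (H \<^bold>\<otimes> H))"
  by unfold_locales simp_all

lemmas comult_unit_mult = weak_bialgebra_cube.comult_unit_mult [OF cube]

end

context weak_bialgebra_stage
begin

text \<open>Here \<open>w\<close> occurs in both entries, and setting it to 1 costs a
  \<open>target\<close>.\<close>

lemma subst1_mult_unit:
  assumes "point d z"
  shows "pr \<Delta> (\<mu> \<cdot> pr \<Delta> w (z \<cdot> lift)) w \<cdot> (\<eta> \<^bold>\<otimes> D) = pr d z (target \<cdot> z)"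
proof -
  note [simp] = point_typing [OF assms]
  have [simp]: "\<delta> \<cdot> w = pr \<Delta> w w" using point_w by (simp add: comultiplicative_def)
  have "pr \<Delta> (\<mu> \<cdot> pr \<Delta> w (z \<cdot> lift)) w = ((\<mu> \<^bold>\<otimes> H) \<cdot> (H \<^bold>\<otimes> c H H) \<cdot> (\<delta> \<^bold>\<otimes> H)) \<cdot> pr \<Delta> w (z \<cdot> lift)"
    by simp
  then have "pr \<Delta> (\<mu> \<cdot> pr \<Delta> w (z \<cdot> lift)) w \<cdot> (\<eta> \<^bold>\<otimes> D)
     = ((\<mu> \<^bold>\<otimes> H) \<cdot> (H \<^bold>\<otimes> c H H) \<cdot> (\<delta> \<^bold>\<otimes> H)) \<cdot> (\<eta> \<^bold>\<otimes> z)"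
    by (simp add: subst1_w del: X.DE.tensor_pr X.DE.tensor_pr2 X.DE.Symm_pr)
  also have "\<dots> = ((\<mu> \<^bold>\<otimes> H) \<cdot> (H \<^bold>\<otimes> c H H) \<cdot> ((\<delta> \<cdot> \<eta>) \<^bold>\<otimes> H)) \<cdot> z"
    using interchange' [of K "\<delta> \<cdot> \<eta>" z H] by (simp add: interchange')
  also have "\<dots> = pr d z (target \<cdot> z)"
    unfolding comult_unit_mult by simp
  finally show ?thesis .
qed

end

section \<open>Comultiplicativity of the projections; reversal of the product\<close>

context weak_bialgebra_cube
begin

text \<open>Both sides are (v, eps(v w z), w) at v = w = 1. For the tensor square of
  \<open>target\<close> this comes from \<open>comult_unit_mult\<close>; for its coproduct, (a3)
  replaces (v, v w, w) by (w, w, w). As a consequence Pi^L x is again an element that can be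
  duplicated.\<close>

lemma point_target: "point \<delta> target"
proof -
  define wz where "wz = \<mu> \<cdot> pr d1 w' z'"
  have wz: "point d1 wz" unfolding wz_def by (intro S2.point_mult points)
  note [simp] = S2.point_typing [OF wz]
  define s where "s = \<epsilon> \<cdot> \<mu> \<cdot> pr d2 v (\<mu> \<cdot> pr d2 w z)"
  have [simp]: "s \<in> Arr C" "Dom C s = H \<^bold>\<otimes> H \<^bold>\<otimes> H" "Cod C s = K" by (simp_all add: s_def)
  define t where "t = \<epsilon> \<cdot> \<mu> \<cdot> pr d1 w' (H \<cdot> z')"
  have [simp]: "t \<in> Arr C" "Dom C t = H \<^bold>\<otimes> H" "Cod C t = K" by (simp_all add: t_def)
  have wz_lift: "wz \<cdot> l = \<mu> \<cdot> pr d2 w z" using pr_lift2 [of w' z'] by (simp add: wz_def)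
  have "pr \<delta> target target = (target \<^bold>\<otimes> H) \<cdot> pr \<delta> H (target \<cdot> H)"
    by simp
  also have "pr \<delta> H (target \<cdot> H) = pr d1 (\<mu> \<cdot> pr d1 w' (H \<cdot> z')) w' \<cdot> (\<eta> \<^bold>\<otimes> H)"
    by (rule S1.subst1_mult_unit [folded d1_eq w'_eq z'_eq, OF comultiplicative_id, symmetric])
  also have "(target \<^bold>\<otimes> H) \<cdot> pr d1 (\<mu> \<cdot> pr d1 w' (H \<cdot> z')) w' \<cdot> (\<eta> \<^bold>\<otimes> H)
     = ((target \<^bold>\<otimes> H) \<cdot> pr d1 wz w') \<cdot> (\<eta> \<^bold>\<otimes> H)"
    by (subst comp_assoc') (simp_all add: wz_def)
  also have "(target \<^bold>\<otimes> H) \<cdot> pr d1 wz w' = pr d1 (target \<cdot> wz) w'"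
    by simp
  also have "target \<cdot> wz = pr d2 s v \<cdot> (\<eta> \<^bold>\<otimes> H \<^bold>\<otimes> H)"
    using target_eval2 [of wz] by (simp add: wz_lift s_def)
  also have "pr d1 (pr d2 s v \<cdot> (\<eta> \<^bold>\<otimes> H \<^bold>\<otimes> H)) w' = pr d2 (pr d2 s v) w \<cdot> (\<eta> \<^bold>\<otimes> H \<^bold>\<otimes> H)"
    using subst2(1) [of "pr d2 s v" w'] by simp
  also have "pr d2 (pr d2 s v) w = pr d2 v (pr d2 s w)"
    using S3.S.scalar_pr_left_commute [of s v w] by simp
  finally have 1: "pr \<delta> target target = (pr d2 v (pr d2 s w) \<cdot> (\<eta> \<^bold>\<otimes> H \<^bold>\<otimes> H)) \<cdot> (\<eta> \<^bold>\<otimes> H)" .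
  define P where "P = (H \<^bold>\<otimes> (\<epsilon> \<cdot> \<mu>) \<^bold>\<otimes> H) \<cdot> (H \<^bold>\<otimes> H \<^bold>\<otimes> c H H)"
  have [simp]: "P \<in> Arr C" "Dom C P = H \<^bold>\<otimes> H \<^bold>\<otimes> H \<^bold>\<otimes> H" "Cod C P = H \<^bold>\<otimes> H" by (simp_all add: P_def)
  have P1: "P \<cdot> pr d2 v (pr d2 (\<mu> \<cdot> pr d2 v w) (pr d2 w z)) = pr d2 v (pr d2 s w)"
    using S3.mult_assoc [of v w z] by (simp add: s_def P_def)
  have P2: "P \<cdot> pr d1 w' (pr d1 w' (pr d1 w' z')) = pr d1 w' (pr d1 t w')"
    by (simp add: t_def P_def)
  have "\<delta> \<cdot> target = \<delta> \<cdot> (target \<cdot> H)" by simp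
  also have "target \<cdot> H = pr d1 t w' \<cdot> (\<eta> \<^bold>\<otimes> H)"
    unfolding t_def by (rule target_eval1) simp_all
  also have "\<delta> \<cdot> pr d1 t w' \<cdot> (\<eta> \<^bold>\<otimes> H) = (\<delta> \<cdot> pr d1 t w') \<cdot> (\<eta> \<^bold>\<otimes> H)"
    by (rule comp_assoc' [symmetric]) simp_all
  also have "\<delta> \<cdot> pr d1 t w' = pr d1 t (pr d1 w' w')"
    using S2.S.scalar_comp [of t w' \<delta>] by simp
  also have "\<dots> = pr d1 w' (pr d1 t w')"
    by (rule S2.S.scalar_pr_left_commute [symmetric]) simp_all
  also have "\<dots> \<cdot> (\<eta> \<^bold>\<otimes> H) = pr d2 v (pr d2 s w) \<cdot> (\<eta> \<^bold>\<otimes> \<eta> \<^bold>\<otimes> H)"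
    unfolding P1 [symmetric] P2 [symmetric] by (rule comult_unit_subst [symmetric]) simp_all
  also have "\<dots> = pr \<delta> target target"
    unfolding 1 unit_unit by (rule comp_assoc' [symmetric]) simp_all
  finally show ?thesis by (simp add: comultiplicative_def)
qed

text \<open>Reversal exchanges the two forms of (a3) and preserves (a2) because scalars commute.
  Every fact about \<open>target\<close> thereby has a mirror image.\<close>

lemma opposite: "weak_bialgebra C H \<epsilon> \<delta> \<eta> (\<mu> \<cdot> c H H)"
proof unfold_locales
  let ?m = "\<mu> \<cdot> c H H"
  show "?m \<cdot> (\<eta> \<^bold>\<otimes> H) = H" "?m \<cdot> (H \<^bold>\<otimes> \<eta>) = H"
    by (simp_all add: Symm_natural' unit_left unit_right)
  show "?m \<cdot> (?m \<^bold>\<otimes> H) = ?m \<cdot> (H \<^bold>\<otimes> ?m)"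
    by (rule eq_coords3) (simp_all add: S3.mult_assoc)
  show "\<delta> \<cdot> ?m = (?m \<^bold>\<otimes> ?m) \<cdot> tensor_comult H \<delta> H \<delta>"
  proof (rule eq_coords2)
    show "(\<delta> \<cdot> ?m) \<cdot> pr d1 w' z' = ((?m \<^bold>\<otimes> ?m) \<cdot> tensor_comult H \<delta> H \<delta>) \<cdot> pr d1 w' z'"
      using S2.point_mult [OF points(2,1)] by (simp add: comultiplicative_def tensor_comult_def [of H \<delta> H \<delta>])
  qed simp_all
  show "\<epsilon> \<cdot> ?m \<cdot> (?m \<^bold>\<otimes> H) = (\<epsilon> \<^bold>\<otimes> \<epsilon>) \<cdot> (?m \<^bold>\<otimes> ?m) \<cdot> (H \<^bold>\<otimes> \<delta> \<^bold>\<otimes> H)"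
  proof (rule eq_coords3)
    show "(\<epsilon> \<cdot> ?m \<cdot> (?m \<^bold>\<otimes> H)) \<cdot> pr d2 v (pr d2 w z)
        = ((\<epsilon> \<^bold>\<otimes> \<epsilon>) \<cdot> (?m \<^bold>\<otimes> ?m) \<cdot> (H \<^bold>\<otimes> \<delta> \<^bold>\<otimes> H)) \<cdot> pr d2 v (pr d2 w z)"
      using S3.counit_mult_point [OF points(4), of z v] S3.mult_assoc [of z w v]
        S3.S.scalar_pr_right [of "\<epsilon> \<cdot> \<mu> \<cdot> pr d2 z w" "\<epsilon> \<cdot> \<mu> \<cdot> pr d2 w v"]
      by simp
  qed simp_all
  show "(\<delta> \<^bold>\<otimes> H) \<cdot> \<delta> \<cdot> \<eta> = (H \<^bold>\<otimes> ?m \<^bold>\<otimes> H) \<cdot> (\<delta> \<^bold>\<otimes> \<delta>) \<cdot> (\<eta> \<^bold>\<otimes> \<eta>)"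
    by (rule comult_unit')
  show "(\<delta> \<^bold>\<otimes> H) \<cdot> \<delta> \<cdot> \<eta> = (H \<^bold>\<otimes> (?m \<cdot> c H H) \<^bold>\<otimes> H) \<cdot> (\<delta> \<^bold>\<otimes> \<delta>) \<cdot> (\<eta> \<^bold>\<otimes> \<eta>)"
    using comult_unit Symm_Symm [of H H] by simp
qed simp_all

end

context weak_bialgebra
begin

lemmas point_target = weak_bialgebra_cube.point_target [OF cube]
lemmas opposite = weak_bialgebra_cube.opposite [OF cube]

text \<open>\<open>target\<close> and \<open>source\<close> are \<open>\<Pi>\<^sup>L\<close> and \<open>\<Pi>\<^sup>R\<close>.  Reversing the product of \<open>H\<close> exchanges them, so facts
  about \<open>source\<close> come from \<open>opposite\<close>.\<close>

definition source :: 'm where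
  "source = (H \<^bold>\<otimes> (\<epsilon> \<cdot> \<mu>)) \<cdot> (c H H \<^bold>\<otimes> H) \<cdot> (H \<^bold>\<otimes> (\<delta> \<cdot> \<eta>))"

text \<open>Naturality carries the free strand across \<open>\<delta> \<cdot> \<eta>\<close> and
  across the counit of the product. Of the crossings left over, one is absorbed by cocommutativity
  and one reverses the product.\<close>

lemma source_eq: "source = weak_bialgebra.target C H \<epsilon> \<delta> \<eta> (\<mu> \<cdot> c H H)"
proof -
  interpret O: weak_bialgebra C H \<epsilon> \<delta> \<eta> "\<mu> \<cdot> c H H" by (rule opposite)
  have co: "c H H \<cdot> \<delta> \<cdot> \<eta> = \<delta> \<cdot> \<eta>"
    using cocomm comp_assoc' [of \<eta> \<delta> "c H H"] by simp
  let ?e = "\<epsilon> \<cdot> \<mu>"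
  have "source = (H \<^bold>\<otimes> ?e) \<cdot> (c H H \<^bold>\<otimes> H) \<cdot> (H \<^bold>\<otimes> (\<delta> \<cdot> \<eta>))" by (simp add: source_def)
  also have "\<dots> = (H \<^bold>\<otimes> ?e) \<cdot> (c H H \<^bold>\<otimes> H) \<cdot> c (H \<^bold>\<otimes> H) H \<cdot> ((\<delta> \<cdot> \<eta>) \<^bold>\<otimes> H)"
    using Symm_natural' [of "\<delta> \<cdot> \<eta>" H "H \<^bold>\<otimes> H" H] by simp
  also have "\<dots> = (H \<^bold>\<otimes> ?e) \<cdot> ((c H H \<^bold>\<otimes> H) \<cdot> (c H H \<^bold>\<otimes> H)) \<cdot> (H \<^bold>\<otimes> c H H) \<cdot> ((\<delta> \<cdot> \<eta>) \<^bold>\<otimes> H)"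
    by (simp add: Symm_hexagon')
  also have "(c H H \<^bold>\<otimes> H) \<cdot> (c H H \<^bold>\<otimes> H) = H \<^bold>\<otimes> H \<^bold>\<otimes> H"
    by (simp add: interchange' Symm_Symm)
  also have "H \<^bold>\<otimes> ?e = (?e \<^bold>\<otimes> H) \<cdot> c H (H \<^bold>\<otimes> H)"
    using Symm_natural' [of H ?e H K] by simp
  also have "((?e \<^bold>\<otimes> H) \<cdot> c H (H \<^bold>\<otimes> H)) \<cdot> (H \<^bold>\<otimes> H \<^bold>\<otimes> H) \<cdot> (H \<^bold>\<otimes> c H H) \<cdot> ((\<delta> \<cdot> \<eta>) \<^bold>\<otimes> H)
     = (?e \<^bold>\<otimes> H) \<cdot> (c H (H \<^bold>\<otimes> H) \<cdot> (H \<^bold>\<otimes> c H H)) \<cdot> ((\<delta> \<cdot> \<eta>) \<^bold>\<otimes> H)"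
    by simp
  also have "c H (H \<^bold>\<otimes> H) \<cdot> (H \<^bold>\<otimes> c H H) = (c H H \<^bold>\<otimes> H) \<cdot> c H (H \<^bold>\<otimes> H)"
    using Symm_natural' [of H "c H H" H "H \<^bold>\<otimes> H"] by simp
  also have "c H (H \<^bold>\<otimes> H) = (H \<^bold>\<otimes> c H H) \<cdot> (c H H \<^bold>\<otimes> H)"
    by (rule Symm_hexagon) simp_all
  also have "(?e \<^bold>\<otimes> H) \<cdot> ((c H H \<^bold>\<otimes> H) \<cdot> (H \<^bold>\<otimes> c H H) \<cdot> (c H H \<^bold>\<otimes> H)) \<cdot> ((\<delta> \<cdot> \<eta>) \<^bold>\<otimes> H)
     = ((?e \<^bold>\<otimes> H) \<cdot> (c H H \<^bold>\<otimes> H)) \<cdot> (H \<^bold>\<otimes> c H H) \<cdot> ((c H H \<^bold>\<otimes> H) \<cdot> ((\<delta> \<cdot> \<eta>) \<^bold>\<otimes> H))"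
    by simp
  also have "(c H H \<^bold>\<otimes> H) \<cdot> ((\<delta> \<cdot> \<eta>) \<^bold>\<otimes> H) = (\<delta> \<cdot> \<eta>) \<^bold>\<otimes> H"
    using co by (subst interchange') simp_all
  also have "(?e \<^bold>\<otimes> H) \<cdot> (c H H \<^bold>\<otimes> H) = (\<epsilon> \<cdot> \<mu> \<cdot> c H H) \<^bold>\<otimes> H"
    by (subst interchange') simp_all
  finally show ?thesis by (simp add: O.target_def)
qed

end

context two_stages
begin

text \<open>Tuples of elements are morphisms of stages, so that \<open>pr_comp\<close> applies when
  a convolution of cochains is evaluated at them.\<close>

lemma comultiplicative_pr:
  assumes "stage C F e d" "comultiplicative d \<delta> f" "comultiplicative d \<delta>' g"
  shows "comultiplicative d \<Delta> (pr d f g)"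
proof -
  interpret F: stage C F e d by fact
  have [simp]: "f \<in> Arr C" "Dom C f = F" "Cod C f = D" "\<delta> \<cdot> f = pr d f f"
    "g \<in> Arr C" "Dom C g = F" "Cod C g = E" "\<delta>' \<cdot> g = pr d g g"
    using assms by (simp_all add: comultiplicative_def)
  show ?thesis
    by (simp add: comultiplicative_def tensor_comult_def)
qed

end

context weak_bialgebra_stage
begin

lemma point_target_comp: "point d x \<Longrightarrow> point d (target \<cdot> x)"
  by (rule comultiplicative_comp [OF _ _ _ _ point_target]) unfold_locales

end

context weak_bialgebra
begin

text \<open>The instance of \<open>comult_unit_mult\<close> at the unit.\<close>

lemma comult_unit_target: "(H \<^bold>\<otimes> target) \<cdot> \<delta> \<cdot> \<eta> = \<delta> \<cdot> \<eta>"
proof -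
  have "(H \<^bold>\<otimes> target) \<cdot> \<delta> \<cdot> \<eta> = ((H \<^bold>\<otimes> target) \<cdot> \<delta>) \<cdot> \<eta>" by simp
  also have "\<dots> = (\<mu> \<^bold>\<otimes> H) \<cdot> (H \<^bold>\<otimes> c H H) \<cdot> (((\<delta> \<cdot> \<eta>) \<^bold>\<otimes> H) \<cdot> \<eta>)"
    unfolding comult_unit_mult [symmetric] by simp
  also have "((\<delta> \<cdot> \<eta>) \<^bold>\<otimes> H) \<cdot> \<eta> = (H \<^bold>\<otimes> H \<^bold>\<otimes> \<eta>) \<cdot> \<delta> \<cdot> \<eta>"
    using interchange' [of K "\<delta> \<cdot> \<eta>" \<eta> H] interchange' [of "\<delta> \<cdot> \<eta>" "H \<^bold>\<otimes> H" K \<eta>] by simp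
  also have "(\<mu> \<^bold>\<otimes> H) \<cdot> (H \<^bold>\<otimes> c H H) \<cdot> ((H \<^bold>\<otimes> H \<^bold>\<otimes> \<eta>) \<cdot> \<delta> \<cdot> \<eta>)
      = (\<mu> \<^bold>\<otimes> H) \<cdot> ((H \<^bold>\<otimes> c H H) \<cdot> (H \<^bold>\<otimes> (H \<^bold>\<otimes> \<eta>))) \<cdot> \<delta> \<cdot> \<eta>" by simp
  also have "(H \<^bold>\<otimes> c H H) \<cdot> (H \<^bold>\<otimes> (H \<^bold>\<otimes> \<eta>)) = (H \<^bold>\<otimes> \<eta>) \<^bold>\<otimes> H"
    by (simp add: interchange' Symm_natural')
  also have "(\<mu> \<^bold>\<otimes> H) \<cdot> ((H \<^bold>\<otimes> \<eta>) \<^bold>\<otimes> H) \<cdot> \<delta> \<cdot> \<eta> = ((\<mu> \<^bold>\<otimes> H) \<cdot> ((H \<^bold>\<otimes> \<eta>) \<^bold>\<otimes> H)) \<cdot> \<delta> \<cdot> \<eta>"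
    by simp
  also have "(\<mu> \<^bold>\<otimes> H) \<cdot> ((H \<^bold>\<otimes> \<eta>) \<^bold>\<otimes> H) = H \<^bold>\<otimes> H"
    by (subst interchange') (simp_all add: unit_right)
  finally show ?thesis by simp
qed

lemma comult_unit_target': "(target \<^bold>\<otimes> H) \<cdot> \<delta> \<cdot> \<eta> = \<delta> \<cdot> \<eta>"
proof -
  have 1: "(H \<^bold>\<otimes> target) \<cdot> \<delta> \<cdot> \<eta> = \<delta> \<cdot> \<eta>" by (rule comult_unit_target)
  have "(target \<^bold>\<otimes> H) \<cdot> \<delta> = c H H \<cdot> (H \<^bold>\<otimes> target) \<cdot> \<delta>"
    using Symm_pr [of H target H H] by (simp add: pr_def)
  then have "((target \<^bold>\<otimes> H) \<cdot> \<delta>) \<cdot> \<eta> = (c H H \<cdot> (H \<^bold>\<otimes> target) \<cdot> \<delta>) \<cdot> \<eta>"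
    by (simp only:)
  also have "\<dots> = (c H H \<cdot> \<delta>) \<cdot> \<eta>" using 1 by simp
  also have "\<dots> = \<delta> \<cdot> \<eta>" unfolding cocomm ..
  finally show ?thesis by simp
qed

lemma source_typing [simp]: "source \<in> Arr C" "Dom C source = H" "Cod C source = H"
  by (simp_all add: source_def)

text \<open>The output of \<open>source\<close> is a leg of the coproduct of 1, and
  \<open>target\<close> fixes such legs; by cocommutativity it does not matter which leg.\<close>

lemma target_source: "target \<cdot> source = source"
proof -
  let ?e = "\<epsilon> \<cdot> \<mu>"
  have 1: "target \<cdot> (H \<^bold>\<otimes> ?e) = (H \<^bold>\<otimes> ?e) \<cdot> (target \<^bold>\<otimes> H \<^bold>\<otimes> H)"
    using interchange' [of H target ?e K] interchange' [of target H "H \<^bold>\<otimes> H" ?e] by simp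
  have 2: "(target \<^bold>\<otimes> H \<^bold>\<otimes> H) \<cdot> (c H H \<^bold>\<otimes> H) = (c H H \<^bold>\<otimes> H) \<cdot> (H \<^bold>\<otimes> target \<^bold>\<otimes> H)"
    using interchange' [of "c H H" "target \<^bold>\<otimes> H" H H] interchange' [of "H \<^bold>\<otimes> target" "c H H" H H]
      Symm_natural' [of H target H H] by simp
  have 3: "(H \<^bold>\<otimes> target \<^bold>\<otimes> H) \<cdot> (H \<^bold>\<otimes> (\<delta> \<cdot> \<eta>)) = H \<^bold>\<otimes> (\<delta> \<cdot> \<eta>)"
    using comult_unit_target' by (subst interchange') simp_all
  have "target \<cdot> source = (target \<cdot> (H \<^bold>\<otimes> ?e)) \<cdot> (c H H \<^bold>\<otimes> H) \<cdot> (H \<^bold>\<otimes> (\<delta> \<cdot> \<eta>))"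
    by (simp add: source_def)
  also have "\<dots> = (H \<^bold>\<otimes> ?e) \<cdot> ((target \<^bold>\<otimes> H \<^bold>\<otimes> H) \<cdot> (c H H \<^bold>\<otimes> H)) \<cdot> (H \<^bold>\<otimes> (\<delta> \<cdot> \<eta>))"
    unfolding 1 by simp
  also have "\<dots> = (H \<^bold>\<otimes> ?e) \<cdot> (c H H \<^bold>\<otimes> H) \<cdot> ((H \<^bold>\<otimes> target \<^bold>\<otimes> H) \<cdot> (H \<^bold>\<otimes> (\<delta> \<cdot> \<eta>)))"
    unfolding 2 by simp
  also have "\<dots> = source" unfolding 3 source_def ..
  finally show ?thesis .
qed

lemma point_source: "point \<delta> source"
proof -
  interpret O: weak_bialgebra C H \<epsilon> \<delta> \<eta> "\<mu> \<cdot> c H H" by (rule opposite)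
  show ?thesis using O.point_target by (simp add: source_eq)
qed

end

context weak_bialgebra_stage
begin

lemma opposite_stage: "weak_bialgebra_stage C H \<epsilon> \<delta> \<eta> (\<mu> \<cdot> c H H) D e d"
  by (intro weak_bialgebra_stage.intro opposite) unfold_locales

lemma point_source_comp: "point d x \<Longrightarrow> point d (source \<cdot> x)"
  by (rule comultiplicative_comp [OF _ _ _ _ point_source]) unfold_locales

lemma mult_source:
  assumes "point d z"
  shows "\<mu> \<cdot> pr d z (source \<cdot> z) = z"
proof -
  note [simp] = point_typing [OF assms]
  interpret O: weak_bialgebra_stage C H \<epsilon> \<delta> \<eta> "\<mu> \<cdot> c H H" D e d by (rule opposite_stage)
  show ?thesis using O.target_mult [OF assms] by (simp add: source_eq)
qed

lemma counit_source:
  assumes "x \<in> Arr C" "Dom C x = D" "Cod C x = H" "y \<in> Arr C" "Dom C y = D" "Cod C y = H"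
  shows "\<epsilon> \<cdot> \<mu> \<cdot> pr d (source \<cdot> x) y = \<epsilon> \<cdot> \<mu> \<cdot> pr d x y"
proof -
  interpret O: weak_bialgebra_stage C H \<epsilon> \<delta> \<eta> "\<mu> \<cdot> c H H" D e d by (rule opposite_stage)
  show ?thesis using O.counit_target [of y x] assms by (simp add: source_eq)
qed

lemma subst1_mult_unit':
  assumes "point d z"
  shows "pr \<Delta> (\<mu> \<cdot> pr \<Delta> (z \<cdot> lift) w) w \<cdot> (\<eta> \<^bold>\<otimes> D) = pr d z (source \<cdot> z)"
proof -
  note [simp] = point_typing [OF assms]
  interpret O: weak_bialgebra_stage C H \<epsilon> \<delta> \<eta> "\<mu> \<cdot> c H H" D e d by (rule opposite_stage)
  show ?thesis using O.subst1_mult_unit [OF assms] by (simp add: source_eq)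
qed

text \<open>In Sweedler notation, x Pi^L(y) = x_1 eps(x_2 y). The left side is eps(w y) x w at w =
  1; since the pair (x w, w) becomes (x, Pi^R x), the scalar is eps(Pi^R(x) y), which is eps(x
  y).\<close>

lemma mult_target:
  assumes "point d x" "point d y"
  shows "\<mu> \<cdot> pr d x (target \<cdot> y) = pr d x (\<epsilon> \<cdot> \<mu> \<cdot> pr d x y)"
proof -
  note [simp] = point_typing [OF assms(1)] point_typing [OF assms(2)]
  let ?x = "x \<cdot> lift" and ?y = "y \<cdot> lift"
  define s where "s = \<epsilon> \<cdot> \<mu> \<cdot> pr \<Delta> w ?y"
  have [simp]: "s \<in> Arr C" "Dom C s = H \<^bold>\<otimes> D" "Cod C s = K" by (simp_all add: s_def)
  define t where "t = \<mu> \<cdot> pr \<Delta> ?x w"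
  have [simp]: "t \<in> Arr C" "Dom C t = H \<^bold>\<otimes> D" "Cod C t = H" by (simp_all add: t_def)
  have "pr d x (target \<cdot> y) = pr \<Delta> ?x (pr \<Delta> s w) \<cdot> (\<eta> \<^bold>\<otimes> D)"
    by (simp add: target_eval subst1_pr' s_def)
  also have "pr \<Delta> ?x (pr \<Delta> s w) = pr \<Delta> s (pr \<Delta> ?x w)"
    by (rule X.DE.scalar_pr_left_commute) simp_all
  finally have "\<mu> \<cdot> pr d x (target \<cdot> y) = (\<mu> \<cdot> pr \<Delta> s (pr \<Delta> ?x w)) \<cdot> (\<eta> \<^bold>\<otimes> D)"
    by simp
  also have "\<mu> \<cdot> pr \<Delta> s (pr \<Delta> ?x w) = pr \<Delta> s t"
    by (simp add: X.DE.scalar_comp t_def)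
  also have "pr \<Delta> s t = pr \<Delta> t s" by (rule X.DE.scalar_pr_right [symmetric]) simp_all
  also have "pr \<Delta> t s = (H \<^bold>\<otimes> (\<epsilon> \<cdot> \<mu>)) \<cdot> pr \<Delta> (pr \<Delta> t w) ?y"
    by (simp add: s_def)
  also have "\<dots> \<cdot> (\<eta> \<^bold>\<otimes> D) = (H \<^bold>\<otimes> (\<epsilon> \<cdot> \<mu>)) \<cdot> (pr \<Delta> (pr \<Delta> t w) ?y \<cdot> (\<eta> \<^bold>\<otimes> D))"
    by (rule comp_assoc') simp_all
  also have "pr \<Delta> (pr \<Delta> t w) ?y \<cdot> (\<eta> \<^bold>\<otimes> D) = pr d (pr d x (source \<cdot> x)) y"
    using subst1_pr [of "pr \<Delta> t w" y] subst1_mult_unit' [OF assms(1)] by (simp add: t_def)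
  also have "(H \<^bold>\<otimes> (\<epsilon> \<cdot> \<mu>)) \<cdot> pr d (pr d x (source \<cdot> x)) y = pr d x (\<epsilon> \<cdot> \<mu> \<cdot> pr d (source \<cdot> x) y)"
    by simp
  finally show ?thesis by (simp add: counit_source)
qed

end

section \<open>Cochains evaluated at the unit\<close>

context weak_bialgebra
begin

text \<open>In Sweedler notation, \<open>f(1\<^sub>1, x\<^sub>1) g(1\<^sub>2 x\<^sub>2) = f(\<Pi>\<^sup>L x\<^sub>1, x\<^sub>2) g(x\<^sub>3)\<close>: this evaluates a cochain at the
  unit.\<close>

lemma unit_left_eval:
  assumes "d1 = tensor_comult H \<delta> H \<delta>" "f \<in> Arr C" "Dom C f = H \<^bold>\<otimes> H" "g \<in> Arr C" "Dom C g = H"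
  shows "pr d1 f (g \<cdot> \<mu>) \<cdot> (\<eta> \<^bold>\<otimes> H) = pr \<delta> (f \<cdot> pr \<delta> target H) g"
proof -
  interpret S1: weak_bialgebra_stage C H \<epsilon> \<delta> \<eta> \<mu> H \<epsilon> \<delta> by unfold_locales
  define w where "w = S1.w" define z where "z = S1.lift"
  note eqs = assms(1) w_def z_def
  interpret S2: weak_bialgebra_stage C H \<epsilon> \<delta> \<eta> \<mu> "H \<^bold>\<otimes> H" "\<epsilon> \<^bold>\<otimes> \<epsilon>" d1
    unfolding eqs by unfold_locales
  have p: "point d1 w" "point d1 z" unfolding eqs by (rule S1.point_w S1.lift_comultiplicative)+
  note [simp] = S2.point_typing [OF p(1)] S2.point_typing [OF p(2)] assms(2-)
  have id: "pr d1 w z = H \<^bold>\<otimes> H" unfolding eqs by (rule S1.X.pr_proj_id)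
  define m where "m = \<mu> \<cdot> pr d1 w z"
  have [simp]: "m \<in> Arr C" "Dom C m = H \<^bold>\<otimes> H" "Cod C m = H" by (simp_all add: m_def)
  have pH: "point \<delta> H" by (rule comultiplicative_id)
  \<comment> \<open>The convolution is a function of the triple (w z, w, z), whose value at w = 1 is
    known.\<close>
  have 1: "pr d1 (pr d1 m w) z \<cdot> (\<eta> \<^bold>\<otimes> H) = pr \<delta> (pr \<delta> H target) H"
    using S1.subst1_pr [of "pr d1 m w" H] S1.subst1_mult_unit [OF pH]
    by (simp add: eqs m_def)
  have "pr d1 f (g \<cdot> \<mu>) = pr d1 (f \<cdot> pr d1 w z) (g \<cdot> m)"
    unfolding m_def by (simp add: id)
  also have "\<dots> = (f \<^bold>\<otimes> g) \<cdot> (H \<^bold>\<otimes> c H H) \<cdot> (c H H \<^bold>\<otimes> H) \<cdot> pr d1 (pr d1 m w) z"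
    by simp
  finally have "pr d1 f (g \<cdot> \<mu>) \<cdot> (\<eta> \<^bold>\<otimes> H)
     = (f \<^bold>\<otimes> g) \<cdot> (H \<^bold>\<otimes> c H H) \<cdot> (c H H \<^bold>\<otimes> H) \<cdot> (pr d1 (pr d1 m w) z \<cdot> (\<eta> \<^bold>\<otimes> H))"
    by (simp del: S2.S.tensor_pr S2.S.tensor_pr2 S2.S.Symm_pr S2.S.pr_assoc)
  also have "\<dots> = pr \<delta> (f \<cdot> pr \<delta> target H) g"
    unfolding 1 by (simp del: S1.X.pr_id)
  finally show ?thesis .
qed

text \<open>The mirror image of \<open>unit_left_eval\<close>. It requires that \<open>c H H\<close>
  be comultiplicative, which holds because it is the pair of the two projections in reversed
  order.\<close>

lemma unit_right_eval:
  assumes "d1 = tensor_comult H \<delta> H \<delta>" "f \<in> Arr C" "Dom C f = H \<^bold>\<otimes> H" "g \<in> Arr C" "Dom C g = H"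
  shows "pr d1 f (g \<cdot> \<mu>) \<cdot> (H \<^bold>\<otimes> \<eta>) = pr \<delta> (f \<cdot> pr \<delta> H source) g"
proof -
  interpret O: weak_bialgebra C H \<epsilon> \<delta> \<eta> "\<mu> \<cdot> c H H" by (rule opposite)
  interpret X: two_stages C H \<epsilon> \<delta> H \<epsilon> \<delta> by unfold_locales
  note [simp] = assms(2-)
  have p: "comultiplicative X.\<Delta> \<delta> X.p" "comultiplicative X.\<Delta> \<delta> X.q"
    by (rule X.comultiplicative_proj)+
  have "c H H = c H H \<cdot> pr X.\<Delta> X.p X.q" unfolding X.pr_proj_id by simp
  also have "\<dots> = pr X.\<Delta> X.q X.p" by simp
  finally have "comultiplicative X.\<Delta> X.\<Delta> (c H H)"
    using X.comultiplicative_pr [OF _ p(2,1)] X.DE.stage_axioms by simp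
  then have 1: "pr d1 f (g \<cdot> \<mu>) \<cdot> c H H = pr d1 (f \<cdot> c H H) (g \<cdot> (\<mu> \<cdot> c H H))"
    unfolding assms(1) using X.DE.pr_comp [of X.\<Delta> "c H H" f "g \<cdot> \<mu>"] by simp
  have "H \<^bold>\<otimes> \<eta> = c H H \<cdot> (\<eta> \<^bold>\<otimes> H)" by (simp add: Symm_natural')
  then have "pr d1 f (g \<cdot> \<mu>) \<cdot> (H \<^bold>\<otimes> \<eta>) = (pr d1 f (g \<cdot> \<mu>) \<cdot> c H H) \<cdot> (\<eta> \<^bold>\<otimes> H)"
    using assms(1) by simp
  also have "\<dots> = pr \<delta> ((f \<cdot> c H H) \<cdot> pr \<delta> source H) g"
    unfolding 1 source_eq by (rule O.unit_left_eval) (simp_all add: assms(1))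
  finally show ?thesis by simp
qed

end

section \<open>Commutative module algebras\<close>

locale sweedler = cocommutative_weak_hopf_algebra C \<H> + commutative_left_module_algebra C \<H> \<A>
  for C :: "'m smcat" (structure) and \<H> :: "'m bialg" and \<A> :: "'m module_alg"
begin

sublocale W: weak_bialgebra C H \<epsilon>\<^sub>H \<delta>\<^sub>H \<eta>\<^sub>H \<mu>\<^sub>H
  using H_algebra H_coalgebra a1 a2 a3 a3' cocommutative
  by unfold_locales (simp_all add: is_algebra_def is_coalgebra_def)

lemma \<Pi>L_eq: "\<Pi>L = W.target"
  by (simp add: \<Pi>L_def W.target_def)

lemma A_typing [simp]:
  "A \<in> Obj C" "\<eta>\<^sub>A \<in> Arr C" "Dom C \<eta>\<^sub>A = K" "Cod C \<eta>\<^sub>A = A"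
  "\<mu>\<^sub>A \<in> Arr C" "Dom C \<mu>\<^sub>A = A \<^bold>\<otimes> A" "Cod C \<mu>\<^sub>A = A"
  "\<phi>\<^sub>A \<in> Arr C" "Dom C \<phi>\<^sub>A = H \<^bold>\<otimes> A" "Cod C \<phi>\<^sub>A = A"
  using A_algebra action_Hom by (simp_all add: is_algebra_def)

lemma A_laws: "\<mu>\<^sub>A \<cdot> (\<eta>\<^sub>A \<^bold>\<otimes> A) = A" "\<mu>\<^sub>A \<cdot> (A \<^bold>\<otimes> \<eta>\<^sub>A) = A" "\<mu>\<^sub>A \<cdot> (\<mu>\<^sub>A \<^bold>\<otimes> A) = \<mu>\<^sub>A \<cdot> (A \<^bold>\<otimes> \<mu>\<^sub>A)"
  using A_algebra by (simp_all add: is_algebra_def)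

text \<open>\<open>U\<close> is \<open>u\<^sub>1\<close>.\<close>

definition U :: 'm where "U = \<phi>\<^sub>A \<cdot> (H \<^bold>\<otimes> \<eta>\<^sub>A)"

lemma U_typing [simp]: "U \<in> Arr C" "Dom C U = H" "Cod C U = A"
  by (simp_all add: U_def)

lemma U_target: "U \<cdot> W.target = U"
  using b6 interchange' [of W.target H K \<eta>\<^sub>A] by (simp add: U_def \<Pi>L_eq)

end

section \<open>Convolution and action at a stage\<close>

locale sweedler_stage = sweedler C \<H> \<A> + S: stage C D e d
  for C :: "'m smcat" (structure) and \<H> :: "'m bialg" and \<A> :: "'m module_alg" and D e d
begin

sublocale WS: weak_bialgebra_stage C H \<epsilon>\<^sub>H \<delta>\<^sub>H \<eta>\<^sub>H \<mu>\<^sub>H D e d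
  by unfold_locales

abbreviation mul (infixl "\<star>" 75) where "x \<star> y \<equiv> \<mu>\<^sub>H \<cdot> pr d x y"
abbreviation cv (infixl "\<odot>" 70) where "a \<odot> b \<equiv> \<mu>\<^sub>A \<cdot> pr d a b"
abbreviation act (infixr "\<rhd>" 73) where "x \<rhd> a \<equiv> \<phi>\<^sub>A \<cdot> pr d x a"
abbreviation pt where "pt x \<equiv> W.point d x"
abbreviation el where "el a \<equiv> a \<in> Hom C D A"

lemma cv_comm:
  assumes "el a" "el b"
  shows "a \<odot> b = b \<odot> a"
proof -
  have "a \<odot> b = (\<mu>\<^sub>A \<cdot> c A A) \<cdot> pr d a b" unfolding commutative ..
  then show ?thesis using assms by simp
qed

lemma cv_assoc:
  assumes "el a" "el b" "el b'"
  shows "(a \<odot> b) \<odot> b' = a \<odot> (b \<odot> b')"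
proof -
  have "(a \<odot> b) \<odot> b' = (\<mu>\<^sub>A \<cdot> (\<mu>\<^sub>A \<^bold>\<otimes> A)) \<cdot> pr d a (pr d b b')"
    using assms by simp
  then show ?thesis unfolding A_laws using assms by simp
qed

lemma cv_left_comm:
  assumes "el a" "el b" "el b'"
  shows "a \<odot> (b \<odot> b') = b \<odot> (a \<odot> b')"
  using cv_assoc [of a b b'] cv_assoc [of b a b'] cv_comm [of a b] assms by simp

lemmas cv_ac = cv_assoc cv_comm cv_left_comm

lemma one_cv: "el a \<Longrightarrow> (\<eta>\<^sub>A \<cdot> e) \<odot> a = a"
proof -
  assume "el a"
  note [simp] = this [unfolded Hom_iff]
  have "(\<eta>\<^sub>A \<cdot> e) \<odot> a = (\<mu>\<^sub>A \<cdot> (\<eta>\<^sub>A \<^bold>\<otimes> A)) \<cdot> pr d e a" by (simp del: S.pr_counit)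
  then show ?thesis unfolding A_laws by simp
qed

lemma act_cv:
  assumes "pt x" "el a" "el b"
  shows "x \<rhd> (a \<odot> b) = (x \<rhd> a) \<odot> (x \<rhd> b)"
proof -
  note [simp] = WS.point_typing [OF assms(1)] assms(2,3) [unfolded Hom_iff]
  have "x \<rhd> (a \<odot> b) = (\<phi>\<^sub>A \<cdot> (H \<^bold>\<otimes> \<mu>\<^sub>A)) \<cdot> pr d x (pr d a b)" by simp
  then show ?thesis unfolding b2 by simp
qed

lemma act_act:
  assumes "x \<in> Hom C D H" "y \<in> Hom C D H" "el a"
  shows "x \<rhd> (y \<rhd> a) = (x \<star> y) \<rhd> a"
proof -
  have "x \<rhd> (y \<rhd> a) = (\<phi>\<^sub>A \<cdot> (H \<^bold>\<otimes> \<phi>\<^sub>A)) \<cdot> pr d x (pr d y a)" using assms by simp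
  then show ?thesis unfolding b3 [symmetric] using assms by simp
qed

lemma U_eval:
  assumes "x \<in> Hom C D H"
  shows "U \<cdot> x = x \<rhd> (\<eta>\<^sub>A \<cdot> e)"
proof -
  have "x \<rhd> (\<eta>\<^sub>A \<cdot> e) = (\<phi>\<^sub>A \<cdot> (H \<^bold>\<otimes> \<eta>\<^sub>A)) \<cdot> pr d x e" using assms by (simp del: S.pr_counit)
  then show ?thesis unfolding U_def [symmetric] using assms by simp
qed

text \<open>This is x (1 a) = (x 1)(x a).\<close>

lemma U_act:
  assumes "pt x" "el a"
  shows "(U \<cdot> x) \<odot> (x \<rhd> a) = x \<rhd> a"
  using act_cv [of x "\<eta>\<^sub>A \<cdot> e" a] one_cv [of a] assms WS.point_typing [OF assms(1)] by (simp add: U_eval)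

lemma act_U:
  assumes "x \<in> Hom C D H" "y \<in> Hom C D H"
  shows "x \<rhd> (U \<cdot> y) = U \<cdot> (x \<star> y)"
  using assms act_act [of x y "\<eta>\<^sub>A \<cdot> e"] by (simp add: U_eval)

lemma U_idem: "pt x \<Longrightarrow> (U \<cdot> x) \<odot> (U \<cdot> x) = U \<cdot> x"
  using U_act [of x "\<eta>\<^sub>A \<cdot> e"] WS.point_typing [of x] by (simp add: U_eval)

text \<open>The scalar is already absorbed by \<open>x\<close> itself.\<close>

lemma U_counit:
  assumes "pt x"
  shows "pr d (\<epsilon>\<^sub>H \<cdot> x) (U \<cdot> x) = U \<cdot> x"
  using S.scalar_comp [of "\<epsilon>\<^sub>H \<cdot> x" x U] WS.counit_point [OF assms] WS.point_typing [OF assms] by simp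

lemma U_target_comp:
  assumes "x \<in> Hom C D H"
  shows "U \<cdot> (W.target \<cdot> x) = U \<cdot> x"
  using U_target comp_assoc' [of x W.target U] assms by simp

text \<open>Condition (b4).  The idea is to write \<open>a\<close> as \<open>1 a\<close> and \<open>(t, t)\<close>, for \<open>t = \<Pi>\<^sup>L x\<close>, as \<open>(1\<^sub>1 t, 1\<^sub>2)\<close>.\<close>

lemma target_act:
  assumes "pt x" "el a"
  shows "(W.target \<cdot> x) \<rhd> a = (U \<cdot> x) \<odot> a"
proof -
  interpret X: sweedler_stage C \<H> \<A> "H \<^bold>\<otimes> D" "\<epsilon>\<^sub>H \<^bold>\<otimes> e" WS.\<Delta> by unfold_locales
  let ?l = "WS.lift" and ?\<Delta> = "WS.\<Delta>"
  note [simp] = WS.point_typing [OF assms(1)] assms(2) [unfolded Hom_iff]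
  define t where "t = W.target \<cdot> x"
  have t: "pt t" unfolding t_def by (rule WS.point_target_comp [OF assms(1)])
  note [simp] = WS.point_typing [OF t]
  have tt: "W.target \<cdot> t = t"
    using W.target_target comp_assoc' [of x W.target W.target] by (simp add: t_def)
  define i where "i = \<eta>\<^sub>A \<cdot> e"
  have [simp]: "i \<in> Arr C" "Dom C i = D" "Cod C i = A" by (simp_all add: i_def)
  define w where "w = WS.w"
  have w: "X.pt w" unfolding w_def by (rule WS.point_w)
  note [simp] = X.WS.point_typing [OF w]
  define tl al il where "tl = t \<cdot> ?l" and "al = a \<cdot> ?l" and "il = i \<cdot> ?l"
  have [simp]: "tl \<in> Arr C" "Dom C tl = H \<^bold>\<otimes> D" "Cod C tl = H" "al \<in> Arr C" "Dom C al = H \<^bold>\<otimes> D" "Cod C al = A"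
    "il \<in> Arr C" "Dom C il = H \<^bold>\<otimes> D" "Cod C il = A" by (simp_all add: tl_def al_def il_def)
  define R where "R = \<mu>\<^sub>A \<cdot> (\<phi>\<^sub>A \<^bold>\<otimes> \<phi>\<^sub>A) \<cdot> (H \<^bold>\<otimes> c H A \<^bold>\<otimes> A)"
  have [simp]: "R \<in> Arr C" "Dom C R = H \<^bold>\<otimes> H \<^bold>\<otimes> A \<^bold>\<otimes> A" "Cod C R = A" by (simp_all add: R_def)
  define b where "b = (t \<rhd> i) \<odot> a"
  have [simp]: "b \<in> Arr C" "Dom C b = D" "Cod C b = A" by (simp_all add: b_def)
  have "t \<rhd> a = t \<rhd> (i \<odot> a)" by (simp add: one_cv i_def)
  also have "\<dots> = (t \<rhd> i) \<odot> (t \<rhd> a)" by (rule act_cv [OF t]) simp_all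
  also have "\<dots> = R \<cdot> pr d (pr d t t) (pr d i a)" by (simp add: R_def)
  also have "pr d t t = pr ?\<Delta> (\<mu>\<^sub>H \<cdot> pr ?\<Delta> w tl) w \<cdot> (\<eta>\<^sub>H \<^bold>\<otimes> D)"
    using WS.subst1_mult_unit [OF t] by (simp add: tt w_def tl_def)
  also have "pr d (pr ?\<Delta> (\<mu>\<^sub>H \<cdot> pr ?\<Delta> w tl) w \<cdot> (\<eta>\<^sub>H \<^bold>\<otimes> D)) (pr d i a)
     = pr ?\<Delta> (pr ?\<Delta> (\<mu>\<^sub>H \<cdot> pr ?\<Delta> w tl) w) (pr d i a \<cdot> ?l) \<cdot> (\<eta>\<^sub>H \<^bold>\<otimes> D)"
    by (rule WS.subst1_pr [symmetric]) simp_all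
  also have "pr d i a \<cdot> ?l = pr ?\<Delta> il al"
    unfolding il_def al_def by (rule WS.pr_lift [symmetric]) simp_all
  also have "R \<cdot> pr ?\<Delta> (pr ?\<Delta> (\<mu>\<^sub>H \<cdot> pr ?\<Delta> w tl) w) (pr ?\<Delta> il al) \<cdot> (\<eta>\<^sub>H \<^bold>\<otimes> D)
     = (R \<cdot> pr ?\<Delta> (pr ?\<Delta> (\<mu>\<^sub>H \<cdot> pr ?\<Delta> w tl) w) (pr ?\<Delta> il al)) \<cdot> (\<eta>\<^sub>H \<^bold>\<otimes> D)"
    by (rule comp_assoc' [symmetric]) simp_all
  also have "R \<cdot> pr ?\<Delta> (pr ?\<Delta> (\<mu>\<^sub>H \<cdot> pr ?\<Delta> w tl) w) (pr ?\<Delta> il al)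
     = X.cv (X.act (X.mul w tl) il) (X.act w al)"
    by (simp add: R_def)
  \<comment> \<open>Both factors now act through \<open>w\<close>. Pulled out by multiplicativity of
    the action, \<open>w\<close> occurs once; it may then be set to the unit, and (b1) removes
    it.\<close>
  also have "X.act (X.mul w tl) il = X.act w (X.act tl il)"
    by (rule X.act_act [symmetric]) simp_all
  also have "X.cv (X.act w (X.act tl il)) (X.act w al) = X.act w (X.cv (X.act tl il) al)"
    by (rule X.act_cv [symmetric, OF w]) simp_all
  also have "X.cv (X.act tl il) al = b \<cdot> ?l"
    unfolding b_def using WS.pr_lift [of t i] WS.pr_lift [of "t \<rhd> i" a]
    by (simp add: tl_def il_def al_def)
  also have "(X.act w (b \<cdot> ?l)) \<cdot> (\<eta>\<^sub>H \<^bold>\<otimes> D) = \<phi>\<^sub>A \<cdot> (\<eta>\<^sub>H \<^bold>\<otimes> b)"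
    using WS.subst1_w [of b] by (simp add: w_def)
  also have "\<dots> = (\<phi>\<^sub>A \<cdot> (\<eta>\<^sub>H \<^bold>\<otimes> A)) \<cdot> b"
    using interchange' [of K \<eta>\<^sub>H b A] by simp
  also have "\<dots> = b" unfolding b1 by simp
  also have "b = (U \<cdot> x) \<odot> a"
    using U_eval [of t] U_target_comp [of x] by (simp add: b_def i_def t_def)
  finally show ?thesis unfolding t_def .
qed

text \<open>In the commutative convolution monoid the idempotent \<open>v\<close> cuts out a
  submonoid with neutral element \<open>v\<close>, and the regular morphisms are its units. The
  equations on the triple products say that \<open>\<sigma>\<close> and its inverse lie in this
  submonoid.\<close>

lemma comm_groupI:
  assumes G: "carrier G = {\<sigma> \<in> Hom C D A. \<exists>\<tau> \<in> Hom C D A. \<sigma> \<odot> \<tau> = v \<and> \<tau> \<odot> \<sigma> = v \<and>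
      (\<sigma> \<odot> \<tau>) \<odot> \<sigma> = \<sigma> \<and> (\<tau> \<odot> \<sigma>) \<odot> \<tau> = \<tau>}"
    "mult G = (\<lambda>\<sigma> \<tau>. \<sigma> \<odot> \<tau>)" "one G = v"
    and v: "el v" "v \<odot> v = v"
  shows "comm_group G"
    and "\<And>\<sigma>. \<sigma> \<in> carrier G \<longleftrightarrow> el \<sigma> \<and> v \<odot> \<sigma> = \<sigma> \<and> (\<exists>\<tau>. el \<tau> \<and> v \<odot> \<tau> = \<tau> \<and> \<sigma> \<odot> \<tau> = v)"
proof -
  note Hom_iff [simp del]
  have [simp]: "el (a \<odot> b)" if "el a" "el b" for a b
    using that by (simp add: Hom_iff)
  show *: "\<sigma> \<in> carrier G \<longleftrightarrow> el \<sigma> \<and> v \<odot> \<sigma> = \<sigma> \<and> (\<exists>\<tau>. el \<tau> \<and> v \<odot> \<tau> = \<tau> \<and> \<sigma> \<odot> \<tau> = v)" for \<sigma>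
  proof
    assume "\<sigma> \<in> carrier G"
    then obtain \<tau> where t: "el \<sigma>" "el \<tau>" "\<sigma> \<odot> \<tau> = v" "\<tau> \<odot> \<sigma> = v" "(\<sigma> \<odot> \<tau>) \<odot> \<sigma> = \<sigma>" "(\<tau> \<odot> \<sigma>) \<odot> \<tau> = \<tau>"
      unfolding G(1) by blast
    have "v \<odot> \<sigma> = \<sigma>" using t(5) unfolding t(3) .
    moreover have "v \<odot> \<tau> = \<tau>" using t(6) unfolding t(4) .
    ultimately show "el \<sigma> \<and> v \<odot> \<sigma> = \<sigma> \<and> (\<exists>\<tau>. el \<tau> \<and> v \<odot> \<tau> = \<tau> \<and> \<sigma> \<odot> \<tau> = v)"
      using t(1-3) by blast
  next
    assume "el \<sigma> \<and> v \<odot> \<sigma> = \<sigma> \<and> (\<exists>\<tau>. el \<tau> \<and> v \<odot> \<tau> = \<tau> \<and> \<sigma> \<odot> \<tau> = v)"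
    then obtain \<tau> where t: "el \<sigma>" "v \<odot> \<sigma> = \<sigma>" "el \<tau>" "v \<odot> \<tau> = \<tau>" "\<sigma> \<odot> \<tau> = v" by blast
    have t': "\<tau> \<odot> \<sigma> = v" using cv_comm [OF t(3,1)] t(5) by (simp only:)
    have "(\<sigma> \<odot> \<tau>) \<odot> \<sigma> = \<sigma>" "(\<tau> \<odot> \<sigma>) \<odot> \<tau> = \<tau>" unfolding t(5) t' by (rule t(2) t(4))+
    then show "\<sigma> \<in> carrier G" unfolding G(1) using t(1,3,5) t' by blast
  qed
  show "comm_group G"
  proof (rule Group.comm_groupI)
    fix \<sigma> \<tau> \<rho> assume s: "\<sigma> \<in> carrier G" and t: "\<tau> \<in> carrier G" and r: "\<rho> \<in> carrier G"
    from s t r have [simp]: "el \<sigma>" "el \<tau>" "el \<rho>" by (simp_all add: *)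
    show "\<sigma> \<otimes>\<^bsub>G\<^esub> \<tau> \<otimes>\<^bsub>G\<^esub> \<rho> = \<sigma> \<otimes>\<^bsub>G\<^esub> (\<tau> \<otimes>\<^bsub>G\<^esub> \<rho>)"
      by (simp only: G(2)) (rule cv_assoc, simp_all)
    show "\<sigma> \<otimes>\<^bsub>G\<^esub> \<tau> = \<tau> \<otimes>\<^bsub>G\<^esub> \<sigma>"
      by (simp only: G(2)) (rule cv_comm, simp_all)
    show "\<one>\<^bsub>G\<^esub> \<otimes>\<^bsub>G\<^esub> \<sigma> = \<sigma>" using s by (simp add: * G(2,3))
    from s obtain \<sigma>' where s': "el \<sigma>'" "v \<odot> \<sigma>' = \<sigma>'" "\<sigma> \<odot> \<sigma>' = v" "v \<odot> \<sigma> = \<sigma>" by (auto simp: *)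
    from t obtain \<tau>' where t': "el \<tau>'" "v \<odot> \<tau>' = \<tau>'" "\<tau> \<odot> \<tau>' = v" "v \<odot> \<tau> = \<tau>" by (auto simp: *)
    note [simp] = s'(1) t'(1) v(1)
    have "(\<sigma> \<odot> \<tau>) \<odot> (\<sigma>' \<odot> \<tau>') = (\<sigma> \<odot> \<sigma>') \<odot> (\<tau> \<odot> \<tau>')"
      by (simp add: cv_ac)
    then have 1: "(\<sigma> \<odot> \<tau>) \<odot> (\<sigma>' \<odot> \<tau>') = v" by (simp only: s' t' v)
    have 2: "v \<odot> (\<sigma> \<odot> \<tau>) = \<sigma> \<odot> \<tau>" "v \<odot> (\<sigma>' \<odot> \<tau>') = \<sigma>' \<odot> \<tau>'"
      using cv_assoc [of v \<sigma> \<tau>] cv_assoc [of v \<sigma>' \<tau>'] s' t' by simp_all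
    have "el (\<sigma> \<odot> \<tau>) \<and> v \<odot> (\<sigma> \<odot> \<tau>) = \<sigma> \<odot> \<tau> \<and> (\<exists>\<rho>. el \<rho> \<and> v \<odot> \<rho> = \<rho> \<and> (\<sigma> \<odot> \<tau>) \<odot> \<rho> = v)"
      using 1 2 by (intro conjI exI [of _ "\<sigma>' \<odot> \<tau>'"]) simp_all
    then show "\<sigma> \<otimes>\<^bsub>G\<^esub> \<tau> \<in> carrier G" by (simp only: * G(2))
    have "\<sigma>' \<in> carrier G"
      unfolding * using s' cv_comm [of \<sigma> \<sigma>'] by (intro conjI exI [of _ \<sigma>]) simp_all
    moreover have "\<sigma>' \<otimes>\<^bsub>G\<^esub> \<sigma> = \<one>\<^bsub>G\<^esub>"
      using s' cv_comm [of \<sigma> \<sigma>'] by (simp add: G(2,3))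
    ultimately show "\<exists>y\<in>carrier G. y \<otimes>\<^bsub>G\<^esub> \<sigma> = \<one>\<^bsub>G\<^esub>" by blast
  next
    show "\<one>\<^bsub>G\<^esub> \<in> carrier G" unfolding * G(3) using v by blast
  qed
qed

lemma cv_comp:
  assumes "stage C E e' d'" "comultiplicative d' d k" "el f" "el g"
  shows "(f \<odot> g) \<cdot> k = \<mu>\<^sub>A \<cdot> pr d' (f \<cdot> k) (g \<cdot> k)"
proof -
  interpret E: stage C E e' d' by fact
  have [simp]: "k \<in> Arr C" "Dom C k = E" "Cod C k = D" using assms(2) by (simp_all add: comultiplicative_def)
  show ?thesis using S.pr_comp [OF assms(2), of f g] assms(3,4) by simp
qed

lemma d1_pr:
  assumes "x \<in> Hom C D H" "y \<in> Hom C D H" "h \<in> Hom C H A"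
  shows "d10 h \<cdot> pr d x y = x \<rhd> (h \<cdot> y)" "d11 h \<cdot> pr d x y = h \<cdot> (x \<star> y)"
    "d12 h \<cdot> pr d x y = h \<cdot> (x \<star> (W.target \<cdot> y))"
  using assms by (simp_all add: d10_def d11_def d12_def \<Pi>L_eq)

lemma d2_pr:
  assumes "x \<in> Hom C D H" "y \<in> Hom C D H" "z \<in> Hom C D H" "\<sigma> \<in> Hom C (H \<^bold>\<otimes> H) A"
  shows "d20 \<sigma> \<cdot> pr d x (pr d y z) = x \<rhd> (\<sigma> \<cdot> pr d y z)"
    "d21 \<sigma> \<cdot> pr d x (pr d y z) = \<sigma> \<cdot> pr d (x \<star> y) z"
    "d22 \<sigma> \<cdot> pr d x (pr d y z) = \<sigma> \<cdot> pr d x (y \<star> z)"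
    "d23 \<sigma> \<cdot> pr d x (pr d y z) = \<sigma> \<cdot> pr d x (y \<star> (W.target \<cdot> z))"
  using assms by (simp_all add: d20_def d21_def d22_def d23_def \<Pi>L_eq)

end

context module_data
begin

text \<open>Regularity is an equational condition in \<open>convn\<close> and \<open>u\<close>,
  hence preserved by any \<open>F\<close> that respects these.\<close>

lemma Reg_homI:
  assumes F: "\<And>\<sigma>. \<sigma> \<in> Hom C (Hpow m) A \<Longrightarrow> F \<sigma> \<in> Hom C (Hpow n) A"
    "\<And>\<sigma> \<tau>. \<lbrakk>\<sigma> \<in> Hom C (Hpow m) A; \<tau> \<in> Hom C (Hpow m) A\<rbrakk> \<Longrightarrow> F (convn m \<sigma> \<tau>) = convn n (F \<sigma>) (F \<tau>)"
    "F (u m) = u n"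
    and cl: "\<And>\<sigma> \<tau>. \<lbrakk>\<sigma> \<in> Hom C (Hpow m) A; \<tau> \<in> Hom C (Hpow m) A\<rbrakk> \<Longrightarrow> convn m \<sigma> \<tau> \<in> Hom C (Hpow m) A"
  shows "F \<in> hom (Reg m) (Reg n)"
proof (rule homI)
  note Hom_iff [simp del]
  fix \<sigma> assume "\<sigma> \<in> carrier (Reg m)"
  then obtain \<tau> where s: "\<sigma> \<in> Hom C (Hpow m) A" and t: "\<tau> \<in> Hom C (Hpow m) A"
    and eq: "convn m \<sigma> \<tau> = u m" "convn m \<tau> \<sigma> = u m" "convn m (convn m \<sigma> \<tau>) \<sigma> = \<sigma>" "convn m (convn m \<tau> \<sigma>) \<tau> = \<tau>"
    by (auto simp: Reg_def)
  have "convn n (F \<sigma>) (F \<tau>) = u n" "convn n (F \<tau>) (F \<sigma>) = u n"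
    "convn n (convn n (F \<sigma>) (F \<tau>)) (F \<sigma>) = F \<sigma>" "convn n (convn n (F \<tau>) (F \<sigma>)) (F \<tau>) = F \<tau>"
    using F(2) [of \<sigma> \<tau>] F(2) [of \<tau> \<sigma>] F(2) [of "convn m \<sigma> \<tau>" \<sigma>] F(2) [of "convn m \<tau> \<sigma>" \<tau>] s t eq F(3) cl
    by metis+
  then show "F \<sigma> \<in> carrier (Reg n)"
    using F(1) [OF s] F(1) [OF t] by (auto simp: Reg_def)
next
  fix \<sigma> \<tau> assume "\<sigma> \<in> carrier (Reg m)" "\<tau> \<in> carrier (Reg m)"
  then show "F (\<sigma> \<otimes>\<^bsub>Reg m\<^esub> \<tau>) = F \<sigma> \<otimes>\<^bsub>Reg n\<^esub> F \<tau>"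
    using F(2) by (simp add: Reg_def)
qed

end

section \<open>Sweedler cohomology\<close>

text \<open>The separate name keeps the interpretations below out of \<open>sweedler_stage\<close>.\<close>

locale sweedler_powers = sweedler C \<H> \<A>
  for C :: "'m smcat" (structure) and \<H> :: "'m bialg" and \<A> :: "'m module_alg"
begin

lemma pow_2: "Hpow 2 = H \<^bold>\<otimes> H" "\<delta>pow 2 = tensor_comult H \<delta>\<^sub>H H \<delta>\<^sub>H" "mpow 2 = \<mu>\<^sub>H"
  by (simp_all add: numeral_2_eq_2)

lemma pow_3: "Hpow 3 = H \<^bold>\<otimes> H \<^bold>\<otimes> H" "\<delta>pow 3 = tensor_comult (H \<^bold>\<otimes> H) (\<delta>pow 2) H \<delta>\<^sub>H"
    "mpow 3 = \<mu>\<^sub>H \<cdot> (\<mu>\<^sub>H \<^bold>\<otimes> H)"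
  by (simp_all add: numeral_3_eq_3 numeral_2_eq_2)

lemma convn_eq: "convn n \<sigma> \<tau> = \<mu>\<^sub>A \<cdot> pr (\<delta>pow n) \<sigma> \<tau>"
  by (simp add: convn_def conv_def pr_def)

lemma u_eq: "u 1 = U" "u 2 = U \<cdot> \<mu>\<^sub>H" "u 3 = U \<cdot> \<mu>\<^sub>H \<cdot> (\<mu>\<^sub>H \<^bold>\<otimes> H)"
  using interchange' [of \<mu>\<^sub>H H K \<eta>\<^sub>A] interchange' [of "\<mu>\<^sub>H \<cdot> (\<mu>\<^sub>H \<^bold>\<otimes> H)" H K \<eta>\<^sub>A]
  by (simp_all add: u_def U_def pow_2 pow_3)

sublocale X2: two_stages C H \<epsilon>\<^sub>H \<delta>\<^sub>H H \<epsilon>\<^sub>H \<delta>\<^sub>H by unfold_locales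

lemma stage_2: "stage C (H \<^bold>\<otimes> H) (\<epsilon>\<^sub>H \<^bold>\<otimes> \<epsilon>\<^sub>H) (\<delta>pow 2)"
  unfolding pow_2 by (rule X2.DE.stage_axioms)

sublocale X3: two_stages C "H \<^bold>\<otimes> H" "\<epsilon>\<^sub>H \<^bold>\<otimes> \<epsilon>\<^sub>H" "\<delta>pow 2" H \<epsilon>\<^sub>H \<delta>\<^sub>H
  by (intro two_stages.intro stage_2) unfold_locales

lemma stage_3: "stage C (H \<^bold>\<otimes> H \<^bold>\<otimes> H) (\<epsilon>\<^sub>H \<^bold>\<otimes> \<epsilon>\<^sub>H \<^bold>\<otimes> \<epsilon>\<^sub>H) (\<delta>pow 3)"
  unfolding pow_3 using X3.DE.stage_axioms by simp

sublocale R1: sweedler_stage C \<H> \<A> H \<epsilon>\<^sub>H \<delta>\<^sub>H by unfold_locales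
sublocale R2: sweedler_stage C \<H> \<A> "H \<^bold>\<otimes> H" "\<epsilon>\<^sub>H \<^bold>\<otimes> \<epsilon>\<^sub>H" "\<delta>pow 2"
  by (intro sweedler_stage.intro stage_2) unfold_locales
sublocale R3: sweedler_stage C \<H> \<A> "H \<^bold>\<otimes> H \<^bold>\<otimes> H" "\<epsilon>\<^sub>H \<^bold>\<otimes> \<epsilon>\<^sub>H \<^bold>\<otimes> \<epsilon>\<^sub>H" "\<delta>pow 3"
  by (intro sweedler_stage.intro stage_3) unfold_locales

definition x2 where "x2 = lproj H \<epsilon>\<^sub>H"
definition y2 where "y2 = rproj \<epsilon>\<^sub>H H"
text \<open>\<open>\<delta>pow\<close> brackets to the left, so the first two coordinates of the
  third tensor power are reached through the projection onto the square.\<close>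

definition l3 where "l3 = lproj (H \<^bold>\<otimes> H) \<epsilon>\<^sub>H"
definition x3 where "x3 = x2 \<cdot> l3"
definition y3 where "y3 = y2 \<cdot> l3"
definition z3 where "z3 = rproj (\<epsilon>\<^sub>H \<^bold>\<otimes> \<epsilon>\<^sub>H) H"

lemma l3: "comultiplicative (\<delta>pow 3) (\<delta>pow 2) l3"
  using X3.comultiplicative_proj(1) by (simp add: pow_3 l3_def)

lemma pts: "R2.pt x2" "R2.pt y2" "R3.pt x3" "R3.pt y3" "R3.pt z3"
proof -
  show 2: "R2.pt x2" "R2.pt y2"
    using X2.comultiplicative_proj by (simp_all add: pow_2 x2_def y2_def)
  show "R3.pt x3" unfolding x3_def by (rule comultiplicative_comp [OF stage_3 stage_2 _ l3 2(1)]) unfold_locales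
  show "R3.pt y3" unfolding y3_def by (rule comultiplicative_comp [OF stage_3 stage_2 _ l3 2(2)]) unfold_locales
  show "R3.pt z3" using X3.comultiplicative_proj(2) by (simp add: pow_3 z3_def)
qed

lemmas coords [simp] = R2.WS.point_typing [OF pts(1)] R2.WS.point_typing [OF pts(2)]
  R3.WS.point_typing [OF pts(3)] R3.WS.point_typing [OF pts(4)] R3.WS.point_typing [OF pts(5)]

lemma pr_coords: "pr (\<delta>pow 2) x2 y2 = H \<^bold>\<otimes> H" "pr (\<delta>pow 3) x3 (pr (\<delta>pow 3) y3 z3) = H \<^bold>\<otimes> H \<^bold>\<otimes> H"
proof -
  show 1: "pr (\<delta>pow 2) x2 y2 = H \<^bold>\<otimes> H"
    unfolding x2_def y2_def pow_2 by (rule X2.pr_proj_id)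
  have "pr (\<delta>pow 3) x3 y3 = pr (\<delta>pow 2) x2 y2 \<cdot> l3"
    unfolding x3_def y3_def by (rule X3.D.pr_comp [OF l3, symmetric]) simp_all
  also have "\<dots> = l3" by (simp add: 1 l3_def)
  finally have 2: "pr (\<delta>pow 3) x3 y3 = l3" .
  have "pr (\<delta>pow 3) x3 (pr (\<delta>pow 3) y3 z3) = pr (\<delta>pow 3) (pr (\<delta>pow 3) x3 y3) z3" by simp
  also have "\<dots> = H \<^bold>\<otimes> H \<^bold>\<otimes> H"
    unfolding 2 using X3.pr_proj_id by (simp add: pow_3 l3_def z3_def)
  finally show "pr (\<delta>pow 3) x3 (pr (\<delta>pow 3) y3 z3) = H \<^bold>\<otimes> H \<^bold>\<otimes> H" .
qed

lemma eval2: "f \<in> Arr C \<Longrightarrow> Dom C f = H \<^bold>\<otimes> H \<Longrightarrow> f = f \<cdot> pr (\<delta>pow 2) x2 y2"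
  unfolding pr_coords by simp

lemma eval3: "f \<in> Arr C \<Longrightarrow> Dom C f = H \<^bold>\<otimes> H \<^bold>\<otimes> H \<Longrightarrow> f = f \<cdot> pr (\<delta>pow 3) x3 (pr (\<delta>pow 3) y3 z3)"
  unfolding pr_coords by simp

lemma d1_typing [simp]:
  assumes "h \<in> Hom C H A"
  shows "d10 h \<in> Arr C" "Dom C (d10 h) = H \<^bold>\<otimes> H" "Cod C (d10 h) = A"
    "d11 h \<in> Arr C" "Dom C (d11 h) = H \<^bold>\<otimes> H" "Cod C (d11 h) = A"
    "d12 h \<in> Arr C" "Dom C (d12 h) = H \<^bold>\<otimes> H" "Cod C (d12 h) = A"
  using assms by (simp_all add: d10_def d11_def d12_def \<Pi>L_eq)

lemma d2_typing [simp]: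
  assumes "\<sigma> \<in> Hom C (H \<^bold>\<otimes> H) A"
  shows "d20 \<sigma> \<in> Arr C" "Dom C (d20 \<sigma>) = H \<^bold>\<otimes> H \<^bold>\<otimes> H" "Cod C (d20 \<sigma>) = A"
    "d21 \<sigma> \<in> Arr C" "Dom C (d21 \<sigma>) = H \<^bold>\<otimes> H \<^bold>\<otimes> H" "Cod C (d21 \<sigma>) = A"
    "d22 \<sigma> \<in> Arr C" "Dom C (d22 \<sigma>) = H \<^bold>\<otimes> H \<^bold>\<otimes> H" "Cod C (d22 \<sigma>) = A"
    "d23 \<sigma> \<in> Arr C" "Dom C (d23 \<sigma>) = H \<^bold>\<otimes> H \<^bold>\<otimes> H" "Cod C (d23 \<sigma>) = A"
  using assms by (simp_all add: d20_def d21_def d22_def d23_def \<Pi>L_eq)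

lemma d1_eval:
  assumes "h \<in> Hom C H A"
  shows "d10 h = R2.act x2 (h \<cdot> y2)" "d11 h = h \<cdot> R2.mul x2 y2" "d12 h = h \<cdot> R2.mul x2 (W.target \<cdot> y2)"
proof -
  have "x2 \<in> Hom C (H \<^bold>\<otimes> H) H" "y2 \<in> Hom C (H \<^bold>\<otimes> H) H" by simp_all
  note * = R2.d1_pr [OF this assms]
  note t = d1_typing [OF assms]
  show "d10 h = R2.act x2 (h \<cdot> y2)" "d11 h = h \<cdot> R2.mul x2 y2" "d12 h = h \<cdot> R2.mul x2 (W.target \<cdot> y2)"
    unfolding *(1-3) [symmetric] by (rule eval2, simp_all only: t)+
qed

lemma d2_eval:
  assumes "\<sigma> \<in> Hom C (H \<^bold>\<otimes> H) A"
  shows "d20 \<sigma> = R3.act x3 (\<sigma> \<cdot> pr (\<delta>pow 3) y3 z3)" "d21 \<sigma> = \<sigma> \<cdot> pr (\<delta>pow 3) (R3.mul x3 y3) z3"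
    "d22 \<sigma> = \<sigma> \<cdot> pr (\<delta>pow 3) x3 (R3.mul y3 z3)"
    "d23 \<sigma> = \<sigma> \<cdot> pr (\<delta>pow 3) x3 (R3.mul y3 (W.target \<cdot> z3))"
proof -
  have "x3 \<in> Hom C (H \<^bold>\<otimes> H \<^bold>\<otimes> H) H" "y3 \<in> Hom C (H \<^bold>\<otimes> H \<^bold>\<otimes> H) H" "z3 \<in> Hom C (H \<^bold>\<otimes> H \<^bold>\<otimes> H) H" by simp_all
  note * = R3.d2_pr [OF this assms]
  note t = d2_typing [OF assms]
  show "d20 \<sigma> = R3.act x3 (\<sigma> \<cdot> pr (\<delta>pow 3) y3 z3)" "d21 \<sigma> = \<sigma> \<cdot> pr (\<delta>pow 3) (R3.mul x3 y3) z3"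
    "d22 \<sigma> = \<sigma> \<cdot> pr (\<delta>pow 3) x3 (R3.mul y3 z3)"
    "d23 \<sigma> = \<sigma> \<cdot> pr (\<delta>pow 3) x3 (R3.mul y3 (W.target \<cdot> z3))"
    unfolding *(1-4) [symmetric] by (rule eval3, simp_all only: t)+
qed

lemma u2_eval: "u 2 = U \<cdot> R2.mul x2 y2"
  unfolding u_eq pr_coords by simp

lemma u3_eval: "u 3 = U \<cdot> R3.mul x3 (R3.mul y3 z3)"
proof -
  have "u 3 = (U \<cdot> \<mu>\<^sub>H \<cdot> (\<mu>\<^sub>H \<^bold>\<otimes> H)) \<cdot> pr (\<delta>pow 3) x3 (pr (\<delta>pow 3) y3 z3)"
    unfolding u_eq by (rule eval3) simp_all
  also have "\<dots> = U \<cdot> R3.mul x3 (R3.mul y3 z3)"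
    by (simp add: R3.WS.mult_assoc)
  finally show ?thesis .
qed

lemma u_typing [simp]:
  "u 2 \<in> Arr C" "Dom C (u 2) = H \<^bold>\<otimes> H" "Cod C (u 2) = A"
  "u 3 \<in> Arr C" "Dom C (u 3) = H \<^bold>\<otimes> H \<^bold>\<otimes> H" "Cod C (u 3) = A"
  by (simp_all add: u_eq)

lemma u_idem: "R1.cv U U = U" "R2.cv (u 2) (u 2) = u 2" "R3.cv (u 3) (u 3) = u 3"
proof -
  show "R1.cv U U = U" using R1.U_idem [OF W.comultiplicative_id] by simp
  show "R2.cv (u 2) (u 2) = u 2"
    unfolding u2_eval by (intro R2.U_idem R2.WS.point_mult pts)
  show "R3.cv (u 3) (u 3) = u 3"
    unfolding u3_eval by (intro R3.U_idem R3.WS.point_mult pts)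
qed

lemma Reg_1: "comm_group (Reg 1)"
  "\<sigma> \<in> carrier (Reg 1) \<longleftrightarrow> R1.el \<sigma> \<and> R1.cv U \<sigma> = \<sigma> \<and> (\<exists>\<tau>. R1.el \<tau> \<and> R1.cv U \<tau> = \<tau> \<and> R1.cv \<sigma> \<tau> = U)"
proof -
  have "carrier (Reg 1) = {\<sigma> \<in> Hom C H A. \<exists>\<tau> \<in> Hom C H A. R1.cv \<sigma> \<tau> = U \<and> R1.cv \<tau> \<sigma> = U \<and>
      R1.cv (R1.cv \<sigma> \<tau>) \<sigma> = \<sigma> \<and> R1.cv (R1.cv \<tau> \<sigma>) \<tau> = \<tau>}"
    using u_eq(1) by (simp add: Reg_def convn_eq del: Hom_iff)
  moreover have "mult (Reg 1) = (\<lambda>\<sigma> \<tau>. R1.cv \<sigma> \<tau>)" "one (Reg 1) = U" using u_eq(1)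
    by (auto simp add: Reg_def convn_eq fun_eq_iff)
  ultimately show "comm_group (Reg 1)"
    "\<sigma> \<in> carrier (Reg 1) \<longleftrightarrow> R1.el \<sigma> \<and> R1.cv U \<sigma> = \<sigma> \<and> (\<exists>\<tau>. R1.el \<tau> \<and> R1.cv U \<tau> = \<tau> \<and> R1.cv \<sigma> \<tau> = U)"
    by (rule R1.comm_groupI; simp add: u_idem)+
qed

lemma Reg_2: "comm_group (Reg 2)"
  "\<sigma> \<in> carrier (Reg 2) \<longleftrightarrow> R2.el \<sigma> \<and> R2.cv (u 2) \<sigma> = \<sigma> \<and> (\<exists>\<tau>. R2.el \<tau> \<and> R2.cv (u 2) \<tau> = \<tau> \<and> R2.cv \<sigma> \<tau> = u 2)"
proof -
  have "carrier (Reg 2) = {\<sigma> \<in> Hom C (H \<^bold>\<otimes> H) A. \<exists>\<tau> \<in> Hom C (H \<^bold>\<otimes> H) A. R2.cv \<sigma> \<tau> = u 2 \<and> R2.cv \<tau> \<sigma> = u 2 \<and>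
      R2.cv (R2.cv \<sigma> \<tau>) \<sigma> = \<sigma> \<and> R2.cv (R2.cv \<tau> \<sigma>) \<tau> = \<tau>}"
    by (simp add: Reg_def convn_eq pow_2(1) del: Hom_iff)
  moreover have "mult (Reg 2) = (\<lambda>\<sigma> \<tau>. R2.cv \<sigma> \<tau>)" "one (Reg 2) = u 2"
    by (auto simp add: Reg_def convn_eq fun_eq_iff)
  ultimately show "comm_group (Reg 2)"
    "\<sigma> \<in> carrier (Reg 2) \<longleftrightarrow> R2.el \<sigma> \<and> R2.cv (u 2) \<sigma> = \<sigma> \<and> (\<exists>\<tau>. R2.el \<tau> \<and> R2.cv (u 2) \<tau> = \<tau> \<and> R2.cv \<sigma> \<tau> = u 2)"
    by (rule R2.comm_groupI; simp add: u_idem)+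
qed

lemma Reg_3: "comm_group (Reg 3)"
proof -
  have "carrier (Reg 3) = {\<sigma> \<in> Hom C (H \<^bold>\<otimes> H \<^bold>\<otimes> H) A. \<exists>\<tau> \<in> Hom C (H \<^bold>\<otimes> H \<^bold>\<otimes> H) A. R3.cv \<sigma> \<tau> = u 3 \<and> R3.cv \<tau> \<sigma> = u 3 \<and>
      R3.cv (R3.cv \<sigma> \<tau>) \<sigma> = \<sigma> \<and> R3.cv (R3.cv \<tau> \<sigma>) \<tau> = \<tau>}"
    by (simp add: Reg_def convn_eq pow_3(1) del: Hom_iff)
  moreover have "mult (Reg 3) = (\<lambda>\<sigma> \<tau>. R3.cv \<sigma> \<tau>)" "one (Reg 3) = u 3"
    by (auto simp add: Reg_def convn_eq fun_eq_iff)
  ultimately show "comm_group (Reg 3)"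
    by (rule R3.comm_groupI; simp add: u_idem)
qed

end

context comm_group
begin

text \<open>Brings \<open>D2 \<sigma> = 1\<close> into the form without inverses in which the
  cocycle condition is stated.\<close>

lemma alternating_eq_one_iff:
  assumes "p \<in> carrier G" "q \<in> carrier G" "r \<in> carrier G" "s \<in> carrier G"
  shows "p \<otimes> inv q \<otimes> r \<otimes> inv s = \<one> \<longleftrightarrow> s \<otimes> q = p \<otimes> r"
proof -
  have "p \<otimes> inv q \<otimes> r \<otimes> inv s = (p \<otimes> r) \<otimes> inv (s \<otimes> q)"
    using assms by (simp add: inv_mult m_ac)
  also have "\<dots> = \<one> \<longleftrightarrow> p \<otimes> r = s \<otimes> q"
    using assms by (metis inv_equality inv_closed m_closed r_inv inv_inv)
  finally show ?thesis by auto
qed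

text \<open>The shape of \<open>D2 (D1 h) = 1\<close> once the twelve composed faces have been
  identified in pairs: \<open>t\<close> cancels on the left side and \<open>q\<close> on the
  right.\<close>

lemma alternating_cancel:
  assumes "p \<in> carrier G" "q \<in> carrier G" "r \<in> carrier G" "s \<in> carrier G" "t \<in> carrier G" "w \<in> carrier G"
  shows "(r \<otimes> inv t \<otimes> w) \<otimes> (p \<otimes> inv s \<otimes> t) = (p \<otimes> inv q \<otimes> r) \<otimes> (q \<otimes> inv s \<otimes> w)"
proof -
  have "(r \<otimes> inv t \<otimes> w) \<otimes> (p \<otimes> inv s \<otimes> t) = (t \<otimes> inv t) \<otimes> (p \<otimes> r \<otimes> inv s \<otimes> w)"
    using assms by (simp only: m_ac m_closed inv_closed)
  also have "\<dots> = (q \<otimes> inv q) \<otimes> (p \<otimes> r \<otimes> inv s \<otimes> w)"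
    using assms by simp
  also have "\<dots> = (p \<otimes> inv q \<otimes> r) \<otimes> (q \<otimes> inv s \<otimes> w)"
    using assms by (simp only: m_ac m_closed inv_closed)
  finally show ?thesis .
qed

end

section \<open>Faces as group homomorphisms and the composite of the coboundaries\<close>

context sweedler_powers
begin

lemma mult_Reg: "\<sigma> \<otimes>\<^bsub>Reg n\<^esub> \<tau> = \<mu>\<^sub>A \<cdot> pr (\<delta>pow n) \<sigma> \<tau>" "\<one>\<^bsub>Reg n\<^esub> = u n"
  by (simp_all add: Reg_def convn_eq)

lemma mult_Reg_1: "\<sigma> \<otimes>\<^bsub>Reg 1\<^esub> \<tau> = R1.cv \<sigma> \<tau>" "\<one>\<^bsub>Reg 1\<^esub> = U"
  using u_eq(1) by (simp_all add: Reg_def convn_eq)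

lemma comultiplicative_pr2:
  assumes "stage C E e d" "W.point d a" "W.point d b"
  shows "comultiplicative d (\<delta>pow 2) (pr d a b)"
  unfolding pow_2 by (rule X2.comultiplicative_pr [OF assms])

lemma comultiplicative_pr3:
  assumes "stage C E e d" "W.point d a" "W.point d b" "W.point d x"
  shows "comultiplicative d (\<delta>pow 3) (pr d a (pr d b x))"
proof -
  interpret E: stage C E e d by fact
  have "comultiplicative d (\<delta>pow 3) (pr d (pr d a b) x)"
    unfolding pow_3(2) by (rule X3.comultiplicative_pr [OF assms(1) comultiplicative_pr2 [OF assms(1-3)] assms(4)])
  then show ?thesis using assms(2-4) by (simp add: comultiplicative_def)
qed

text \<open>A face either substitutes a tuple of elements or lets an element act; convolution is
  compatible with both. The neutral element is preserved because x U(y) = U(x y) and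
  \<open>U\<close> does not distinguish y from Pi^L y.\<close>

lemma hom_d1: "d10 \<in> hom (Reg 1) (Reg 2)" "d11 \<in> hom (Reg 1) (Reg 2)" "d12 \<in> hom (Reg 1) (Reg 2)"
proof -
  have cl: "\<mu>\<^sub>A \<cdot> pr \<delta>\<^sub>H \<sigma> \<tau> \<in> Hom C H A" if "\<sigma> \<in> Hom C H A" "\<tau> \<in> Hom C H A" for \<sigma> \<tau>
    using that by simp
  have pow_1: "Hpow 1 = H" "\<delta>pow 1 = \<delta>\<^sub>H" by simp_all
  note * = Reg_homI [of 1 _ 2, unfolded convn_eq u_eq(1) pow_1 pow_2(1), OF _ _ _ cl]
  have Ty: "R2.pt (W.target \<cdot> y2)" by (rule R2.WS.point_target_comp [OF pts(2)])
  have m: "R2.pt (R2.mul x2 y2)" "R2.pt (R2.mul x2 (W.target \<cdot> y2))"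
    by (intro R2.WS.point_mult pts Ty)+
  show "d10 \<in> hom (Reg 1) (Reg 2)"
  proof (rule *)
    fix \<sigma> \<tau> assume st: "\<sigma> \<in> Hom C H A" "\<tau> \<in> Hom C H A"
    have "R2.act x2 ((R1.cv \<sigma> \<tau>) \<cdot> y2) = R2.act x2 (R2.cv (\<sigma> \<cdot> y2) (\<tau> \<cdot> y2))"
      using R1.cv_comp [OF stage_2 pts(2) st] by simp
    also have "\<dots> = R2.cv (R2.act x2 (\<sigma> \<cdot> y2)) (R2.act x2 (\<tau> \<cdot> y2))"
      by (rule R2.act_cv [OF pts(1)]) (use st in simp_all)
    finally show "d10 (R1.cv \<sigma> \<tau>) = R2.cv (d10 \<sigma>) (d10 \<tau>)"
      using d1_eval(1) [OF st(1)] d1_eval(1) [OF st(2)] d1_eval(1) [OF cl [OF st]] by simp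
  next
    show "d10 U = u 2" using d1_eval(1) [of U] R2.act_U [of x2 y2] u2_eval by simp
  qed simp_all
  show "d11 \<in> hom (Reg 1) (Reg 2)"
  proof (rule *)
    fix \<sigma> \<tau> assume st: "\<sigma> \<in> Hom C H A" "\<tau> \<in> Hom C H A"
    show "d11 (R1.cv \<sigma> \<tau>) = R2.cv (d11 \<sigma>) (d11 \<tau>)"
      using R1.cv_comp [OF stage_2 m(1) st] d1_eval(2) [OF st(1)] d1_eval(2) [OF st(2)] d1_eval(2) [OF cl [OF st]]
      by simp
  next
    show "d11 U = u 2" using d1_eval(2) [of U] u2_eval by simp
  qed simp_all
  show "d12 \<in> hom (Reg 1) (Reg 2)"
  proof (rule *)
    fix \<sigma> \<tau> assume st: "\<sigma> \<in> Hom C H A" "\<tau> \<in> Hom C H A"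
    show "d12 (R1.cv \<sigma> \<tau>) = R2.cv (d12 \<sigma>) (d12 \<tau>)"
      using R1.cv_comp [OF stage_2 m(2) st] d1_eval(3) [OF st(1)] d1_eval(3) [OF st(2)] d1_eval(3) [OF cl [OF st]]
      by simp
  next
    have "d12 U = R2.act x2 (U \<cdot> (W.target \<cdot> y2))"
      using d1_eval(3) [of U] R2.act_U [of x2 "W.target \<cdot> y2"] by simp
    also have "\<dots> = u 2"
      using R2.U_target_comp [of y2] R2.act_U [of x2 y2] u2_eval by simp
    finally show "d12 U = u 2" .
  qed simp_all
qed

lemma hom_d2: "d20 \<in> hom (Reg 2) (Reg 3)" "d21 \<in> hom (Reg 2) (Reg 3)" "d22 \<in> hom (Reg 2) (Reg 3)"
  "d23 \<in> hom (Reg 2) (Reg 3)"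
proof -
  have cl: "\<mu>\<^sub>A \<cdot> pr (\<delta>pow 2) \<sigma> \<tau> \<in> Hom C (H \<^bold>\<otimes> H) A" if "\<sigma> \<in> Hom C (H \<^bold>\<otimes> H) A" "\<tau> \<in> Hom C (H \<^bold>\<otimes> H) A" for \<sigma> \<tau>
    using that by simp
  note * = Reg_homI [of 2 _ 3, unfolded convn_eq pow_2(1) pow_3(1), OF _ _ _ cl]
  define xy yz t yt where "xy = R3.mul x3 y3" and "yz = R3.mul y3 z3" and "t = W.target \<cdot> z3" and "yt = R3.mul y3 t"
  have p: "R3.pt xy" "R3.pt yz" "R3.pt t" "R3.pt yt"
    unfolding xy_def yz_def t_def yt_def by (intro R3.WS.point_mult R3.WS.point_target_comp pts)+
  note [simp] = R3.WS.point_typing [OF p(1)] R3.WS.point_typing [OF p(2)] R3.WS.point_typing [OF p(3)]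
    R3.WS.point_typing [OF p(4)]
  note ev = d2_eval [folded xy_def yz_def t_def, folded yt_def]
  note cm = comultiplicative_pr2 [OF stage_3]
  note u2 = u_eq(2)
  \<comment> \<open>Needed for \<open>d23\<close>: \<open>U\<close> does not see the
    \<open>target\<close> in the last argument.\<close>
  have yt: "U \<cdot> yt = U \<cdot> yz"
    using R3.act_U [of y3 t] R3.act_U [of y3 z3] R3.U_target_comp [of z3] by (simp add: yt_def yz_def t_def)
  have u3: "u 3 = U \<cdot> R3.mul x3 yz" "u 3 = U \<cdot> R3.mul xy z3" "u 3 = U \<cdot> R3.mul x3 yt"
  proof -
    show *: "u 3 = U \<cdot> R3.mul x3 yz" unfolding yz_def by (rule u3_eval)
    then show "u 3 = U \<cdot> R3.mul xy z3" using R3.WS.mult_assoc [of x3 y3 z3] by (simp add: xy_def yz_def)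
    show "u 3 = U \<cdot> R3.mul x3 yt" using * R3.act_U [of x3 yt] R3.act_U [of x3 yz] yt by simp
  qed
  show "d20 \<in> hom (Reg 2) (Reg 3)"
  proof (rule *)
    fix \<sigma> \<tau> assume st: "\<sigma> \<in> Hom C (H \<^bold>\<otimes> H) A" "\<tau> \<in> Hom C (H \<^bold>\<otimes> H) A"
    let ?k = "pr (\<delta>pow 3) y3 z3"
    have "R3.act x3 ((R2.cv \<sigma> \<tau>) \<cdot> ?k) = R3.act x3 (R3.cv (\<sigma> \<cdot> ?k) (\<tau> \<cdot> ?k))"
      using R2.cv_comp [OF stage_3 cm [OF pts(4,5)] st] by simp
    also have "\<dots> = R3.cv (R3.act x3 (\<sigma> \<cdot> ?k)) (R3.act x3 (\<tau> \<cdot> ?k))"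
      by (rule R3.act_cv [OF pts(3)]) (use st in simp_all)
    finally show "d20 (R2.cv \<sigma> \<tau>) = R3.cv (d20 \<sigma>) (d20 \<tau>)"
      using ev(1) [OF st(1)] ev(1) [OF st(2)] ev(1) [OF cl [OF st]] by simp
  next
    show "d20 (u 2) = u 3"
      using ev(1) [of "u 2"] R3.act_U [of x3 yz] u3(1) by (simp add: u2 yz_def)
  qed simp_all
  show "d21 \<in> hom (Reg 2) (Reg 3)"
  proof (rule *)
    fix \<sigma> \<tau> assume st: "\<sigma> \<in> Hom C (H \<^bold>\<otimes> H) A" "\<tau> \<in> Hom C (H \<^bold>\<otimes> H) A"
    show "d21 (R2.cv \<sigma> \<tau>) = R3.cv (d21 \<sigma>) (d21 \<tau>)"
      using R2.cv_comp [OF stage_3 cm [OF p(1) pts(5)] st] ev(2) [OF st(1)] ev(2) [OF st(2)] ev(2) [OF cl [OF st]]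
      by simp
  next
    show "d21 (u 2) = u 3" using ev(2) [of "u 2"] u3(2) by (simp add: u2)
  qed simp_all
  show "d22 \<in> hom (Reg 2) (Reg 3)"
  proof (rule *)
    fix \<sigma> \<tau> assume st: "\<sigma> \<in> Hom C (H \<^bold>\<otimes> H) A" "\<tau> \<in> Hom C (H \<^bold>\<otimes> H) A"
    show "d22 (R2.cv \<sigma> \<tau>) = R3.cv (d22 \<sigma>) (d22 \<tau>)"
      using R2.cv_comp [OF stage_3 cm [OF pts(3) p(2)] st] ev(3) [OF st(1)] ev(3) [OF st(2)] ev(3) [OF cl [OF st]]
      by simp
  next
    show "d22 (u 2) = u 3" using ev(3) [of "u 2"] u3(1) by (simp add: u2)
  qed simp_all
  show "d23 \<in> hom (Reg 2) (Reg 3)"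
  proof (rule *)
    fix \<sigma> \<tau> assume st: "\<sigma> \<in> Hom C (H \<^bold>\<otimes> H) A" "\<tau> \<in> Hom C (H \<^bold>\<otimes> H) A"
    show "d23 (R2.cv \<sigma> \<tau>) = R3.cv (d23 \<sigma>) (d23 \<tau>)"
      using R2.cv_comp [OF stage_3 cm [OF pts(3) p(4)] st] ev(4) [OF st(1)] ev(4) [OF st(2)] ev(4) [OF cl [OF st]]
      by simp
  next
    show "d23 (u 2) = u 3" using ev(4) [of "u 2"] u3(3) by (simp add: u2)
  qed simp_all
qed

text \<open>The cosimplicial identities. Two of them hold by the form of the faces, the others by
  associativity of the action or of the product, except the last, which is Pi^L(y Pi^L z) = Pi^L(y
  z).\<close>

lemma d2_d1:
  assumes "h \<in> Hom C H A"
  shows "d20 (d10 h) = d21 (d10 h)" "d20 (d11 h) = d22 (d10 h)" "d20 (d12 h) = d23 (d10 h)"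
    "d21 (d11 h) = d22 (d11 h)" "d21 (d12 h) = d23 (d11 h)" "d22 (d12 h) = d23 (d12 h)"
proof -
  define xy yz t yt where "xy = R3.mul x3 y3" and "yz = R3.mul y3 z3" and "t = W.target \<cdot> z3" and "yt = R3.mul y3 t"
  have p: "R3.pt xy" "R3.pt yz" "R3.pt t" "R3.pt yt"
    unfolding xy_def yz_def t_def yt_def by (intro R3.WS.point_mult R3.WS.point_target_comp pts)+
  note [simp] = R3.WS.point_typing [OF p(1)] R3.WS.point_typing [OF p(2)] R3.WS.point_typing [OF p(3)]
    R3.WS.point_typing [OF p(4)] assms [unfolded Hom_iff]
  note ev = d2_eval [folded xy_def yz_def t_def, folded yt_def]
  have h: "h \<in> Hom C H A" by fact
  have D: "d10 h \<in> Hom C (H \<^bold>\<otimes> H) A" "d11 h \<in> Hom C (H \<^bold>\<otimes> H) A" "d12 h \<in> Hom C (H \<^bold>\<otimes> H) A"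
    using d1_typing [OF h] by simp_all
  note ev = ev [OF D(1)] ev [OF D(2)] ev [OF D(3)]
  note pr = R3.d1_pr [OF _ _ h]
  note as = R3.WS.mult_assoc [of x3 y3 z3, folded xy_def yz_def] R3.WS.mult_assoc [of x3 y3 t, folded xy_def yt_def]
  show "d20 (d10 h) = d21 (d10 h)"
    unfolding ev by (simp add: pr xy_def R3.act_act)
  show "d20 (d11 h) = d22 (d10 h)"
    unfolding ev by (simp add: pr yz_def)
  show "d20 (d12 h) = d23 (d10 h)"
    unfolding ev by (simp add: pr yt_def t_def)
  show "d21 (d11 h) = d22 (d11 h)"
    unfolding ev using as by (simp add: pr)
  show "d21 (d12 h) = d23 (d11 h)"
    unfolding ev using as by (simp add: pr t_def)
  show "d22 (d12 h) = d23 (d12 h)"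
    unfolding ev using R3.WS.target_mult_target [of y3 z3] by (simp add: pr yz_def yt_def t_def)
qed

sublocale G1: comm_group "Reg 1" by (rule Reg_1)
sublocale G2: comm_group "Reg 2" by (rule Reg_2)
sublocale G3: comm_group "Reg 3" by (rule Reg_3)

lemma cocycle_iff:
  assumes "\<sigma> \<in> carrier (Reg 2)"
  shows "D2 \<sigma> = \<one>\<^bsub>Reg 3\<^esub> \<longleftrightarrow> is_cocycle \<sigma>"
proof -
  have "d20 \<sigma> \<in> carrier (Reg 3)" "d21 \<sigma> \<in> carrier (Reg 3)" "d22 \<sigma> \<in> carrier (Reg 3)" "d23 \<sigma> \<in> carrier (Reg 3)"
    using hom_d2 [THEN hom_in_carrier, OF assms] by simp_all
  then show ?thesis unfolding D2_def G3.alternating_eq_one_iff is_cocycle_def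
    by (subst G3.alternating_eq_one_iff) (simp_all add: Reg_def)
qed

lemma hom_D:
  "D1 \<in> hom (Reg 1) (Reg 2)" "D2 \<in> hom (Reg 2) (Reg 3)"
proof -
  note c1 = hom_d1 [THEN hom_in_carrier] and m1 = hom_d1 [THEN hom_mult]
  note c2 = hom_d2 [THEN hom_in_carrier] and m2 = hom_d2 [THEN hom_mult]
  show "D1 \<in> hom (Reg 1) (Reg 2)"
    by (rule homI) (simp_all only: D1_def c1 m1 G2.m_closed G2.inv_closed G2.inv_mult G2.m_ac)
  show "D2 \<in> hom (Reg 2) (Reg 3)"
    by (rule homI) (simp_all only: D2_def c2 m2 G3.m_closed G3.inv_closed G3.inv_mult G3.m_ac)
qed

lemma D2_D1:
  assumes "h \<in> carrier (Reg 1)"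
  shows "D2 (D1 h) = \<one>\<^bsub>Reg 3\<^esub>"
proof -
  interpret f0: group_hom "Reg 2" "Reg 3" d20 by unfold_locales (rule hom_d2)
  interpret f1: group_hom "Reg 2" "Reg 3" d21 by unfold_locales (rule hom_d2)
  interpret f2: group_hom "Reg 2" "Reg 3" d22 by unfold_locales (rule hom_d2)
  interpret f3: group_hom "Reg 2" "Reg 3" d23 by unfold_locales (rule hom_d2)
  have h: "h \<in> Hom C H A" using assms Reg_1(2) [of h] by simp
  note c = hom_d1 [THEN hom_in_carrier, OF assms]
  note c' = c [THEN f0.hom_closed] c [THEN f1.hom_closed] c [THEN f2.hom_closed] c [THEN f3.hom_closed]
  have D: "D1 h \<in> carrier (Reg 2)" using hom_D(1) assms by (rule hom_in_carrier)
  have e: "d20 (D1 h) = d20 (d10 h) \<otimes>\<^bsub>Reg 3\<^esub> inv\<^bsub>Reg 3\<^esub> d20 (d11 h) \<otimes>\<^bsub>Reg 3\<^esub> d20 (d12 h)"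
    "d21 (D1 h) = d21 (d10 h) \<otimes>\<^bsub>Reg 3\<^esub> inv\<^bsub>Reg 3\<^esub> d21 (d11 h) \<otimes>\<^bsub>Reg 3\<^esub> d21 (d12 h)"
    "d22 (D1 h) = d22 (d10 h) \<otimes>\<^bsub>Reg 3\<^esub> inv\<^bsub>Reg 3\<^esub> d22 (d11 h) \<otimes>\<^bsub>Reg 3\<^esub> d22 (d12 h)"
    "d23 (D1 h) = d23 (d10 h) \<otimes>\<^bsub>Reg 3\<^esub> inv\<^bsub>Reg 3\<^esub> d23 (d11 h) \<otimes>\<^bsub>Reg 3\<^esub> d23 (d12 h)"
    unfolding D1_def using c by simp_all
  have "d23 (D1 h) \<otimes>\<^bsub>Reg 3\<^esub> d21 (D1 h) = d20 (D1 h) \<otimes>\<^bsub>Reg 3\<^esub> d22 (D1 h)"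
    unfolding e d2_d1 [OF h] using c' by (intro G3.alternating_cancel) simp_all
  then show ?thesis
    unfolding D2_def using D by (subst G3.alternating_eq_one_iff) simp_all
qed

end

lemma (in comm_group) mult_inv_mult_cancel:
  assumes "p \<in> carrier G" "q \<in> carrier G" "r \<in> carrier G"
  shows "(p \<otimes> inv q \<otimes> r) \<otimes> q = p \<otimes> r"
proof -
  have "(p \<otimes> inv q \<otimes> r) \<otimes> q = (q \<otimes> inv q) \<otimes> (p \<otimes> r)"
    using assms by (simp only: m_ac m_closed inv_closed)
  then show ?thesis using assms by simp
qed

section \<open>The cocycle condition at elements\<close>

context sweedler_stage
begin

text \<open>The value of a regular cochain at elements x, y is invertible relative to
  \<open>U (x \<star> y)\<close>; it can be cancelled between elements that absorb this
  idempotent.\<close>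

lemma cv_cancel:
  assumes "el a" "el b" "el r" "el r'" "v \<odot> a = a" "v \<odot> b = b" "r \<odot> r' = v" "r \<odot> a = r \<odot> b"
  shows "a = b"
proof -
  have *: "x = r' \<odot> (r \<odot> x)" if "el x" "v \<odot> x = x" for x
  proof -
    have "r' \<odot> (r \<odot> x) = (r' \<odot> r) \<odot> x" by (rule cv_assoc [symmetric]) fact+
    also have "r' \<odot> r = v" using cv_comm [OF assms(4,3)] assms(7) by (simp only:)
    finally show ?thesis using that(2) by (simp only:)
  qed
  have "a = r' \<odot> (r \<odot> a)" by (rule *) fact+
  also have "\<dots> = r' \<odot> (r \<odot> b)" by (simp only: assms(8))
  also have "\<dots> = b" by (rule * [symmetric]) fact+
  finally show ?thesis .
qed

end

locale sweedler_powers_stage = sweedler_powers C \<H> \<A> + sweedler_stage C \<H> \<A> D e d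
  for C :: "'m smcat" (structure) and \<H> :: "'m bialg" and \<A> :: "'m module_alg" and D e d
begin

abbreviation "T \<equiv> W.target"
abbreviation "S \<equiv> W.source"

lemma stage_D: "stage C D e d" by unfold_locales

lemma cv_pr:
  assumes "pt x" "pt y" "R2.el \<sigma>" "R2.el \<tau>"
  shows "R2.cv \<sigma> \<tau> \<cdot> pr d x y = (\<sigma> \<cdot> pr d x y) \<odot> (\<tau> \<cdot> pr d x y)"
  using R2.cv_comp [OF stage_D comultiplicative_pr2 [OF stage_D assms(1,2)] assms(3,4)]
    assms(1,2) [THEN WS.point_typing(1)] assms(1,2) [THEN WS.point_typing(2)]
    assms(1,2) [THEN WS.point_typing(3)] assms(3,4) by simp

lemma u2_pr:
  assumes "pt x" "pt y"
  shows "u 2 \<cdot> pr d x y = U \<cdot> (x \<star> y)"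
  using WS.point_typing [OF assms(1)] WS.point_typing [OF assms(2)] by (simp add: u_eq(2))

lemma Reg_absorb:
  assumes "\<sigma> \<in> carrier (Reg 2)" "pt x" "pt y"
  shows "(U \<cdot> (x \<star> y)) \<odot> (\<sigma> \<cdot> pr d x y) = \<sigma> \<cdot> pr d x y"
proof -
  have s: "R2.el \<sigma>" "R2.cv (u 2) \<sigma> = \<sigma>" using assms(1) Reg_2(2) [of \<sigma>] by blast+
  have "R2.el (u 2)" by simp
  from cv_pr [OF assms(2,3) this s(1)] show ?thesis unfolding s(2) u2_pr [OF assms(2,3)] ..
qed

lemma cocycle_at:
  assumes "\<sigma> \<in> carrier (Reg 2)" "is_cocycle \<sigma>" "pt x" "pt y" "pt z"
  shows "(\<sigma> \<cdot> pr d x (y \<star> (T \<cdot> z))) \<odot> (\<sigma> \<cdot> pr d (x \<star> y) z)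
    = (x \<rhd> (\<sigma> \<cdot> pr d y z)) \<odot> (\<sigma> \<cdot> pr d x (y \<star> z))"
proof -
  have s: "\<sigma> \<in> Hom C (H \<^bold>\<otimes> H) A" using assms(1) Reg_2(2) [of \<sigma>] by blast
  note t = WS.point_typing [OF assms(3)] WS.point_typing [OF assms(4)] WS.point_typing [OF assms(5)]
  have h: "x \<in> Hom C D H" "y \<in> Hom C D H" "z \<in> Hom C D H" using t by simp_all
  define k where "k = pr d x (pr d y z)"
  have k: "comultiplicative d (\<delta>pow 3) k"
    unfolding k_def by (rule comultiplicative_pr3 [OF stage_D assms(3-5)])
  have [simp]: "k \<in> Arr C" "Dom C k = D" "Cod C k = H \<^bold>\<otimes> H \<^bold>\<otimes> H" using t by (simp_all add: k_def)
  note ev = d2_pr [OF h s, folded k_def]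
  have el: "R3.el (d20 \<sigma>)" "R3.el (d21 \<sigma>)" "R3.el (d22 \<sigma>)" "R3.el (d23 \<sigma>)"
    using d2_typing [OF s] by simp_all
  have "R3.cv (d23 \<sigma>) (d21 \<sigma>) = R3.cv (d20 \<sigma>) (d22 \<sigma>)"
    using assms(2) by (simp only: is_cocycle_def convn_eq)
  then have "R3.cv (d23 \<sigma>) (d21 \<sigma>) \<cdot> k = R3.cv (d20 \<sigma>) (d22 \<sigma>) \<cdot> k" by (simp only:)
  then have "(\<mu>\<^sub>A \<cdot> pr (\<delta>pow 3) (d23 \<sigma>) (d21 \<sigma>)) \<cdot> k = (\<mu>\<^sub>A \<cdot> pr (\<delta>pow 3) (d20 \<sigma>) (d22 \<sigma>)) \<cdot> k" .
  then show ?thesis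
    unfolding R3.cv_comp [OF stage_D k el(4,2)] R3.cv_comp [OF stage_D k el(1,3)] ev .
qed

lemma Reg_inverse:
  assumes "\<sigma> \<in> carrier (Reg 2)"
  obtains \<tau> where "\<tau> \<in> carrier (Reg 2)" "\<And>x y. \<lbrakk>pt x; pt y\<rbrakk> \<Longrightarrow> (\<sigma> \<cdot> pr d x y) \<odot> (\<tau> \<cdot> pr d x y) = U \<cdot> (x \<star> y)"
proof
  let ?t = "inv\<^bsub>Reg 2\<^esub> \<sigma>"
  show t: "?t \<in> carrier (Reg 2)" using assms by simp
  have "R2.cv \<sigma> ?t = u 2" using G2.r_inv [OF assms] by (simp only: mult_Reg)
  moreover have "R2.el \<sigma>" "R2.el ?t" using assms t Reg_2(2) by blast+
  ultimately show "(\<sigma> \<cdot> pr d x y) \<odot> (?t \<cdot> pr d x y) = U \<cdot> (x \<star> y)" if "pt x" "pt y" for x y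
    using cv_pr [OF that, of \<sigma> ?t] u2_pr [OF that] by (simp only:)
qed

lemma el_pr: "\<sigma> \<in> carrier (Reg 2) \<Longrightarrow> pt x \<Longrightarrow> pt y \<Longrightarrow> el (\<sigma> \<cdot> pr d x y)"
  using Reg_2(2) [of \<sigma>] WS.point_typing [of x] WS.point_typing [of y] by simp

lemma target_idem:
  assumes "pt z"
  shows "T \<cdot> (T \<cdot> z) = T \<cdot> z" "(T \<cdot> z) \<star> (T \<cdot> z) = T \<cdot> z"
proof -
  show 1: "T \<cdot> (T \<cdot> z) = T \<cdot> z"
    using W.target_target comp_assoc' [of z T T] WS.point_typing [OF assms] by simp
  show "(T \<cdot> z) \<star> (T \<cdot> z) = T \<cdot> z"
    using WS.target_mult [OF WS.point_target_comp [OF assms]] unfolding 1 .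
qed

text \<open>Being fixed by \<open>target\<close>, Pi^R z is subject to
  \<open>target_mult\<close>.\<close>

lemma source_idem:
  assumes "pt z"
  shows "T \<cdot> (S \<cdot> z) = S \<cdot> z" "(S \<cdot> z) \<star> (S \<cdot> z) = S \<cdot> z"
proof -
  show 1: "T \<cdot> (S \<cdot> z) = S \<cdot> z"
    using W.target_source comp_assoc' [of z S T] WS.point_typing [OF assms] by simp
  show "(S \<cdot> z) \<star> (S \<cdot> z) = S \<cdot> z"
    using WS.target_mult [OF WS.point_source_comp [OF assms]] unfolding 1 .
qed

text \<open>The cocycle condition at \<open>(\<Pi>\<^sup>L z, \<Pi>\<^sup>L z, z)\<close>, and below at \<open>(x, \<Pi>\<^sup>R x, \<Pi>\<^sup>R x)\<close>.\<close>

lemma cocycle_target: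
  assumes \<sigma>: "\<sigma> \<in> carrier (Reg 2)" "is_cocycle \<sigma>" and z: "pt z"
  shows "\<sigma> \<cdot> pr d (T \<cdot> z) (T \<cdot> z) = \<sigma> \<cdot> pr d (T \<cdot> z) z"
proof -
  obtain \<tau> where \<tau>: "\<tau> \<in> carrier (Reg 2)" "\<And>x y. \<lbrakk>pt x; pt y\<rbrakk> \<Longrightarrow> (\<sigma> \<cdot> pr d x y) \<odot> (\<tau> \<cdot> pr d x y) = U \<cdot> (x \<star> y)"
    using Reg_inverse [OF \<sigma>(1)] by blast
  have Tz: "pt (T \<cdot> z)" by (rule WS.point_target_comp [OF z])
  have Uz: "U \<cdot> (T \<cdot> z) = U \<cdot> z" using U_target_comp [of z] WS.point_typing [OF z] by simp
  let ?r = "\<sigma> \<cdot> pr d (T \<cdot> z) z"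
  have el: "el ?r" "el (\<sigma> \<cdot> pr d (T \<cdot> z) (T \<cdot> z))" "el (\<tau> \<cdot> pr d (T \<cdot> z) z)"
    by (rule el_pr [OF _ Tz] \<sigma> \<tau> z Tz)+
  have ab: "(U \<cdot> z) \<odot> ?r = ?r"
    using Reg_absorb [OF \<sigma>(1) Tz z] unfolding WS.target_mult [OF z] .
  show ?thesis
  proof (rule cv_cancel [OF el(2,1,1,3)])
    show "(U \<cdot> z) \<odot> (\<sigma> \<cdot> pr d (T \<cdot> z) (T \<cdot> z)) = \<sigma> \<cdot> pr d (T \<cdot> z) (T \<cdot> z)"
      using Reg_absorb [OF \<sigma>(1) Tz Tz] unfolding target_idem [OF z] Uz .
    show "(U \<cdot> z) \<odot> ?r = ?r" by (rule ab)
    show "?r \<odot> (\<tau> \<cdot> pr d (T \<cdot> z) z) = U \<cdot> z"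
      using \<tau>(2) [OF Tz z] unfolding WS.target_mult [OF z] .
    \<comment> \<open>At these arguments three of the four factors of the cocycle condition reduce
      to \<open>?r\<close>, the acted one by \<open>target_act\<close>.\<close>
    have "(\<sigma> \<cdot> pr d (T \<cdot> z) (T \<cdot> z)) \<odot> ?r = ((T \<cdot> z) \<rhd> ?r) \<odot> ?r"
      using cocycle_at [OF \<sigma> Tz Tz z] unfolding target_idem [OF z] WS.target_mult [OF z] .
    also have "(T \<cdot> z) \<rhd> ?r = (U \<cdot> z) \<odot> ?r"
      by (rule target_act [OF z el(1)])
    finally have "(\<sigma> \<cdot> pr d (T \<cdot> z) (T \<cdot> z)) \<odot> ?r = ?r \<odot> ?r" unfolding ab .
    then show "?r \<odot> (\<sigma> \<cdot> pr d (T \<cdot> z) (T \<cdot> z)) = ?r \<odot> ?r"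
      using cv_comm [OF el(1,2)] by (simp only:)
  qed
qed

lemma cocycle_source:
  assumes \<sigma>: "\<sigma> \<in> carrier (Reg 2)" "is_cocycle \<sigma>" and x: "pt x"
  shows "x \<rhd> (\<sigma> \<cdot> pr d (S \<cdot> x) (S \<cdot> x)) = \<sigma> \<cdot> pr d x (S \<cdot> x)"
proof -
  obtain \<tau> where \<tau>: "\<tau> \<in> carrier (Reg 2)" "\<And>x y. \<lbrakk>pt x; pt y\<rbrakk> \<Longrightarrow> (\<sigma> \<cdot> pr d x y) \<odot> (\<tau> \<cdot> pr d x y) = U \<cdot> (x \<star> y)"
    using Reg_inverse [OF \<sigma>(1)] by blast
  have Sx: "pt (S \<cdot> x)" by (rule WS.point_source_comp [OF x])
  let ?s = "\<sigma> \<cdot> pr d x (S \<cdot> x)" and ?b = "x \<rhd> (\<sigma> \<cdot> pr d (S \<cdot> x) (S \<cdot> x))"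
  have el: "el ?s" "el (\<sigma> \<cdot> pr d (S \<cdot> x) (S \<cdot> x))" "el (\<tau> \<cdot> pr d x (S \<cdot> x))"
    by (rule el_pr [OF _ _ Sx] \<sigma> \<tau> x Sx)+
  have elb: "el ?b" using el(2) WS.point_typing [OF x] by simp
  show ?thesis
  proof (rule cv_cancel [OF elb el(1,1,3)])
    show "(U \<cdot> x) \<odot> ?b = ?b" by (rule U_act [OF x el(2)])
    show "(U \<cdot> x) \<odot> ?s = ?s" using Reg_absorb [OF \<sigma>(1) x Sx] unfolding WS.mult_source [OF x] .
    show "?s \<odot> (\<tau> \<cdot> pr d x (S \<cdot> x)) = U \<cdot> x" using \<tau>(2) [OF x Sx] unfolding WS.mult_source [OF x] .
    \<comment> \<open>At these arguments three of the four factors of the cocycle condition reduce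
      to \<open>?s\<close>.\<close>
    have "?s \<odot> ?s = ?b \<odot> ?s"
      using cocycle_at [OF \<sigma> x Sx Sx] unfolding source_idem [OF x] WS.mult_source [OF x] .
    then show "?s \<odot> ?b = ?s \<odot> ?s"
      using cv_comm [OF el(1) elb] by (simp only:)
  qed
qed

end

section \<open>Normalization of cocycles\<close>

context sweedler_powers
begin

lemma powers_stage_1: "sweedler_powers_stage C \<H> \<A> H \<epsilon>\<^sub>H \<delta>\<^sub>H" by unfold_locales

lemma Reg_el: "\<sigma> \<in> carrier (Reg 2) \<Longrightarrow> R2.el \<sigma>" "h \<in> carrier (Reg 1) \<Longrightarrow> R1.el h"
  using Reg_1(2) Reg_2(2) by blast+

text \<open>A regular cochain absorbs \<open>u 2\<close>, a function of the product x y; this puts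
  it into the form that \<open>unit_left_eval\<close> and \<open>unit_right_eval\<close>
  evaluate.\<close>

lemma Reg_unit:
  assumes "\<sigma> \<in> carrier (Reg 2)"
  shows "\<sigma> \<cdot> (\<eta>\<^sub>H \<^bold>\<otimes> H) = \<sigma> \<cdot> pr \<delta>\<^sub>H W.target H" "\<sigma> \<cdot> (H \<^bold>\<otimes> \<eta>\<^sub>H) = \<sigma> \<cdot> pr \<delta>\<^sub>H H W.source"
proof -
  interpret N: sweedler_powers_stage C \<H> \<A> H \<epsilon>\<^sub>H \<delta>\<^sub>H by (rule powers_stage_1)
  have [simp]: "\<sigma> \<in> Arr C" "Dom C \<sigma> = H \<^bold>\<otimes> H" "Cod C \<sigma> = A" using Reg_el(1) [OF assms] by simp_all
  have pH: "W.point \<delta>\<^sub>H H" by (rule W.comultiplicative_id)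
  have cm: "R2.cv \<sigma> (U \<cdot> \<mu>\<^sub>H) = \<sigma>"
    using assms Reg_2(2) [of \<sigma>] R2.cv_comm [of \<sigma> "u 2"] by (simp add: u_eq(2))
  have "\<sigma> \<cdot> (\<eta>\<^sub>H \<^bold>\<otimes> H) = R2.cv \<sigma> (U \<cdot> \<mu>\<^sub>H) \<cdot> (\<eta>\<^sub>H \<^bold>\<otimes> H)" unfolding cm ..
  also have "\<dots> = \<mu>\<^sub>A \<cdot> (pr (\<delta>pow 2) \<sigma> (U \<cdot> \<mu>\<^sub>H) \<cdot> (\<eta>\<^sub>H \<^bold>\<otimes> H))"
    by (rule comp_assoc') simp_all
  also have "\<dots> = R1.cv (\<sigma> \<cdot> pr \<delta>\<^sub>H W.target H) U"
    by (subst W.unit_left_eval [OF pow_2(2)]) simp_all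
  also have "\<dots> = R1.cv U (\<sigma> \<cdot> pr \<delta>\<^sub>H W.target H)" by (rule R1.cv_comm) simp_all
  also have "\<dots> = \<sigma> \<cdot> pr \<delta>\<^sub>H W.target H"
    using N.Reg_absorb [OF assms R1.WS.point_target_comp [OF pH] pH] R1.WS.target_mult [OF pH] by simp
  finally show "\<sigma> \<cdot> (\<eta>\<^sub>H \<^bold>\<otimes> H) = \<sigma> \<cdot> pr \<delta>\<^sub>H W.target H" .
  have "\<sigma> \<cdot> (H \<^bold>\<otimes> \<eta>\<^sub>H) = R2.cv \<sigma> (U \<cdot> \<mu>\<^sub>H) \<cdot> (H \<^bold>\<otimes> \<eta>\<^sub>H)" unfolding cm ..
  also have "\<dots> = \<mu>\<^sub>A \<cdot> (pr (\<delta>pow 2) \<sigma> (U \<cdot> \<mu>\<^sub>H) \<cdot> (H \<^bold>\<otimes> \<eta>\<^sub>H))"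
    by (rule comp_assoc') simp_all
  also have "\<dots> = R1.cv (\<sigma> \<cdot> pr \<delta>\<^sub>H H W.source) U"
    by (subst W.unit_right_eval [OF pow_2(2)]) simp_all
  also have "\<dots> = R1.cv U (\<sigma> \<cdot> pr \<delta>\<^sub>H H W.source)" by (rule R1.cv_comm) simp_all
  also have "\<dots> = \<sigma> \<cdot> pr \<delta>\<^sub>H H W.source"
    using N.Reg_absorb [OF assms pH R1.WS.point_source_comp [OF pH]] R1.WS.mult_source [OF pH] by simp
  finally show "\<sigma> \<cdot> (H \<^bold>\<otimes> \<eta>\<^sub>H) = \<sigma> \<cdot> pr \<delta>\<^sub>H H W.source" .
qed

lemma is_normal_iff:
  assumes "\<sigma> \<in> carrier (Reg 2)"
  shows "is_normal \<sigma> \<longleftrightarrow> \<sigma> \<cdot> pr \<delta>\<^sub>H W.target H = U \<and> \<sigma> \<cdot> pr \<delta>\<^sub>H H W.source = U"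
  unfolding is_normal_def Reg_unit [OF assms] u_eq ..

text \<open>The normalizing cochain is \<open>h(x) = \<sigma>\<^sup>-\<^sup>1(\<Pi>\<^sup>L x, x)\<close>.  It factors through \<open>\<Pi>\<^sup>L\<close>, so the last two factors of
  \<open>D1 h\<close> cancel and \<open>(D1 h)(x, y) = x h(y)\<close>.\<close>

lemma ex_normal:
  assumes \<sigma>: "\<sigma> \<in> carrier (Reg 2)" "is_cocycle \<sigma>"
  shows "\<exists>h \<in> carrier (Reg 1). D1 h \<otimes>\<^bsub>Reg 2\<^esub> \<sigma> \<in> normal_cocycles"
proof -
  interpret N: sweedler_powers_stage C \<H> \<A> H \<epsilon>\<^sub>H \<delta>\<^sub>H by (rule powers_stage_1)
  let ?T = "W.target" and ?S = "W.source"
  have pH: "R1.pt H" by (rule W.comultiplicative_id)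
  have pT: "R1.pt ?T" and pS: "R1.pt ?S" by (rule W.point_target W.point_source)+
  note [simp] = Reg_el(1) [OF \<sigma>(1), unfolded Hom_iff]
  obtain \<tau> where \<tau>: "\<tau> \<in> carrier (Reg 2)" "\<And>x y. \<lbrakk>R1.pt x; R1.pt y\<rbrakk> \<Longrightarrow> R1.cv (\<sigma> \<cdot> pr \<delta>\<^sub>H x y) (\<tau> \<cdot> pr \<delta>\<^sub>H x y) = U \<cdot> R1.mul x y"
    using N.Reg_inverse [OF \<sigma>(1)] by blast
  note [simp] = Reg_el(1) [OF \<tau>(1), unfolded Hom_iff]
  define r h where "r = \<sigma> \<cdot> pr \<delta>\<^sub>H ?T H" and "h = \<tau> \<cdot> pr \<delta>\<^sub>H ?T H"
  have [simp]: "r \<in> Arr C" "Dom C r = H" "Cod C r = A" "h \<in> Arr C" "Dom C h = H" "Cod C h = A"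
    by (simp_all add: r_def h_def)
  have TH: "R1.mul ?T H = H" using R1.WS.target_mult [OF pH] by simp
  have rh: "R1.cv r h = U" using \<tau>(2) [OF pT pH] by (simp add: r_def h_def TH)
  have Ur: "R1.cv U r = r" and Uh: "R1.cv U h = h"
    using N.Reg_absorb [OF \<sigma>(1) pT pH] N.Reg_absorb [OF \<tau>(1) pT pH] by (simp_all add: r_def h_def TH)
  have hr: "R1.cv h r = U" using rh R1.cv_comm [of h r] by simp
  have hReg: "h \<in> carrier (Reg 1)"
    unfolding Reg_1(2) using Uh Ur hr by (intro conjI exI [of _ r]) simp_all
  have comp_pr: "f \<cdot> pr \<delta>\<^sub>H ?T H \<cdot> x = f \<cdot> pr \<delta>\<^sub>H (?T \<cdot> x) x" if "R1.pt x" for f x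
    using W.pr_comp [OF that, of ?T H] R1.WS.point_typing [OF that] by simp
  have comp_r: "(\<sigma> \<cdot> pr \<delta>\<^sub>H ?T H) \<cdot> x = \<sigma> \<cdot> pr \<delta>\<^sub>H (?T \<cdot> x) x" if "R1.pt x" for x
    using comp_pr [OF that] R1.WS.point_typing [OF that] by simp
  have rT: "r \<cdot> ?T = r"
    unfolding r_def using comp_r [OF pT] N.cocycle_target [OF \<sigma> pH] N.target_idem(1) [OF pH] by simp
  \<comment> \<open>Inverses inherit the factorization: \<open>h \<cdot> ?T\<close> is another
    inverse of \<open>r \<cdot> ?T\<close>, which is \<open>r\<close>.\<close>
  have hT: "h \<cdot> ?T = h"
  proof (rule R1.cv_cancel [of _ _ r h U])
    have 1: "R1.cv (f \<cdot> ?T) (g \<cdot> ?T) = R1.cv f g \<cdot> ?T" if "R1.el f" "R1.el g" for f g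
      using R1.cv_comp [OF N.stage_D pT that] by simp
    show "R1.cv U (h \<cdot> ?T) = h \<cdot> ?T"
      using 1 [of U h] Uh U_target by simp
    show "R1.cv r (h \<cdot> ?T) = R1.cv r h"
      using 1 [of r h] rT rh U_target by simp
  qed (simp_all add: Uh rh)
  \<comment> \<open>The two faces differ by a \<open>target\<close> on the second factor of the
    product; since \<open>h\<close> allows an outer \<open>target\<close>,
    \<open>target_mult_target\<close> removes the inner one.\<close>
  have "d11 h = d12 h"
  proof -
    have "h \<cdot> R2.mul x2 (?T \<cdot> y2) = (h \<cdot> ?T) \<cdot> R2.mul x2 (?T \<cdot> y2)" unfolding hT ..
    also have "\<dots> = h \<cdot> ?T \<cdot> R2.mul x2 (?T \<cdot> y2)" by (rule comp_assoc') simp_all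
    also have "?T \<cdot> R2.mul x2 (?T \<cdot> y2) = ?T \<cdot> R2.mul x2 y2"
      by (rule R2.WS.target_mult_target) simp_all
    also have "h \<cdot> ?T \<cdot> R2.mul x2 y2 = (h \<cdot> ?T) \<cdot> R2.mul x2 y2" by (rule comp_assoc' [symmetric]) simp_all
    finally show ?thesis unfolding hT using d1_eval(2,3) [of h] by simp
  qed
  then have D1h: "D1 h = d10 h"
    unfolding D1_def using hom_d1 [THEN hom_in_carrier, OF hReg] by (simp add: G2.m_assoc)
  let ?\<alpha> = "D1 h \<otimes>\<^bsub>Reg 2\<^esub> \<sigma>"
  have D: "D1 h \<in> carrier (Reg 2)" by (rule hom_in_carrier [OF hom_D(1) hReg])
  then have \<alpha>: "?\<alpha> \<in> carrier (Reg 2)" using \<sigma>(1) by simp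
  interpret D2: group_hom "Reg 2" "Reg 3" D2 by unfold_locales (rule hom_D)
  have "is_cocycle ?\<alpha>"
    unfolding cocycle_iff [OF \<alpha>, symmetric]
    using D \<sigma> by (simp add: D2_D1 [OF hReg] cocycle_iff [OF \<sigma>(1), symmetric])
  moreover have "is_normal ?\<alpha>"
    unfolding is_normal_iff [OF \<alpha>]
  proof
    note ev = N.cv_pr [OF _ _ Reg_el(1) [OF D] Reg_el(1) [OF \<sigma>(1)], folded mult_Reg]
    have "?\<alpha> \<cdot> pr \<delta>\<^sub>H ?T H = R1.cv (R1.act ?T h) r"
      using ev [OF pT pH] R1.d1_pr(1) [of ?T H h] by (simp add: D1h r_def)
    also have "R1.act ?T h = h" using R1.target_act [OF pH, of h] Uh by simp
    finally show "?\<alpha> \<cdot> pr \<delta>\<^sub>H ?T H = U" by (simp only: hr)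
    \<comment> \<open>With \<open>cocycle_source\<close> the value of \<open>\<sigma>\<close> at (x,
      Pi^R x) becomes x r(Pi^R x), the inverse of the factor x h(Pi^R x) contributed by
      \<open>D1 h\<close>.\<close>
    have rS: "r \<cdot> ?S = \<sigma> \<cdot> pr \<delta>\<^sub>H ?S ?S"
      unfolding r_def comp_r [OF pS] using W.target_source by simp
    have "?\<alpha> \<cdot> pr \<delta>\<^sub>H H ?S = R1.cv (R1.act H (h \<cdot> ?S)) (\<sigma> \<cdot> pr \<delta>\<^sub>H H ?S)"
      using ev [OF pH pS] R1.d1_pr(1) [of H ?S h] by (simp add: D1h)
    also have "\<sigma> \<cdot> pr \<delta>\<^sub>H H ?S = R1.act H (r \<cdot> ?S)"
      unfolding rS using N.cocycle_source [OF \<sigma> pH] by simp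
    also have "R1.cv (R1.act H (h \<cdot> ?S)) (R1.act H (r \<cdot> ?S)) = R1.act H (R1.cv (h \<cdot> ?S) (r \<cdot> ?S))"
      by (rule R1.act_cv [OF pH, symmetric]) simp_all
    also have "R1.cv (h \<cdot> ?S) (r \<cdot> ?S) = R1.cv h r \<cdot> ?S"
      by (rule R1.cv_comp [OF N.stage_D pS, symmetric]) simp_all
    also have "R1.act H (R1.cv h r \<cdot> ?S) = U"
      unfolding hr using R1.act_U [of H ?S] R1.WS.mult_source [OF pH] by simp
    finally show "?\<alpha> \<cdot> pr \<delta>\<^sub>H H ?S = U" .
  qed
  ultimately have "?\<alpha> \<in> normal_cocycles" using \<alpha> by (simp add: normal_cocycles_def)
  then show ?thesis using hReg by blast
qed

text \<open>Normality of both cocycles makes \<open>D1 h\<close> trivial at (Pi^L x, x). There the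
  coboundary formula reads h(x) = (Pi^L(x) h(x)) h(Pi^L x), the action of Pi^L(x) is trivial on
  h(x), and h(x) cancels. The conclusion is what unit preservation requires of
  \<open>h\<close>.\<close>

lemma normal_coboundary_target:
  assumes \<alpha>: "\<alpha> \<in> normal_cocycles" and \<beta>: "\<beta> \<in> normal_cocycles" and h: "h \<in> carrier (Reg 1)"
    and eq: "\<alpha> = D1 h \<otimes>\<^bsub>Reg 2\<^esub> \<beta>"
  shows "h \<cdot> W.target = U"
proof -
  interpret N: sweedler_powers_stage C \<H> \<A> H \<epsilon>\<^sub>H \<delta>\<^sub>H by (rule powers_stage_1)
  let ?T = "W.target"
  have pH: "R1.pt H" by (rule W.comultiplicative_id)
  have pT: "R1.pt ?T" by (rule W.point_target)
  have TH: "R1.mul ?T H = H" using R1.WS.target_mult [OF pH] by simp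
  have TT: "R1.mul ?T ?T = ?T" using N.target_idem(2) [OF pH] by simp
  note [simp] = Reg_el(2) [OF h, unfolded Hom_iff]
  have c: "\<alpha> \<in> carrier (Reg 2)" "\<beta> \<in> carrier (Reg 2)" and D: "D1 h \<in> carrier (Reg 2)"
    using \<alpha> \<beta> hom_in_carrier [OF hom_D(1) h] by (simp_all add: normal_cocycles_def)
  have n: "\<alpha> \<cdot> pr \<delta>\<^sub>H ?T H = U" "\<beta> \<cdot> pr \<delta>\<^sub>H ?T H = U"
    using \<alpha> \<beta> c by (simp_all add: normal_cocycles_def is_normal_iff)
  note Del = Reg_el(1) [OF D]
  have "U = R1.cv (D1 h \<cdot> pr \<delta>\<^sub>H ?T H) U"
    using N.cv_pr [OF pT pH Del Reg_el(1) [OF c(2)]] n eq by (simp only: mult_Reg)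
  also have "\<dots> = R1.cv U (D1 h \<cdot> pr \<delta>\<^sub>H ?T H)" by (rule R1.cv_comm) (use Del in simp_all)
  also have "\<dots> = D1 h \<cdot> pr \<delta>\<^sub>H ?T H"
    using N.Reg_absorb [OF D pT pH] unfolding TH by simp
  finally have DU: "D1 h \<cdot> pr \<delta>\<^sub>H ?T H = U" by simp
  note c1 = hom_d1 [THEN hom_in_carrier, OF h]
  note el = c1 [THEN Reg_el(1)]
  have "D1 h \<otimes>\<^bsub>Reg 2\<^esub> d11 h = d10 h \<otimes>\<^bsub>Reg 2\<^esub> d12 h"
    unfolding D1_def using c1 by (rule G2.mult_inv_mult_cancel)
  then have "R2.cv (D1 h) (d11 h) \<cdot> pr \<delta>\<^sub>H ?T H = R2.cv (d10 h) (d12 h) \<cdot> pr \<delta>\<^sub>H ?T H"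
    by (simp only: mult_Reg)
  then have "R1.cv U (d11 h \<cdot> pr \<delta>\<^sub>H ?T H) = R1.cv (d10 h \<cdot> pr \<delta>\<^sub>H ?T H) (d12 h \<cdot> pr \<delta>\<^sub>H ?T H)"
    using N.cv_pr [OF pT pH Del el(2)] N.cv_pr [OF pT pH el(1,3)] by (simp only: DU)
  then have *: "R1.cv U h = R1.cv (R1.act ?T h) (h \<cdot> ?T)"
    using R1.d1_pr [of ?T H h] by (simp add: TH TT)
  have Uh: "R1.cv U h = h" using h Reg_1(2) [of h] by blast
  have Th: "R1.act ?T h = h" using R1.target_act [OF pH, of h] Uh by simp
  obtain k where k: "R1.el k" "R1.cv h k = U" using h Reg_1(2) [of h] by blast
  show ?thesis
  proof (rule R1.cv_cancel [of _ _ h k U])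
    have "R1.cv (U \<cdot> ?T) (h \<cdot> ?T) = R1.cv U h \<cdot> ?T"
      by (rule R1.cv_comp [OF N.stage_D pT, symmetric]) simp_all
    then show "R1.cv U (h \<cdot> ?T) = h \<cdot> ?T" by (simp only: Uh U_target)
    show "R1.cv h (h \<cdot> ?T) = R1.cv h U"
      using * Uh Th R1.cv_comm [of h U] by simp
  qed (use k in \<open>simp_all add: u_idem\<close>)
qed

text \<open>By \<open>mult_target\<close>, h(x Pi^L y) is h(x) times the scalar eps(x y), and U(x y)
  absorbs that scalar. This links \<open>d12\<close>, defined with \<open>\<Pi>L\<close>, to the
  factor h(x) that arises in crossed products.\<close>

lemma d12_eq:
  assumes h: "h \<in> carrier (Reg 1)"
  shows "R2.cv (h \<cdot> x2) (u 2) = d12 h"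
proof -
  note [simp] = Reg_el(2) [OF h, unfolded Hom_iff]
  define s where "s = \<epsilon>\<^sub>H \<cdot> R2.mul x2 y2"
  have [simp]: "s \<in> Arr C" "Dom C s = H \<^bold>\<otimes> H" "Cod C s = K" by (simp_all add: s_def)
  have "d12 h = h \<cdot> R2.mul x2 (W.target \<cdot> y2)" by (rule d1_eval) simp
  also have "R2.mul x2 (W.target \<cdot> y2) = pr (\<delta>pow 2) x2 s"
    unfolding s_def by (rule R2.WS.mult_target [OF pts(1,2)])
  also have "\<dots> = pr (\<delta>pow 2) s x2" by (rule X3.D.scalar_pr_right) simp_all
  also have "h \<cdot> \<dots> = pr (\<delta>pow 2) s (h \<cdot> x2)" by (rule X3.D.scalar_comp) simp_all
  finally have d12: "d12 h = pr (\<delta>pow 2) s (h \<cdot> x2)" .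
  have "d12 h = R2.cv (u 2) (d12 h)"
    using hom_d1(3) [THEN hom_in_carrier, OF h] Reg_2(2) [of "d12 h"] by simp
  also have "\<dots> = \<mu>\<^sub>A \<cdot> pr (\<delta>pow 2) (pr (\<delta>pow 2) s (u 2)) (h \<cdot> x2)"
    unfolding d12 using X3.D.scalar_pr_left_commute [of s "u 2" "h \<cdot> x2"] by simp
  also have "pr (\<delta>pow 2) s (u 2) = u 2"
    unfolding s_def u2_eval by (intro R2.U_counit R2.WS.point_mult pts)
  also have "\<mu>\<^sub>A \<cdot> pr (\<delta>pow 2) (u 2) (h \<cdot> x2) = R2.cv (h \<cdot> x2) (u 2)"
    by (rule R2.cv_comm) simp_all
  finally show ?thesis ..
qed

end

section \<open>Crossed products\<close>

context stage
begin

text \<open>Pairs in which one component depends on a variable from an arbitrary object \<open>X\<close>.  Since \<open>X\<close>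
  carries no coproduct, only the variable from \<open>D\<close> may be shared.\<close>

definition lpair :: "'m \<Rightarrow> 'm \<Rightarrow> 'm \<Rightarrow> 'm" where
  "lpair X g F = (g \<^bold>\<otimes> F) \<cdot> (\<delta> \<^bold>\<otimes> X)"

definition rpair :: "'m \<Rightarrow> 'm \<Rightarrow> 'm \<Rightarrow> 'm" where
  "rpair X F g = c (Cod C g) (Cod C F) \<cdot> lpair X g F"

context
  fixes X assumes X [simp]: "X \<in> Obj C"
begin

lemma lpair_typing [simp]:
  assumes "g \<in> Arr C" "Dom C g = D" "F \<in> Arr C" "Dom C F = D \<^bold>\<otimes> X"
  shows "lpair X g F \<in> Arr C" "Dom C (lpair X g F) = D \<^bold>\<otimes> X" "Cod C (lpair X g F) = Cod C g \<^bold>\<otimes> Cod C F"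
    "rpair X F g \<in> Arr C" "Dom C (rpair X F g) = D \<^bold>\<otimes> X" "Cod C (rpair X F g) = Cod C F \<^bold>\<otimes> Cod C g"
  using assms by (simp_all add: lpair_def rpair_def)

lemma tensor_lpair:
  assumes "g \<in> Arr C" "Dom C g = D" "F \<in> Arr C" "Dom C F = D \<^bold>\<otimes> X"
    "p \<in> Arr C" "q \<in> Arr C" "Dom C p = Cod C g" "Dom C q = Cod C F"
  shows "(p \<^bold>\<otimes> q) \<cdot> lpair X g F = lpair X (p \<cdot> g) (q \<cdot> F)"
  using assms by (simp add: lpair_def interchange_comp)

lemma lpair_lpair:
  assumes "g \<in> Arr C" "Dom C g = D" "h \<in> Arr C" "Dom C h = D" "F \<in> Arr C" "Dom C F = D \<^bold>\<otimes> X"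
  shows "lpair X g (lpair X h F) = lpair X (pr \<delta> g h) F"
proof -
  have 1: "g \<^bold>\<otimes> ((h \<^bold>\<otimes> F) \<cdot> (\<delta> \<^bold>\<otimes> X)) = (g \<^bold>\<otimes> h \<^bold>\<otimes> F) \<cdot> (D \<^bold>\<otimes> \<delta> \<^bold>\<otimes> X)"
    using assms by (simp add: interchange')
  have 2: "pr \<delta> g h \<^bold>\<otimes> F = (g \<^bold>\<otimes> h \<^bold>\<otimes> F) \<cdot> (\<delta> \<^bold>\<otimes> D \<^bold>\<otimes> X)"
    using assms interchange' [of \<delta> "g \<^bold>\<otimes> h" "D \<^bold>\<otimes> X" F] by (simp add: pr_def)
  have 3: "(D \<^bold>\<otimes> \<delta> \<^bold>\<otimes> X) \<cdot> (\<delta> \<^bold>\<otimes> X) = ((D \<^bold>\<otimes> \<delta>) \<cdot> \<delta>) \<^bold>\<otimes> X"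
    using interchange' [of \<delta> "D \<^bold>\<otimes> \<delta>" X X] by simp
  have 4: "(\<delta> \<^bold>\<otimes> D \<^bold>\<otimes> X) \<cdot> (\<delta> \<^bold>\<otimes> X) = ((\<delta> \<^bold>\<otimes> D) \<cdot> \<delta>) \<^bold>\<otimes> X"
    using interchange' [of \<delta> "\<delta> \<^bold>\<otimes> D" X X] by simp
  have "lpair X g (lpair X h F) = (g \<^bold>\<otimes> h \<^bold>\<otimes> F) \<cdot> ((D \<^bold>\<otimes> \<delta> \<^bold>\<otimes> X) \<cdot> (\<delta> \<^bold>\<otimes> X))"
    unfolding lpair_def 1 using assms by simp
  also have "\<dots> = (g \<^bold>\<otimes> h \<^bold>\<otimes> F) \<cdot> ((\<delta> \<^bold>\<otimes> D \<^bold>\<otimes> X) \<cdot> (\<delta> \<^bold>\<otimes> X))"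
    unfolding 3 4 coassoc ..
  also have "\<dots> = lpair X (pr \<delta> g h) F"
    unfolding lpair_def 2 using assms by simp
  finally show ?thesis .
qed

lemma tensor_rpair:
  assumes "g \<in> Arr C" "Dom C g = D" "F \<in> Arr C" "Dom C F = D \<^bold>\<otimes> X"
    "p \<in> Arr C" "q \<in> Arr C" "Dom C p = Cod C g" "Dom C q = Cod C F"
  shows "(q \<^bold>\<otimes> p) \<cdot> rpair X F g = rpair X (q \<cdot> F) (p \<cdot> g)"
proof -
  have "(q \<^bold>\<otimes> p) \<cdot> rpair X F g = ((q \<^bold>\<otimes> p) \<cdot> c (Dom C p) (Dom C q)) \<cdot> lpair X g F"
    using assms by (simp add: rpair_def)
  also have "(q \<^bold>\<otimes> p) \<cdot> c (Dom C p) (Dom C q) = c (Cod C p) (Cod C q) \<cdot> (p \<^bold>\<otimes> q)"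
    using assms by (intro Symm_natural' [symmetric]) simp_all
  finally show ?thesis
    using assms tensor_lpair [of g F p q] by (simp add: rpair_def)
qed

text \<open>The hexagon reduces the claim to the order of \<open>g\<close> and \<open>h\<close>,
  which cocommutativity makes irrelevant.\<close>

lemma lpair_rpair:
  assumes "g \<in> Arr C" "Dom C g = D" "h \<in> Arr C" "Dom C h = D" "F \<in> Arr C" "Dom C F = D \<^bold>\<otimes> X"
  shows "lpair X h (rpair X F g) = rpair X (lpair X h F) g"
proof -
  let ?Z = "Cod C g" and ?W = "Cod C h" and ?Y = "Cod C F"
  have "rpair X (lpair X h F) g = c ?Z (?W \<^bold>\<otimes> ?Y) \<cdot> lpair X (pr \<delta> g h) F"
    using assms by (simp add: rpair_def lpair_lpair)
  also have "\<dots> = (?W \<^bold>\<otimes> c ?Z ?Y) \<cdot> ((c ?Z ?W \<^bold>\<otimes> ?Y) \<cdot> lpair X (pr \<delta> g h) F)"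
    using assms by (simp add: Symm_hexagon)
  also have "(c ?Z ?W \<^bold>\<otimes> ?Y) \<cdot> lpair X (pr \<delta> g h) F = lpair X h (lpair X g F)"
    using assms by (subst tensor_lpair) (simp_all add: lpair_lpair)
  also have "(?W \<^bold>\<otimes> c ?Z ?Y) \<cdot> lpair X h (lpair X g F) = lpair X h (rpair X F g)"
    using assms by (subst tensor_lpair) (simp_all add: rpair_def)
  finally show ?thesis ..
qed

lemma rpair_rpair:
  assumes "g \<in> Arr C" "Dom C g = D" "h \<in> Arr C" "Dom C h = D" "F \<in> Arr C" "Dom C F = D \<^bold>\<otimes> X"
  shows "rpair X (rpair X F g) h = rpair X F (pr \<delta> g h)"
proof -
  let ?Z = "Cod C g" and ?W = "Cod C h" and ?Y = "Cod C F"
  have "lpair X h (rpair X F g) = (?W \<^bold>\<otimes> c ?Z ?Y) \<cdot> lpair X h (lpair X g F)"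
    using assms by (subst tensor_lpair) (simp_all add: rpair_def)
  then have "rpair X (rpair X F g) h = c ?W (?Y \<^bold>\<otimes> ?Z) \<cdot> ((?W \<^bold>\<otimes> c ?Z ?Y) \<cdot> lpair X (pr \<delta> h g) F)"
    using assms by (simp add: rpair_def [of X "rpair X F g"] lpair_lpair)
  also have "\<dots> = (c ?W (?Y \<^bold>\<otimes> ?Z) \<cdot> (?W \<^bold>\<otimes> c ?Z ?Y)) \<cdot> lpair X (pr \<delta> h g) F"
    using assms by simp
  also have "c ?W (?Y \<^bold>\<otimes> ?Z) \<cdot> (?W \<^bold>\<otimes> c ?Z ?Y) = (c ?Z ?Y \<^bold>\<otimes> ?W) \<cdot> c ?W (?Z \<^bold>\<otimes> ?Y)"
    using Symm_natural' [of ?W "c ?Z ?Y" ?W "?Y \<^bold>\<otimes> ?Z"] assms by simp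
  also have "\<dots> = c (?Z \<^bold>\<otimes> ?W) ?Y \<cdot> (c ?W ?Z \<^bold>\<otimes> ?Y)"
    using assms by (simp add: Symm_hexagon Symm_hexagon')
  also have "(c (?Z \<^bold>\<otimes> ?W) ?Y \<cdot> (c ?W ?Z \<^bold>\<otimes> ?Y)) \<cdot> lpair X (pr \<delta> h g) F
      = c (?Z \<^bold>\<otimes> ?W) ?Y \<cdot> ((c ?W ?Z \<^bold>\<otimes> ?Y) \<cdot> lpair X (pr \<delta> h g) F)"
    using assms by simp
  also have "(c ?W ?Z \<^bold>\<otimes> ?Y) \<cdot> lpair X (pr \<delta> h g) F = lpair X (pr \<delta> g h) F"
    using assms by (subst tensor_lpair) simp_all
  finally show ?thesis using assms by (simp add: rpair_def)
qed

lemma pr_tensor_id: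
  assumes "g \<in> Arr C" "Dom C g = D" "h \<in> Arr C" "Dom C h = D"
  shows "pr \<delta> g h \<^bold>\<otimes> X = lpair X g (h \<^bold>\<otimes> X)"
  using assms interchange' [of \<delta> "g \<^bold>\<otimes> h" X X] by (simp add: lpair_def pr_def)

end

end

section \<open>Twists and the product of a crossed product\<close>

context sweedler_powers
begin

lemma psi_typing [simp]: "\<psi> \<in> Arr C" "Dom C \<psi> = H \<^bold>\<otimes> A" "Cod C \<psi> = A \<^bold>\<otimes> H"
  by (simp_all add: \<psi>_def)

text \<open>The two forms differ by a crossing of the legs of the coproduct, absorbed by
  cocommutativity.\<close>

lemma psi_eq: "\<psi> = W.rpair A \<phi>\<^sub>A H"
proof -
  have "W.rpair A \<phi>\<^sub>A H = (c H A \<cdot> (H \<^bold>\<otimes> \<phi>\<^sub>A)) \<cdot> (\<delta>\<^sub>H \<^bold>\<otimes> A)"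
    by (simp add: W.rpair_def W.lpair_def)
  also have "c H A \<cdot> (H \<^bold>\<otimes> \<phi>\<^sub>A) = (\<phi>\<^sub>A \<^bold>\<otimes> H) \<cdot> (H \<^bold>\<otimes> c H A) \<cdot> (c H H \<^bold>\<otimes> A)"
    by (simp add: Symm_natural' Symm_hexagon)
  also have "((\<phi>\<^sub>A \<^bold>\<otimes> H) \<cdot> (H \<^bold>\<otimes> c H A) \<cdot> (c H H \<^bold>\<otimes> A)) \<cdot> (\<delta>\<^sub>H \<^bold>\<otimes> A) = (\<phi>\<^sub>A \<^bold>\<otimes> H) \<cdot> (H \<^bold>\<otimes> c H A) \<cdot> ((c H H \<^bold>\<otimes> A) \<cdot> (\<delta>\<^sub>H \<^bold>\<otimes> A))"
    by simp
  also have "(c H H \<^bold>\<otimes> A) \<cdot> (\<delta>\<^sub>H \<^bold>\<otimes> A) = \<delta>\<^sub>H \<^bold>\<otimes> A"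
    by (simp add: interchange' cocommutative)
  finally show ?thesis by (simp add: \<psi>_def)
qed

text \<open>The left \<open>A\<close>-linear extension of \<open>k : X \<rightarrow> A \<otimes> H\<close>.\<close>

definition Lin :: "'m \<Rightarrow> 'm" where "Lin k = (\<mu>\<^sub>A \<^bold>\<otimes> H) \<cdot> (A \<^bold>\<otimes> k)"

lemma Lin_typing [simp]:
  assumes "k \<in> Arr C" "Cod C k = A \<^bold>\<otimes> H"
  shows "Lin k \<in> Arr C" "Dom C (Lin k) = A \<^bold>\<otimes> Dom C k" "Cod C (Lin k) = A \<^bold>\<otimes> H"
  using assms by (simp_all add: Lin_def)

lemma Lin_mult:
  assumes "k \<in> Arr C" "Cod C k = A \<^bold>\<otimes> H" "Dom C k = X"
  shows "Lin k \<cdot> (\<mu>\<^sub>A \<^bold>\<otimes> X) = (\<mu>\<^sub>A \<^bold>\<otimes> H) \<cdot> (A \<^bold>\<otimes> Lin k)"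
proof -
  have X [simp]: "X \<in> Obj C" using assms by auto
  have 1: "(A \<^bold>\<otimes> k) \<cdot> (\<mu>\<^sub>A \<^bold>\<otimes> X) = (\<mu>\<^sub>A \<^bold>\<otimes> A \<^bold>\<otimes> H) \<cdot> (A \<^bold>\<otimes> A \<^bold>\<otimes> k)"
    using assms interchange' [of \<mu>\<^sub>A A X k] interchange' [of "A \<^bold>\<otimes> A" \<mu>\<^sub>A k "A \<^bold>\<otimes> H"] by simp
  have 2: "(\<mu>\<^sub>A \<^bold>\<otimes> H) \<cdot> (\<mu>\<^sub>A \<^bold>\<otimes> A \<^bold>\<otimes> H) = (\<mu>\<^sub>A \<^bold>\<otimes> H) \<cdot> (A \<^bold>\<otimes> \<mu>\<^sub>A \<^bold>\<otimes> H)"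
    using interchange' [of "\<mu>\<^sub>A \<^bold>\<otimes> A" \<mu>\<^sub>A H H] interchange' [of "A \<^bold>\<otimes> \<mu>\<^sub>A" \<mu>\<^sub>A H H] A_laws(3) by simp
  have 3: "A \<^bold>\<otimes> Lin k = (A \<^bold>\<otimes> \<mu>\<^sub>A \<^bold>\<otimes> H) \<cdot> (A \<^bold>\<otimes> A \<^bold>\<otimes> k)"
    using assms by (simp add: Lin_def interchange')
  have "Lin k \<cdot> (\<mu>\<^sub>A \<^bold>\<otimes> X) = (\<mu>\<^sub>A \<^bold>\<otimes> H) \<cdot> ((A \<^bold>\<otimes> k) \<cdot> (\<mu>\<^sub>A \<^bold>\<otimes> X))"
    using assms by (simp add: Lin_def)
  also have "\<dots> = ((\<mu>\<^sub>A \<^bold>\<otimes> H) \<cdot> (\<mu>\<^sub>A \<^bold>\<otimes> A \<^bold>\<otimes> H)) \<cdot> (A \<^bold>\<otimes> A \<^bold>\<otimes> k)"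
    unfolding 1 using assms by simp
  also have "\<dots> = (\<mu>\<^sub>A \<^bold>\<otimes> H) \<cdot> (A \<^bold>\<otimes> Lin k)"
    unfolding 2 3 using assms by simp
  finally show ?thesis .
qed

lemma Lin_comp:
  assumes "k \<in> Arr C" "Cod C k = A \<^bold>\<otimes> H" "l \<in> Arr C" "Dom C l = H" "Cod C l = A \<^bold>\<otimes> H"
  shows "Lin l \<cdot> Lin k = Lin (Lin l \<cdot> k)"
proof -
  have "Lin l \<cdot> Lin k = (Lin l \<cdot> (\<mu>\<^sub>A \<^bold>\<otimes> H)) \<cdot> (A \<^bold>\<otimes> k)"
    using assms by (simp add: Lin_def [of k])
  also have "\<dots> = (\<mu>\<^sub>A \<^bold>\<otimes> H) \<cdot> ((A \<^bold>\<otimes> Lin l) \<cdot> (A \<^bold>\<otimes> k))"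
    using assms by (simp add: Lin_mult)
  also have "(A \<^bold>\<otimes> Lin l) \<cdot> (A \<^bold>\<otimes> k) = A \<^bold>\<otimes> (Lin l \<cdot> k)"
    using assms by (simp add: interchange')
  finally show ?thesis by (simp add: Lin_def)
qed

lemma Lin_pre:
  assumes "k \<in> Arr C" "Cod C k = A \<^bold>\<otimes> H" "g \<in> Arr C" "Cod C g = Dom C k"
  shows "Lin k \<cdot> (A \<^bold>\<otimes> g) = Lin (k \<cdot> g)"
  using assms by (simp add: Lin_def interchange')

lemma Lin_unit:
  assumes "k \<in> Arr C" "Cod C k = A \<^bold>\<otimes> H" "Dom C k = X"
  shows "Lin k \<cdot> (\<eta>\<^sub>A \<^bold>\<otimes> X) = k"
proof -
  have [simp]: "X \<in> Obj C" using assms by auto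
  have "(A \<^bold>\<otimes> k) \<cdot> (\<eta>\<^sub>A \<^bold>\<otimes> X) = (\<eta>\<^sub>A \<^bold>\<otimes> A \<^bold>\<otimes> H) \<cdot> k"
    using assms interchange' [of \<eta>\<^sub>A A X k] interchange' [of K \<eta>\<^sub>A k "A \<^bold>\<otimes> H"] by simp
  then have "Lin k \<cdot> (\<eta>\<^sub>A \<^bold>\<otimes> X) = ((\<mu>\<^sub>A \<^bold>\<otimes> H) \<cdot> (\<eta>\<^sub>A \<^bold>\<otimes> A \<^bold>\<otimes> H)) \<cdot> k"
    using assms by (simp add: Lin_def)
  also have "(\<mu>\<^sub>A \<^bold>\<otimes> H) \<cdot> (\<eta>\<^sub>A \<^bold>\<otimes> A \<^bold>\<otimes> H) = A \<^bold>\<otimes> H"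
    using interchange' [of "\<eta>\<^sub>A \<^bold>\<otimes> A" \<mu>\<^sub>A H H] A_laws(1) by simp
  finally show ?thesis using assms by simp
qed

text \<open>\<open>Tw f\<close> is \<open>a \<otimes> x \<mapsto> a f(x\<^sub>1) \<otimes> x\<^sub>2\<close>; up to the splitting of \<open>nabla\<close>, these are all the \<open>A\<close>-linear and
  \<open>H\<close>-colinear morphisms.\<close>

definition Tw :: "'m \<Rightarrow> 'm" where "Tw f = Lin (pr \<delta>\<^sub>H f H)"

lemma Tw_typing [simp]:
  assumes "R1.el f"
  shows "Tw f \<in> Arr C" "Dom C (Tw f) = A \<^bold>\<otimes> H" "Cod C (Tw f) = A \<^bold>\<otimes> H"
  using assms by (simp_all add: Tw_def)

lemma Tw_comp:
  assumes "R1.el f" "R1.el g"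
  shows "Tw g \<cdot> Tw f = Tw (R1.cv f g)"
proof -
  have "Lin (pr \<delta>\<^sub>H g H) \<cdot> pr \<delta>\<^sub>H f H = pr \<delta>\<^sub>H (R1.cv f g) H"
    using assms by (simp add: Lin_def)
  then show ?thesis using assms by (simp add: Tw_def Lin_comp)
qed

text \<open>At the unit of \<open>A\<close>, \<open>\<psi>\<close> sends x to x_1 1 \<otimes> x_2,
  and x 1 is U x.\<close>

lemma nabla_eq: "nabla = Tw U"
proof -
  have 1: "H \<^bold>\<otimes> \<eta>\<^sub>A = pr \<delta>\<^sub>H H (\<eta>\<^sub>A \<cdot> \<epsilon>\<^sub>H)"
    using W.tensor_pr [of H \<epsilon>\<^sub>H H \<eta>\<^sub>A] by (simp del: W.tensor_pr)
  have H: "\<delta>\<^sub>H \<cdot> H = pr \<delta>\<^sub>H H H" by simp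
  have "\<psi> \<cdot> (H \<^bold>\<otimes> \<eta>\<^sub>A) = pr \<delta>\<^sub>H (R1.act H (\<eta>\<^sub>A \<cdot> \<epsilon>\<^sub>H)) H"
  proof -
    have "(\<delta>\<^sub>H \<^bold>\<otimes> A) \<cdot> pr \<delta>\<^sub>H H (\<eta>\<^sub>A \<cdot> \<epsilon>\<^sub>H) = pr \<delta>\<^sub>H H (pr \<delta>\<^sub>H H (\<eta>\<^sub>A \<cdot> \<epsilon>\<^sub>H))"
      using W.tensor_pr [of H "\<eta>\<^sub>A \<cdot> \<epsilon>\<^sub>H" \<delta>\<^sub>H A] unfolding H by (simp del: W.tensor_pr X2.pr_id)
    then show ?thesis unfolding 1 \<psi>_def by (simp del: X2.pr_id)
  qed
  then have "\<psi> \<cdot> (H \<^bold>\<otimes> \<eta>\<^sub>A) = pr \<delta>\<^sub>H U H" using R1.U_eval [of H] by simp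
  then show ?thesis by (simp add: nabla_def Tw_def Lin_def interchange')
qed

text \<open>In elements, h(x_1) (x_2 a) \<otimes> x_3 = (x_1 a) h(x_2) \<otimes> x_3:
  \<open>A\<close> is commutative, and cocommutativity permits the relabelling of the legs.\<close>

lemma Tw_psi:
  assumes "R1.el h"
  shows "(\<mu>\<^sub>A \<^bold>\<otimes> H) \<cdot> (A \<^bold>\<otimes> \<psi>) \<cdot> (pr \<delta>\<^sub>H h H \<^bold>\<otimes> A) = Tw h \<cdot> \<psi>"
proof -
  note [simp] = assms [unfolded Hom_iff]
  have comm: "\<mu>\<^sub>A \<cdot> W.lpair A h \<phi>\<^sub>A = \<mu>\<^sub>A \<cdot> W.rpair A \<phi>\<^sub>A h"
  proof -
    have "\<mu>\<^sub>A \<cdot> W.rpair A \<phi>\<^sub>A h = (\<mu>\<^sub>A \<cdot> c A A) \<cdot> W.lpair A h \<phi>\<^sub>A" by (simp add: W.rpair_def)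
    then show ?thesis unfolding commutative ..
  qed
  have "(\<mu>\<^sub>A \<^bold>\<otimes> H) \<cdot> (A \<^bold>\<otimes> \<psi>) \<cdot> (pr \<delta>\<^sub>H h H \<^bold>\<otimes> A) = (\<mu>\<^sub>A \<^bold>\<otimes> H) \<cdot> W.lpair A h (W.rpair A \<phi>\<^sub>A H)"
    by (simp add: W.pr_tensor_id W.tensor_lpair psi_eq [symmetric])
  also have "\<dots> = W.rpair A (\<mu>\<^sub>A \<cdot> W.lpair A h \<phi>\<^sub>A) H"
    using W.tensor_rpair [of A H "W.lpair A h \<phi>\<^sub>A" H \<mu>\<^sub>A] by (simp add: W.lpair_rpair)
  also have "\<dots> = (\<mu>\<^sub>A \<^bold>\<otimes> H) \<cdot> W.rpair A (W.rpair A \<phi>\<^sub>A h) H"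
    unfolding comm using W.tensor_rpair [of A H "W.rpair A \<phi>\<^sub>A h" H \<mu>\<^sub>A] by simp
  also have "W.rpair A (W.rpair A \<phi>\<^sub>A h) H = (A \<^bold>\<otimes> pr \<delta>\<^sub>H h H) \<cdot> \<psi>"
    using W.tensor_rpair [of A H \<phi>\<^sub>A "pr \<delta>\<^sub>H h H" A] by (simp add: W.rpair_rpair psi_eq)
  finally show ?thesis by (simp add: Tw_def Lin_def)
qed

text \<open>This is x (a b) = (x_1 a)(x_2 b) with a further leg of x kept. As \<open>A\<close> has
  no coproduct, the argument runs with \<open>lpair\<close> and \<open>rpair\<close> over
  \<open>X = A \<otimes> A\<close> and not with elements.\<close>

lemma psi_mult: "\<psi> \<cdot> (H \<^bold>\<otimes> \<mu>\<^sub>A) = (\<mu>\<^sub>A \<^bold>\<otimes> H) \<cdot> (A \<^bold>\<otimes> \<psi>) \<cdot> (\<psi> \<^bold>\<otimes> A)"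
proof -
  \<comment> \<open>\<open>\<Omega>\<close> sends (x, a, b) to (x_1 a, x_2 b).\<close>
  define \<Omega> where "\<Omega> = (A \<^bold>\<otimes> \<phi>\<^sub>A) \<cdot> (\<psi> \<^bold>\<otimes> A)"
  have [simp]: "\<Omega> \<in> Arr C" "Dom C \<Omega> = H \<^bold>\<otimes> A \<^bold>\<otimes> A" "Cod C \<Omega> = A \<^bold>\<otimes> A" by (simp_all add: \<Omega>_def)
  have b2': "\<phi>\<^sub>A \<cdot> (H \<^bold>\<otimes> \<mu>\<^sub>A) = \<mu>\<^sub>A \<cdot> \<Omega>"
  proof -
    have "(\<psi> \<^bold>\<otimes> A) = (\<phi>\<^sub>A \<^bold>\<otimes> H \<^bold>\<otimes> A) \<cdot> (H \<^bold>\<otimes> c H A \<^bold>\<otimes> A) \<cdot> (\<delta>\<^sub>H \<^bold>\<otimes> A \<^bold>\<otimes> A)"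
      using interchange' [of "\<delta>\<^sub>H \<^bold>\<otimes> A" "H \<^bold>\<otimes> c H A" A A] interchange' [of "(H \<^bold>\<otimes> c H A) \<cdot> (\<delta>\<^sub>H \<^bold>\<otimes> A)" "\<phi>\<^sub>A \<^bold>\<otimes> H" A A]
      by (simp add: \<psi>_def)
    then have "\<Omega> = ((A \<^bold>\<otimes> \<phi>\<^sub>A) \<cdot> (\<phi>\<^sub>A \<^bold>\<otimes> H \<^bold>\<otimes> A)) \<cdot> (H \<^bold>\<otimes> c H A \<^bold>\<otimes> A) \<cdot> (\<delta>\<^sub>H \<^bold>\<otimes> A \<^bold>\<otimes> A)"
      by (simp add: \<Omega>_def)
    also have "(A \<^bold>\<otimes> \<phi>\<^sub>A) \<cdot> (\<phi>\<^sub>A \<^bold>\<otimes> H \<^bold>\<otimes> A) = \<phi>\<^sub>A \<^bold>\<otimes> \<phi>\<^sub>A"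
      using interchange' [of \<phi>\<^sub>A A "H \<^bold>\<otimes> A" \<phi>\<^sub>A] by simp
    finally show ?thesis by (simp add: b2)
  qed
  \<comment> \<open>A coproduct taken after \<open>\<psi>\<close> affects only the leg that does not
    act, so it can be taken before; cocommutativity then lets the extra copy start at the far
    left.\<close>
  have co: "(A \<^bold>\<otimes> \<delta>\<^sub>H) \<cdot> \<psi> = (c H A \<^bold>\<otimes> H) \<cdot> W.lpair A H \<psi>"
  proof -
    have "(A \<^bold>\<otimes> \<delta>\<^sub>H) \<cdot> \<psi> = W.rpair A \<phi>\<^sub>A \<delta>\<^sub>H"
      using W.tensor_rpair [of A H \<phi>\<^sub>A \<delta>\<^sub>H A] by (simp add: psi_eq)
    also have "\<dots> = W.rpair A \<psi> H"
      using W.rpair_rpair [of A H H \<phi>\<^sub>A] by (simp add: psi_eq)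
    finally have 1: "(A \<^bold>\<otimes> \<delta>\<^sub>H) \<cdot> \<psi> = W.rpair A \<psi> H" .
    have "(A \<^bold>\<otimes> \<delta>\<^sub>H) \<cdot> \<psi> = (A \<^bold>\<otimes> c H H) \<cdot> ((A \<^bold>\<otimes> \<delta>\<^sub>H) \<cdot> \<psi>)"
      using interchange_comp [of A A \<delta>\<^sub>H "c H H" \<psi>] cocommutative by simp
    also have "\<dots> = (A \<^bold>\<otimes> c H H) \<cdot> W.rpair A \<psi> H"
      unfolding 1 ..
    also have "(A \<^bold>\<otimes> c H H) \<cdot> W.rpair A \<psi> H = ((A \<^bold>\<otimes> c H H) \<cdot> (A \<^bold>\<otimes> c H H)) \<cdot> (c H A \<^bold>\<otimes> H) \<cdot> W.lpair A H \<psi>"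
      by (simp add: W.rpair_def Symm_hexagon)
    also have "(A \<^bold>\<otimes> c H H) \<cdot> (A \<^bold>\<otimes> c H H) = A \<^bold>\<otimes> H \<^bold>\<otimes> H"
      by (simp add: interchange' Symm_Symm)
    finally show ?thesis by simp
  qed
  have lp: "W.lpair A H \<psi> \<^bold>\<otimes> A = (H \<^bold>\<otimes> \<psi> \<^bold>\<otimes> A) \<cdot> (\<delta>\<^sub>H \<^bold>\<otimes> A \<^bold>\<otimes> A)"
    using interchange' [of "\<delta>\<^sub>H \<^bold>\<otimes> A" "H \<^bold>\<otimes> \<psi>" A A] by (simp add: W.lpair_def)
  have "(A \<^bold>\<otimes> \<psi>) \<cdot> (\<psi> \<^bold>\<otimes> A) = (A \<^bold>\<otimes> c H A) \<cdot> (A \<^bold>\<otimes> H \<^bold>\<otimes> \<phi>\<^sub>A) \<cdot> ((A \<^bold>\<otimes> \<delta>\<^sub>H \<^bold>\<otimes> A) \<cdot> (\<psi> \<^bold>\<otimes> A))"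
  proof -
    have "A \<^bold>\<otimes> \<psi> = (A \<^bold>\<otimes> c H A) \<cdot> (A \<^bold>\<otimes> H \<^bold>\<otimes> \<phi>\<^sub>A) \<cdot> (A \<^bold>\<otimes> \<delta>\<^sub>H \<^bold>\<otimes> A)"
      unfolding psi_eq by (simp add: W.rpair_def W.lpair_def interchange')
    then show ?thesis by simp
  qed
  also have "(A \<^bold>\<otimes> \<delta>\<^sub>H \<^bold>\<otimes> A) \<cdot> (\<psi> \<^bold>\<otimes> A) = (c H A \<^bold>\<otimes> H \<^bold>\<otimes> A) \<cdot> (H \<^bold>\<otimes> \<psi> \<^bold>\<otimes> A) \<cdot> (\<delta>\<^sub>H \<^bold>\<otimes> A \<^bold>\<otimes> A)"
    using interchange' [of \<psi> "A \<^bold>\<otimes> \<delta>\<^sub>H" A A] interchange' [of "W.lpair A H \<psi>" "c H A \<^bold>\<otimes> H" A A] lp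
    by (simp add: co)
  also have "(A \<^bold>\<otimes> c H A) \<cdot> (A \<^bold>\<otimes> H \<^bold>\<otimes> \<phi>\<^sub>A) \<cdot> ((c H A \<^bold>\<otimes> H \<^bold>\<otimes> A) \<cdot> (H \<^bold>\<otimes> \<psi> \<^bold>\<otimes> A) \<cdot> (\<delta>\<^sub>H \<^bold>\<otimes> A \<^bold>\<otimes> A))
    = (A \<^bold>\<otimes> c H A) \<cdot> ((A \<^bold>\<otimes> H \<^bold>\<otimes> \<phi>\<^sub>A) \<cdot> (c H A \<^bold>\<otimes> H \<^bold>\<otimes> A)) \<cdot> (H \<^bold>\<otimes> \<psi> \<^bold>\<otimes> A) \<cdot> (\<delta>\<^sub>H \<^bold>\<otimes> A \<^bold>\<otimes> A)"
    by simp
  also have "(A \<^bold>\<otimes> H \<^bold>\<otimes> \<phi>\<^sub>A) \<cdot> (c H A \<^bold>\<otimes> H \<^bold>\<otimes> A) = (c H A \<^bold>\<otimes> A) \<cdot> (H \<^bold>\<otimes> A \<^bold>\<otimes> \<phi>\<^sub>A)"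
    using interchange' [of "c H A" "A \<^bold>\<otimes> H" "H \<^bold>\<otimes> A" \<phi>\<^sub>A] interchange' [of "H \<^bold>\<otimes> A" "c H A" \<phi>\<^sub>A A] by simp
  also have "(A \<^bold>\<otimes> c H A) \<cdot> ((c H A \<^bold>\<otimes> A) \<cdot> (H \<^bold>\<otimes> A \<^bold>\<otimes> \<phi>\<^sub>A)) \<cdot> (H \<^bold>\<otimes> \<psi> \<^bold>\<otimes> A) \<cdot> (\<delta>\<^sub>H \<^bold>\<otimes> A \<^bold>\<otimes> A)
    = ((A \<^bold>\<otimes> c H A) \<cdot> (c H A \<^bold>\<otimes> A)) \<cdot> ((H \<^bold>\<otimes> A \<^bold>\<otimes> \<phi>\<^sub>A) \<cdot> (H \<^bold>\<otimes> \<psi> \<^bold>\<otimes> A)) \<cdot> (\<delta>\<^sub>H \<^bold>\<otimes> A \<^bold>\<otimes> A)"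
    by simp
  also have "(H \<^bold>\<otimes> A \<^bold>\<otimes> \<phi>\<^sub>A) \<cdot> (H \<^bold>\<otimes> \<psi> \<^bold>\<otimes> A) = H \<^bold>\<otimes> \<Omega>"
    by (simp add: \<Omega>_def interchange')
  also have "(A \<^bold>\<otimes> c H A) \<cdot> (c H A \<^bold>\<otimes> A) = c H (A \<^bold>\<otimes> A)"
    by (simp add: Symm_hexagon)
  also have "c H (A \<^bold>\<otimes> A) \<cdot> (H \<^bold>\<otimes> \<Omega>) \<cdot> (\<delta>\<^sub>H \<^bold>\<otimes> A \<^bold>\<otimes> A) = W.rpair (A \<^bold>\<otimes> A) \<Omega> H"
    by (simp add: W.rpair_def W.lpair_def)
  finally have "(\<mu>\<^sub>A \<^bold>\<otimes> H) \<cdot> (A \<^bold>\<otimes> \<psi>) \<cdot> (\<psi> \<^bold>\<otimes> A) = W.rpair (A \<^bold>\<otimes> A) (\<mu>\<^sub>A \<cdot> \<Omega>) H"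
    using W.tensor_rpair [of "A \<^bold>\<otimes> A" H \<Omega> H \<mu>\<^sub>A] by simp
  also have "\<dots> = \<psi> \<cdot> (H \<^bold>\<otimes> \<mu>\<^sub>A)"
  proof -
    have "H \<^bold>\<otimes> (\<phi>\<^sub>A \<cdot> (H \<^bold>\<otimes> \<mu>\<^sub>A)) = (H \<^bold>\<otimes> \<phi>\<^sub>A) \<cdot> (H \<^bold>\<otimes> H \<^bold>\<otimes> \<mu>\<^sub>A)"
      by (simp add: interchange')
    moreover have "(H \<^bold>\<otimes> H \<^bold>\<otimes> \<mu>\<^sub>A) \<cdot> (\<delta>\<^sub>H \<^bold>\<otimes> A \<^bold>\<otimes> A) = (\<delta>\<^sub>H \<^bold>\<otimes> A) \<cdot> (H \<^bold>\<otimes> \<mu>\<^sub>A)"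
      using interchange' [of \<delta>\<^sub>H "H \<^bold>\<otimes> H" "A \<^bold>\<otimes> A" \<mu>\<^sub>A] interchange' [of H \<delta>\<^sub>H \<mu>\<^sub>A A] by simp
    ultimately show ?thesis
      unfolding b2' [symmetric] psi_eq by (simp add: W.rpair_def W.lpair_def)
  qed
  finally show ?thesis ..
qed

abbreviation cpm where "cpm f \<equiv> cp_mult (weak_crossed_product f)"

text \<open>The product of the crossed product is the \<open>A\<close>-linear extension of \<open>Tail\<close>.\<close>

definition Tail :: "'m \<Rightarrow> 'm" where "Tail f = Lin (sigma f) \<cdot> (\<psi> \<^bold>\<otimes> H)"

lemma sigma_eq: "sigma f = pr (\<delta>pow 2) f \<mu>\<^sub>H"
  by (simp add: sigma_def pr_def)

lemma sigma_typing [simp]: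
  assumes "R2.el f"
  shows "sigma f \<in> Arr C" "Dom C (sigma f) = H \<^bold>\<otimes> H" "Cod C (sigma f) = A \<^bold>\<otimes> H"
  using assms by (simp_all add: sigma_eq)

lemma Tail_typing [simp]:
  assumes "R2.el f"
  shows "Tail f \<in> Arr C" "Dom C (Tail f) = H \<^bold>\<otimes> A \<^bold>\<otimes> H" "Cod C (Tail f) = A \<^bold>\<otimes> H"
  using assms by (simp_all add: Tail_def)

lemma cpm_eq:
  assumes "R2.el f"
  shows "cpm f = Lin (Tail f)"
proof -
  note [simp] = sigma_typing [OF assms]
  have 1: "A \<^bold>\<otimes> Tail f = (A \<^bold>\<otimes> Lin (sigma f)) \<cdot> (A \<^bold>\<otimes> \<psi> \<^bold>\<otimes> H)"
    by (simp add: Tail_def interchange')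
  have 2: "\<mu>\<^sub>A \<^bold>\<otimes> sigma f = (A \<^bold>\<otimes> sigma f) \<cdot> (\<mu>\<^sub>A \<^bold>\<otimes> H \<^bold>\<otimes> H)"
    using interchange' [of \<mu>\<^sub>A A "H \<^bold>\<otimes> H" "sigma f"] by simp
  have "Lin (Tail f) = ((\<mu>\<^sub>A \<^bold>\<otimes> H) \<cdot> (A \<^bold>\<otimes> Lin (sigma f))) \<cdot> (A \<^bold>\<otimes> \<psi> \<^bold>\<otimes> H)"
    unfolding Lin_def [of "Tail f"] 1 by simp
  also have "\<dots> = (Lin (sigma f) \<cdot> (\<mu>\<^sub>A \<^bold>\<otimes> (H \<^bold>\<otimes> H))) \<cdot> (A \<^bold>\<otimes> \<psi> \<^bold>\<otimes> H)"
    by (subst Lin_mult) simp_all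
  also have "\<dots> = cpm f"
    unfolding weak_crossed_product_def by (simp add: 2 Lin_def)
  finally show ?thesis ..
qed

lemma cpm_typing [simp]:
  assumes "R2.el f"
  shows "cpm f \<in> Arr C" "Dom C (cpm f) = A \<^bold>\<otimes> H \<^bold>\<otimes> A \<^bold>\<otimes> H" "Cod C (cpm f) = A \<^bold>\<otimes> H"
  using Tail_typing [OF assms] by (simp_all add: cpm_eq [OF assms])

text \<open>A twist of the result is evaluated at the \<open>H\<close>-component of the product,
  that is at x y. This gives the factor \<open>d11 h\<close>.\<close>

lemma Tw_cpm:
  assumes "R1.el h" "R2.el f"
  shows "Tw h \<cdot> cpm f = cpm (R2.cv f (d11 h))"
proof -
  note [simp] = assms [unfolded Hom_iff] sigma_typing [OF assms(2)] Tail_typing [OF assms(2)]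
  have [simp]: "d11 h \<in> Arr C" "Dom C (d11 h) = H \<^bold>\<otimes> H" "Cod C (d11 h) = A" by simp_all
  have el: "R2.el (R2.cv f (d11 h))" by simp
  have pm: "W.point (\<delta>pow 2) \<mu>\<^sub>H"
    using R2.WS.point_mult [OF pts(1,2)] unfolding pr_coords by simp
  have "pr \<delta>\<^sub>H h H \<cdot> \<mu>\<^sub>H = pr (\<delta>pow 2) (d11 h) \<mu>\<^sub>H"
    using W.pr_comp [OF pm, of h H] by (simp add: d11_def)
  then have "Tw h \<cdot> sigma f = sigma (R2.cv f (d11 h))"
    unfolding Tw_def Lin_def sigma_eq by simp
  then have "Tw h \<cdot> Tail f = Tail (R2.cv f (d11 h))"
    using Lin_comp [of "sigma f" "pr \<delta>\<^sub>H h H"] comp_assoc' [of "\<psi> \<^bold>\<otimes> H" "Lin (sigma f)" "Tw h"]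
    by (simp add: Tail_def Tw_def)
  then show ?thesis
    using Lin_comp [of "Tail f" "pr \<delta>\<^sub>H h H"] by (simp add: cpm_eq [OF assms(2)] cpm_eq [OF el] Tw_def)
qed

lemma Lin_sigma_pr:
  assumes "R1.el h" "R2.el f"
  shows "Lin (sigma f) \<cdot> (pr \<delta>\<^sub>H h H \<^bold>\<otimes> H) = sigma (R2.cv (h \<cdot> x2) f)"
proof -
  note [simp] = assms [unfolded Hom_iff] sigma_typing [OF assms(2)]
  have "(pr \<delta>\<^sub>H h H \<^bold>\<otimes> H) \<cdot> pr (\<delta>pow 2) x2 y2 = pr (\<delta>pow 2) (h \<cdot> x2) (pr (\<delta>pow 2) x2 y2)"
    using W.pr_comp [OF pts(1), of h H] by simp
  then have "pr \<delta>\<^sub>H h H \<^bold>\<otimes> H = pr (\<delta>pow 2) (h \<cdot> x2) (H \<^bold>\<otimes> H)"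
    unfolding pr_coords by simp
  then have "Lin (sigma f) \<cdot> (pr \<delta>\<^sub>H h H \<^bold>\<otimes> H) = (\<mu>\<^sub>A \<^bold>\<otimes> H) \<cdot> pr (\<delta>pow 2) (h \<cdot> x2) (sigma f)"
    by (simp add: Lin_def)
  then show ?thesis by (simp add: sigma_eq)
qed

text \<open>The coefficient h(x_1) of the left factor has to pass \<open>\<psi>\<close>, by
  \<open>Tw_psi\<close>, before it meets the cochain; it arrives unchanged as h(x).\<close>

lemma cpm_Tw_left:
  assumes "R1.el h" "R2.el f"
  shows "cpm f \<cdot> (Tw h \<^bold>\<otimes> A \<^bold>\<otimes> H) = cpm (R2.cv (h \<cdot> x2) f)"
proof -
  note [simp] = assms [unfolded Hom_iff] sigma_typing [OF assms(2)] Tail_typing [OF assms(2)]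
  define k where "k = pr \<delta>\<^sub>H h H"
  have [simp]: "k \<in> Arr C" "Dom C k = H" "Cod C k = A \<^bold>\<otimes> H" by (simp_all add: k_def)
  have el: "R2.el (R2.cv (h \<cdot> x2) f)" by simp
  have T: "Tw h \<^bold>\<otimes> A \<^bold>\<otimes> H = (\<mu>\<^sub>A \<^bold>\<otimes> H \<^bold>\<otimes> A \<^bold>\<otimes> H) \<cdot> (A \<^bold>\<otimes> k \<^bold>\<otimes> A \<^bold>\<otimes> H)"
    using interchange' [of "A \<^bold>\<otimes> k" "\<mu>\<^sub>A \<^bold>\<otimes> H" "A \<^bold>\<otimes> H" "A \<^bold>\<otimes> H"] by (simp add: Tw_def Lin_def k_def)
  have T': "Lin (sigma f) \<cdot> (Tw h \<^bold>\<otimes> H) = Lin (sigma (R2.cv (h \<cdot> x2) f))"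
  proof -
    have "Tw h \<^bold>\<otimes> H = (\<mu>\<^sub>A \<^bold>\<otimes> H \<^bold>\<otimes> H) \<cdot> (A \<^bold>\<otimes> k \<^bold>\<otimes> H)"
      using interchange' [of "A \<^bold>\<otimes> k" "\<mu>\<^sub>A \<^bold>\<otimes> H" H H] by (simp add: Tw_def Lin_def k_def)
    then have "Lin (sigma f) \<cdot> (Tw h \<^bold>\<otimes> H) = (Lin (sigma f) \<cdot> (\<mu>\<^sub>A \<^bold>\<otimes> (H \<^bold>\<otimes> H))) \<cdot> (A \<^bold>\<otimes> k \<^bold>\<otimes> H)"
      by simp
    also have "\<dots> = (\<mu>\<^sub>A \<^bold>\<otimes> H) \<cdot> ((A \<^bold>\<otimes> Lin (sigma f)) \<cdot> (A \<^bold>\<otimes> k \<^bold>\<otimes> H))"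
      by (subst Lin_mult) simp_all
    also have "(A \<^bold>\<otimes> Lin (sigma f)) \<cdot> (A \<^bold>\<otimes> k \<^bold>\<otimes> H) = A \<^bold>\<otimes> sigma (R2.cv (h \<cdot> x2) f)"
      using Lin_sigma_pr [OF assms, folded k_def] by (simp add: interchange')
    finally show ?thesis by (simp add: Lin_def)
  qed
  have tail: "Lin (Tail f) \<cdot> (k \<^bold>\<otimes> A \<^bold>\<otimes> H) = Tail (R2.cv (h \<cdot> x2) f)"
  proof -
    have 1: "(A \<^bold>\<otimes> Tail f) = (A \<^bold>\<otimes> Lin (sigma f)) \<cdot> (A \<^bold>\<otimes> \<psi> \<^bold>\<otimes> H)"
      by (simp add: Tail_def interchange')
    have "Lin (Tail f) \<cdot> (k \<^bold>\<otimes> A \<^bold>\<otimes> H)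
       = ((\<mu>\<^sub>A \<^bold>\<otimes> H) \<cdot> (A \<^bold>\<otimes> Lin (sigma f))) \<cdot> ((A \<^bold>\<otimes> \<psi> \<^bold>\<otimes> H) \<cdot> (k \<^bold>\<otimes> A \<^bold>\<otimes> H))"
      unfolding Lin_def [of "Tail f"] 1 by simp
    also have "\<dots> = (Lin (sigma f) \<cdot> (\<mu>\<^sub>A \<^bold>\<otimes> (H \<^bold>\<otimes> H))) \<cdot> ((A \<^bold>\<otimes> \<psi> \<^bold>\<otimes> H) \<cdot> (k \<^bold>\<otimes> A \<^bold>\<otimes> H))"
      by (subst Lin_mult) simp_all
    also have "\<dots> = Lin (sigma f) \<cdot> ((\<mu>\<^sub>A \<^bold>\<otimes> H \<^bold>\<otimes> H) \<cdot> (A \<^bold>\<otimes> \<psi> \<^bold>\<otimes> H) \<cdot> (k \<^bold>\<otimes> A \<^bold>\<otimes> H))"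
      by simp
    also have "(\<mu>\<^sub>A \<^bold>\<otimes> H \<^bold>\<otimes> H) \<cdot> (A \<^bold>\<otimes> \<psi> \<^bold>\<otimes> H) \<cdot> (k \<^bold>\<otimes> A \<^bold>\<otimes> H)
        = ((\<mu>\<^sub>A \<^bold>\<otimes> H) \<cdot> (A \<^bold>\<otimes> \<psi>) \<cdot> (k \<^bold>\<otimes> A)) \<^bold>\<otimes> H"
      using interchange' [of "k \<^bold>\<otimes> A" "A \<^bold>\<otimes> \<psi>" H H] interchange' [of "(A \<^bold>\<otimes> \<psi>) \<cdot> (k \<^bold>\<otimes> A)" "\<mu>\<^sub>A \<^bold>\<otimes> H" H H]
      by simp
    also have "\<dots> = (Tw h \<^bold>\<otimes> H) \<cdot> (\<psi> \<^bold>\<otimes> H)"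
      using Tw_psi [OF assms(1)] by (simp add: k_def interchange')
    also have "Lin (sigma f) \<cdot> ((Tw h \<^bold>\<otimes> H) \<cdot> (\<psi> \<^bold>\<otimes> H)) = (Lin (sigma f) \<cdot> (Tw h \<^bold>\<otimes> H)) \<cdot> (\<psi> \<^bold>\<otimes> H)"
      by simp
    also have "\<dots> = Tail (R2.cv (h \<cdot> x2) f)"
      unfolding T' Tail_def ..
    finally show ?thesis .
  qed
  have "cpm f \<cdot> (Tw h \<^bold>\<otimes> A \<^bold>\<otimes> H) = (Lin (Tail f) \<cdot> (\<mu>\<^sub>A \<^bold>\<otimes> (H \<^bold>\<otimes> A \<^bold>\<otimes> H))) \<cdot> (A \<^bold>\<otimes> k \<^bold>\<otimes> A \<^bold>\<otimes> H)"
    unfolding T cpm_eq [OF assms(2)] by simp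
  also have "\<dots> = (\<mu>\<^sub>A \<^bold>\<otimes> H) \<cdot> ((A \<^bold>\<otimes> Lin (Tail f)) \<cdot> (A \<^bold>\<otimes> k \<^bold>\<otimes> A \<^bold>\<otimes> H))"
    by (subst Lin_mult) simp_all
  also have "(A \<^bold>\<otimes> Lin (Tail f)) \<cdot> (A \<^bold>\<otimes> k \<^bold>\<otimes> A \<^bold>\<otimes> H) = A \<^bold>\<otimes> Tail (R2.cv (h \<cdot> x2) f)"
    using tail by (simp add: interchange')
  finally show ?thesis unfolding cpm_eq [OF el] Lin_def .
qed

text \<open>The coefficient h(y_1) of the right factor stands behind x, which acts on it while
  passing. \<open>psi_mult\<close> separates this action from that on the coefficient in
  \<open>A\<close>, leaving x h(y).\<close>

lemma cpm_Tw_right: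
  assumes "R1.el h" "R2.el f"
  shows "cpm f \<cdot> (A \<^bold>\<otimes> H \<^bold>\<otimes> Tw h) = cpm (R2.cv (d10 h) f)"
proof -
  note [simp] = assms [unfolded Hom_iff] sigma_typing [OF assms(2)] Tail_typing [OF assms(2)]
  define k where "k = pr \<delta>\<^sub>H h H"
  have [simp]: "k \<in> Arr C" "Dom C k = H" "Cod C k = A \<^bold>\<otimes> H" by (simp_all add: k_def)
  have [simp]: "d10 h \<in> Arr C" "Dom C (d10 h) = H \<^bold>\<otimes> H" "Cod C (d10 h) = A" by simp_all
  have el: "R2.el (R2.cv (d10 h) f)" by simp
  have sig: "Lin (sigma f) \<cdot> ((\<psi> \<^bold>\<otimes> H) \<cdot> (H \<^bold>\<otimes> k)) = sigma (R2.cv (d10 h) f)"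
  proof -
    have 1: "(H \<^bold>\<otimes> k) \<cdot> pr (\<delta>pow 2) x2 y2 = pr (\<delta>pow 2) x2 (pr (\<delta>pow 2) (h \<cdot> y2) y2)"
      using W.pr_comp [OF pts(2), of h H] by (simp add: k_def)
    have "(\<psi> \<^bold>\<otimes> H) \<cdot> ((H \<^bold>\<otimes> k) \<cdot> pr (\<delta>pow 2) x2 y2) = pr (\<delta>pow 2) (d10 h) (pr (\<delta>pow 2) x2 y2)"
      unfolding 1 using d1_eval(1) [OF assms(1)] by (simp add: \<psi>_def)
    then have "(\<psi> \<^bold>\<otimes> H) \<cdot> (H \<^bold>\<otimes> k) = pr (\<delta>pow 2) (d10 h) (H \<^bold>\<otimes> H)"
      unfolding pr_coords by simp
    then have "Lin (sigma f) \<cdot> ((\<psi> \<^bold>\<otimes> H) \<cdot> (H \<^bold>\<otimes> k)) = (\<mu>\<^sub>A \<^bold>\<otimes> H) \<cdot> pr (\<delta>pow 2) (d10 h) (sigma f)"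
      by (simp add: Lin_def)
    then show ?thesis by (simp add: sigma_eq)
  qed
  have 1: "(\<psi> \<^bold>\<otimes> H) \<cdot> (H \<^bold>\<otimes> \<mu>\<^sub>A \<^bold>\<otimes> H) = (\<mu>\<^sub>A \<^bold>\<otimes> H \<^bold>\<otimes> H) \<cdot> (A \<^bold>\<otimes> \<psi> \<^bold>\<otimes> H) \<cdot> (\<psi> \<^bold>\<otimes> A \<^bold>\<otimes> H)"
  proof -
    have "(\<psi> \<^bold>\<otimes> H) \<cdot> ((H \<^bold>\<otimes> \<mu>\<^sub>A) \<^bold>\<otimes> H) = (\<psi> \<cdot> (H \<^bold>\<otimes> \<mu>\<^sub>A)) \<^bold>\<otimes> H"
      by (subst interchange') simp_all
    also have "\<dots> = ((\<mu>\<^sub>A \<^bold>\<otimes> H) \<^bold>\<otimes> H) \<cdot> ((A \<^bold>\<otimes> \<psi>) \<^bold>\<otimes> H) \<cdot> ((\<psi> \<^bold>\<otimes> A) \<^bold>\<otimes> H)"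
      unfolding psi_mult using interchange' [of "\<psi> \<^bold>\<otimes> A" "A \<^bold>\<otimes> \<psi>" H H]
        interchange' [of "(A \<^bold>\<otimes> \<psi>) \<cdot> (\<psi> \<^bold>\<otimes> A)" "\<mu>\<^sub>A \<^bold>\<otimes> H" H H] by simp
    finally show ?thesis by simp
  qed
  have 2: "(\<psi> \<^bold>\<otimes> A \<^bold>\<otimes> H) \<cdot> (H \<^bold>\<otimes> A \<^bold>\<otimes> k) = (A \<^bold>\<otimes> H \<^bold>\<otimes> k) \<cdot> (\<psi> \<^bold>\<otimes> H)"
    using interchange' [of "H \<^bold>\<otimes> A" \<psi> k "A \<^bold>\<otimes> H"] interchange' [of \<psi> "A \<^bold>\<otimes> H" H k] by simp
  have "Tail f \<cdot> (H \<^bold>\<otimes> Tw h) = Lin (sigma f) \<cdot> (((\<psi> \<^bold>\<otimes> H) \<cdot> (H \<^bold>\<otimes> \<mu>\<^sub>A \<^bold>\<otimes> H)) \<cdot> (H \<^bold>\<otimes> A \<^bold>\<otimes> k))"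
  proof -
    have "H \<^bold>\<otimes> Tw h = (H \<^bold>\<otimes> \<mu>\<^sub>A \<^bold>\<otimes> H) \<cdot> (H \<^bold>\<otimes> A \<^bold>\<otimes> k)"
      by (simp add: Tw_def Lin_def k_def interchange')
    then show ?thesis by (simp add: Tail_def)
  qed
  also have "\<dots> = (Lin (sigma f) \<cdot> (\<mu>\<^sub>A \<^bold>\<otimes> (H \<^bold>\<otimes> H))) \<cdot> (A \<^bold>\<otimes> \<psi> \<^bold>\<otimes> H) \<cdot> ((\<psi> \<^bold>\<otimes> A \<^bold>\<otimes> H) \<cdot> (H \<^bold>\<otimes> A \<^bold>\<otimes> k))"
    unfolding 1 by simp
  also have "Lin (sigma f) \<cdot> (\<mu>\<^sub>A \<^bold>\<otimes> (H \<^bold>\<otimes> H)) = (\<mu>\<^sub>A \<^bold>\<otimes> H) \<cdot> (A \<^bold>\<otimes> Lin (sigma f))"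
    by (subst Lin_mult) simp_all
  also have "((\<mu>\<^sub>A \<^bold>\<otimes> H) \<cdot> (A \<^bold>\<otimes> Lin (sigma f))) \<cdot> (A \<^bold>\<otimes> \<psi> \<^bold>\<otimes> H) \<cdot> ((\<psi> \<^bold>\<otimes> A \<^bold>\<otimes> H) \<cdot> (H \<^bold>\<otimes> A \<^bold>\<otimes> k))
    = ((\<mu>\<^sub>A \<^bold>\<otimes> H) \<cdot> ((A \<^bold>\<otimes> Lin (sigma f)) \<cdot> (A \<^bold>\<otimes> \<psi> \<^bold>\<otimes> H) \<cdot> (A \<^bold>\<otimes> H \<^bold>\<otimes> k))) \<cdot> (\<psi> \<^bold>\<otimes> H)"
    unfolding 2 by simp
  also have "(A \<^bold>\<otimes> Lin (sigma f)) \<cdot> (A \<^bold>\<otimes> \<psi> \<^bold>\<otimes> H) \<cdot> (A \<^bold>\<otimes> H \<^bold>\<otimes> k) = A \<^bold>\<otimes> sigma (R2.cv (d10 h) f)"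
    using sig by (simp add: interchange')
  finally have tail: "Tail f \<cdot> (H \<^bold>\<otimes> Tw h) = Tail (R2.cv (d10 h) f)"
    by (simp add: Tail_def Lin_def)
  have "cpm f \<cdot> (A \<^bold>\<otimes> H \<^bold>\<otimes> Tw h) = Lin (Tail f \<cdot> (H \<^bold>\<otimes> Tw h))"
    unfolding cpm_eq [OF assms(2)] by (rule Lin_pre) simp_all
  then show ?thesis unfolding tail cpm_eq [OF el] .
qed

lemma U_Reg: "U \<in> carrier (Reg 1)"
  using G1.one_closed unfolding mult_Reg_1 .

lemma d1_U: "d10 U = u 2" "d11 U = u 2" "d12 U = u 2"
proof -
  interpret f0: group_hom "Reg 1" "Reg 2" d10 by unfold_locales (rule hom_d1)
  interpret f1: group_hom "Reg 1" "Reg 2" d11 by unfold_locales (rule hom_d1)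
  interpret f2: group_hom "Reg 1" "Reg 2" d12 by unfold_locales (rule hom_d1)
  show "d10 U = u 2" "d11 U = u 2" "d12 U = u 2"
    using f0.hom_one f1.hom_one f2.hom_one unfolding mult_Reg u_eq(1) .
qed

text \<open>\<open>h \<cdot> x2\<close> need not absorb \<open>u 2\<close>, but the regular factor
  \<open>f\<close> supplies it.\<close>

lemma cv_x2:
  assumes "h \<in> carrier (Reg 1)" "f \<in> carrier (Reg 2)"
  shows "R2.cv (h \<cdot> x2) f = R2.cv (d12 h) f"
proof -
  note [simp] = Reg_el(2) [OF assms(1), unfolded Hom_iff] Reg_el(1) [OF assms(2), unfolded Hom_iff]
  have f: "R2.cv (u 2) f = f" using assms(2) Reg_2(2) by blast
  have "R2.cv (h \<cdot> x2) (R2.cv (u 2) f) = R2.cv (R2.cv (h \<cdot> x2) (u 2)) f"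
    by (rule R2.cv_assoc [symmetric]) simp_all
  then show ?thesis unfolding f d12_eq [OF assms(1)] .
qed

text \<open>Inserting \<open>\<eta>\<^sub>A\<close> in both slots of \<open>A\<close> and applying
  \<open>\<epsilon>\<^sub>H\<close> to the result leaves eps(x y) f(x, y). This is f(x, y), because
  \<open>f\<close> absorbs \<open>u 2\<close>, which absorbs the scalar.\<close>

lemma cpm_inj:
  assumes "f \<in> carrier (Reg 2)" "g \<in> carrier (Reg 2)" "cpm f = cpm g"
  shows "f = g"
proof -
  have *: "(A \<^bold>\<otimes> \<epsilon>\<^sub>H) \<cdot> ((cpm f \<cdot> (\<eta>\<^sub>A \<^bold>\<otimes> (H \<^bold>\<otimes> A \<^bold>\<otimes> H))) \<cdot> (H \<^bold>\<otimes> \<eta>\<^sub>A \<^bold>\<otimes> H)) = f" if "f \<in> carrier (Reg 2)" for f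
  proof -
    have el: "R2.el f" by (rule Reg_el(1) [OF that])
    note [simp] = el [unfolded Hom_iff] sigma_typing [OF el] Tail_typing [OF el]
    have f: "R2.cv (u 2) f = f" using that Reg_2(2) by blast
    have psi: "\<psi> \<cdot> (H \<^bold>\<otimes> \<eta>\<^sub>A) = pr \<delta>\<^sub>H U H"
    proof -
      have "\<psi> \<cdot> (H \<^bold>\<otimes> \<eta>\<^sub>A) = Lin (\<psi> \<cdot> (H \<^bold>\<otimes> \<eta>\<^sub>A)) \<cdot> (\<eta>\<^sub>A \<^bold>\<otimes> H)"
        by (rule Lin_unit [symmetric]) simp_all
      also have "Lin (\<psi> \<cdot> (H \<^bold>\<otimes> \<eta>\<^sub>A)) = nabla" by (simp add: nabla_def Lin_def interchange')
      also have "nabla \<cdot> (\<eta>\<^sub>A \<^bold>\<otimes> H) = pr \<delta>\<^sub>H U H"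
        unfolding nabla_eq Tw_def by (rule Lin_unit) simp_all
      finally show ?thesis .
    qed
    define s where "s = \<epsilon>\<^sub>H \<cdot> \<mu>\<^sub>H"
    have [simp]: "s \<in> Arr C" "Dom C s = H \<^bold>\<otimes> H" "Cod C s = K" by (simp_all add: s_def)
    have su: "pr (\<delta>pow 2) s (u 2) = u 2"
      using R2.U_counit [OF R2.WS.point_mult [OF pts(1,2)]] by (simp add: pr_coords s_def u_eq(2))
    have "(\<psi> \<^bold>\<otimes> H) \<cdot> (H \<^bold>\<otimes> \<eta>\<^sub>A \<^bold>\<otimes> H) = (\<psi> \<cdot> (H \<^bold>\<otimes> \<eta>\<^sub>A)) \<^bold>\<otimes> H"
      using interchange' [of "H \<^bold>\<otimes> \<eta>\<^sub>A" \<psi> H H] by simp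
    then have 1: "(\<psi> \<^bold>\<otimes> H) \<cdot> (H \<^bold>\<otimes> \<eta>\<^sub>A \<^bold>\<otimes> H) = pr \<delta>\<^sub>H U H \<^bold>\<otimes> H"
      unfolding psi .
    have "cpm f \<cdot> (\<eta>\<^sub>A \<^bold>\<otimes> (H \<^bold>\<otimes> A \<^bold>\<otimes> H)) = Tail f"
      unfolding cpm_eq [OF el] by (rule Lin_unit) simp_all
    then have "(cpm f \<cdot> (\<eta>\<^sub>A \<^bold>\<otimes> (H \<^bold>\<otimes> A \<^bold>\<otimes> H))) \<cdot> (H \<^bold>\<otimes> \<eta>\<^sub>A \<^bold>\<otimes> H) = Lin (sigma f) \<cdot> (pr \<delta>\<^sub>H U H \<^bold>\<otimes> H)"
      using 1 by (simp add: Tail_def)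
    also have "\<dots> = sigma f"
      using Lin_sigma_pr [of U f] cv_x2 [OF U_Reg that] f by (simp add: d1_U)
    also have "(A \<^bold>\<otimes> \<epsilon>\<^sub>H) \<cdot> sigma f = pr (\<delta>pow 2) f s"
      by (simp add: sigma_eq s_def)
    also have "\<dots> = pr (\<delta>pow 2) s f" by (rule X3.D.scalar_pr_right) simp_all
    also have "\<dots> = pr (\<delta>pow 2) s (R2.cv (u 2) f)" unfolding f ..
    also have "\<dots> = \<mu>\<^sub>A \<cdot> pr (\<delta>pow 2) s (pr (\<delta>pow 2) (u 2) f)"
      by (rule X3.D.scalar_comp [symmetric]) simp_all
    also have "pr (\<delta>pow 2) s (pr (\<delta>pow 2) (u 2) f) = pr (\<delta>pow 2) (pr (\<delta>pow 2) s (u 2)) f"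
      by (rule X3.D.pr_assoc [symmetric]) simp_all
    also have "\<mu>\<^sub>A \<cdot> \<dots> = f" unfolding su by (rule f)
    finally show ?thesis .
  qed
  show ?thesis using * [OF assms(1)] * [OF assms(2)] unfolding assms(3) by (simp only:)
qed

lemma cpm_Tw_Tw:
  assumes "h \<in> carrier (Reg 1)" "f \<in> carrier (Reg 2)"
  shows "cpm f \<cdot> (Tw h \<^bold>\<otimes> Tw h) = cpm (R2.cv (d12 h) (R2.cv (d10 h) f))"
proof -
  have h: "R1.el h" and f: "R2.el f" using Reg_el assms by blast+
  note [simp] = Tw_typing [OF h] cpm_typing [OF f]
  have d: "R2.cv (d10 h) f \<in> carrier (Reg 2)"
    using G2.m_closed [OF hom_d1(1) [THEN hom_in_carrier, OF assms(1)] assms(2)] unfolding mult_Reg .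
  have "cpm f \<cdot> (Tw h \<^bold>\<otimes> Tw h) = (cpm f \<cdot> (A \<^bold>\<otimes> H \<^bold>\<otimes> Tw h)) \<cdot> (Tw h \<^bold>\<otimes> (A \<^bold>\<otimes> H))"
    using interchange' [of "Tw h" "A \<^bold>\<otimes> H" "A \<^bold>\<otimes> H" "Tw h"] by simp
  then show ?thesis
    unfolding cpm_Tw_right [OF h f] cpm_Tw_left [OF h Reg_el(1) [OF d]] cv_x2 [OF assms(1) d] .
qed

lemma Tw_inj:
  assumes "R1.el f" "R1.el g" "Tw f = Tw g"
  shows "f = g"
proof -
  have *: "(A \<^bold>\<otimes> \<epsilon>\<^sub>H) \<cdot> (Tw f \<cdot> (\<eta>\<^sub>A \<^bold>\<otimes> H)) = f" if "R1.el f" for f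
  proof -
    have "Tw f \<cdot> (\<eta>\<^sub>A \<^bold>\<otimes> H) = pr \<delta>\<^sub>H f H"
      unfolding Tw_def by (rule Lin_unit) (use that in simp_all)
    then show ?thesis using that by simp
  qed
  show ?thesis using * [OF assms(1)] * [OF assms(2)] unfolding assms(3) by (simp only:)
qed

lemma Tw_comult:
  assumes "R1.el h"
  shows "(A \<^bold>\<otimes> \<delta>\<^sub>H) \<cdot> Tw h = (Tw h \<^bold>\<otimes> H) \<cdot> (A \<^bold>\<otimes> \<delta>\<^sub>H)"
proof -
  note [simp] = assms [unfolded Hom_iff]
  have 1: "(A \<^bold>\<otimes> \<delta>\<^sub>H) \<cdot> (\<mu>\<^sub>A \<^bold>\<otimes> H) = (\<mu>\<^sub>A \<^bold>\<otimes> H \<^bold>\<otimes> H) \<cdot> (A \<^bold>\<otimes> A \<^bold>\<otimes> \<delta>\<^sub>H)"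
    using interchange' [of \<mu>\<^sub>A A H \<delta>\<^sub>H] interchange' [of "A \<^bold>\<otimes> A" \<mu>\<^sub>A \<delta>\<^sub>H "H \<^bold>\<otimes> H"] by simp
  have 2: "(pr \<delta>\<^sub>H h H \<^bold>\<otimes> H) \<cdot> \<delta>\<^sub>H = pr \<delta>\<^sub>H h \<delta>\<^sub>H"
    using W.pr_assoc [of h H H] by (simp add: pr_def [of \<delta>\<^sub>H "pr \<delta>\<^sub>H h H" H])
  have T: "Tw h \<^bold>\<otimes> H = (\<mu>\<^sub>A \<^bold>\<otimes> H \<^bold>\<otimes> H) \<cdot> (A \<^bold>\<otimes> pr \<delta>\<^sub>H h H \<^bold>\<otimes> H)"
    using interchange' [of "A \<^bold>\<otimes> pr \<delta>\<^sub>H h H" "\<mu>\<^sub>A \<^bold>\<otimes> H" H H] by (simp add: Tw_def Lin_def)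
  have "(A \<^bold>\<otimes> \<delta>\<^sub>H) \<cdot> Tw h = ((A \<^bold>\<otimes> \<delta>\<^sub>H) \<cdot> (\<mu>\<^sub>A \<^bold>\<otimes> H)) \<cdot> (A \<^bold>\<otimes> pr \<delta>\<^sub>H h H)"
    by (simp add: Tw_def Lin_def)
  also have "\<dots> = (\<mu>\<^sub>A \<^bold>\<otimes> H \<^bold>\<otimes> H) \<cdot> ((A \<^bold>\<otimes> A \<^bold>\<otimes> \<delta>\<^sub>H) \<cdot> (A \<^bold>\<otimes> pr \<delta>\<^sub>H h H))"
    unfolding 1 by simp
  also have "(A \<^bold>\<otimes> A \<^bold>\<otimes> \<delta>\<^sub>H) \<cdot> (A \<^bold>\<otimes> pr \<delta>\<^sub>H h H) = (A \<^bold>\<otimes> pr \<delta>\<^sub>H h H \<^bold>\<otimes> H) \<cdot> (A \<^bold>\<otimes> \<delta>\<^sub>H)"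
    using 2 by (simp add: interchange')
  finally show ?thesis unfolding T by simp
qed

section \<open>Equivalence of crossed products\<close>

lemma splits_AH: "splits (A \<^bold>\<otimes> H) nabla i_AH p_AH"
proof -
  have [simp]: "nabla \<in> Arr C" "Dom C nabla = A \<^bold>\<otimes> H" "Cod C nabla = A \<^bold>\<otimes> H"
    by (simp_all add: nabla_eq)
  have idem: "nabla \<cdot> nabla = nabla"
    using Tw_comp [of U U] u_idem(1) by (simp add: nabla_eq)
  obtain i where i: "is_equalizer C nabla (A \<^bold>\<otimes> H) i"
    using equalizers [of nabla "A \<^bold>\<otimes> H" "A \<^bold>\<otimes> H" "A \<^bold>\<otimes> H"] by auto
  then have i': "i \<in> Arr C" "Cod C i = A \<^bold>\<otimes> H" "nabla \<cdot> i = i"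
    and univ: "\<And>Z h. \<lbrakk>h \<in> Hom C Z (A \<^bold>\<otimes> H); nabla \<cdot> h = (A \<^bold>\<otimes> H) \<cdot> h\<rbrakk> \<Longrightarrow> \<exists>!k. k \<in> Hom C Z (Dom C i) \<and> i \<cdot> k = h"
    by (auto simp: is_equalizer_def)
  note [simp] = i'(1,2)
  have "\<exists>!k. k \<in> Hom C (A \<^bold>\<otimes> H) (Dom C i) \<and> i \<cdot> k = nabla"
    by (rule univ) (simp_all add: idem)
  then obtain p where p: "p \<in> Hom C (A \<^bold>\<otimes> H) (Dom C i)" "i \<cdot> p = nabla" by blast
  have "i \<cdot> (p \<cdot> i) = (i \<cdot> p) \<cdot> i" using p(1) by simp
  also have "\<dots> = i" using p(2) i'(3) by simp
  finally have ipi: "i \<cdot> (p \<cdot> i) = i" .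
  \<comment> \<open>Both \<open>p \<cdot> i\<close> and the identity factor \<open>i\<close> through
    itself, so they coincide.\<close>
  have "\<exists>!k. k \<in> Hom C (Dom C i) (Dom C i) \<and> i \<cdot> k = i"
    by (rule univ) (simp_all add: i'(3))
  moreover have "p \<cdot> i \<in> Hom C (Dom C i) (Dom C i)" "Dom C i \<in> Hom C (Dom C i) (Dom C i)" "i \<cdot> Dom C i = i"
    using p(1) by simp_all
  ultimately have "p \<cdot> i = Dom C i" using ipi by blast
  then have "splits (A \<^bold>\<otimes> H) nabla i p"
    using p by (simp add: splits_def)
  then have "\<exists>x. case x of (i, p) \<Rightarrow> splits (A \<^bold>\<otimes> H) nabla i p" by auto
  then have "case nabla_splitting of (i, p) \<Rightarrow> splits (A \<^bold>\<otimes> H) nabla i p"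
    unfolding nabla_splitting_def by (rule someI_ex)
  then show ?thesis by (simp add: i_AH_def p_AH_def case_prod_beta)
qed

lemma splitting_typing [simp]:
  "AxH \<in> Obj C" "i_AH \<in> Arr C" "Dom C i_AH = AxH" "Cod C i_AH = A \<^bold>\<otimes> H"
  "p_AH \<in> Arr C" "Dom C p_AH = A \<^bold>\<otimes> H" "Cod C p_AH = AxH"
  using splits_AH by (auto simp: splits_def AxH_def)

lemma i_p: "i_AH \<cdot> p_AH = Tw U" and p_i: "p_AH \<cdot> i_AH = AxH"
  using splits_AH unfolding splits_def AxH_def nabla_eq by blast+

lemma Tw_U_Tw:
  assumes "h \<in> carrier (Reg 1)"
  shows "Tw U \<cdot> Tw h = Tw h" "Tw h \<cdot> Tw U = Tw h"
proof -
  have h: "R1.el h" and Uh: "R1.cv U h = h" using assms Reg_1(2) by blast+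
  have U: "R1.el U" by simp
  show "Tw h \<cdot> Tw U = Tw h" unfolding Tw_comp [OF U h] Uh ..
  show "Tw U \<cdot> Tw h = Tw h" unfolding Tw_comp [OF h U] R1.cv_comm [OF h U] Uh ..
qed

text \<open>The rules for \<open>cpm\<close> and \<open>cpm_inj\<close> turn multiplicativity of
  \<open>Tw h\<close> into an equation of cochains; convolution with \<open>d11 h\<close> accounts
  for the inverse inside \<open>D1 h\<close>.\<close>

lemma comparison_iff:
  assumes "\<alpha> \<in> carrier (Reg 2)" "\<beta> \<in> carrier (Reg 2)" "h \<in> carrier (Reg 1)"
  shows "Tw h \<cdot> cpm \<alpha> = cpm \<beta> \<cdot> (Tw h \<^bold>\<otimes> Tw h) \<longleftrightarrow> \<alpha> = D1 h \<otimes>\<^bsub>Reg 2\<^esub> \<beta>"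
proof -
  note c = hom_d1 [THEN hom_in_carrier, OF assms(3)]
  have "Tw h \<cdot> cpm \<alpha> = cpm \<beta> \<cdot> (Tw h \<^bold>\<otimes> Tw h) \<longleftrightarrow> cpm (\<alpha> \<otimes>\<^bsub>Reg 2\<^esub> d11 h) = cpm (d12 h \<otimes>\<^bsub>Reg 2\<^esub> (d10 h \<otimes>\<^bsub>Reg 2\<^esub> \<beta>))"
    unfolding Tw_cpm [OF Reg_el(2) [OF assms(3)] Reg_el(1) [OF assms(1)]] cpm_Tw_Tw [OF assms(3,2)] mult_Reg ..
  also have "\<dots> \<longleftrightarrow> \<alpha> \<otimes>\<^bsub>Reg 2\<^esub> d11 h = d12 h \<otimes>\<^bsub>Reg 2\<^esub> (d10 h \<otimes>\<^bsub>Reg 2\<^esub> \<beta>)"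
    using cpm_inj [of "\<alpha> \<otimes>\<^bsub>Reg 2\<^esub> d11 h" "d12 h \<otimes>\<^bsub>Reg 2\<^esub> (d10 h \<otimes>\<^bsub>Reg 2\<^esub> \<beta>)"] c assms by auto
  also have "d12 h \<otimes>\<^bsub>Reg 2\<^esub> (d10 h \<otimes>\<^bsub>Reg 2\<^esub> \<beta>) = (D1 h \<otimes>\<^bsub>Reg 2\<^esub> \<beta>) \<otimes>\<^bsub>Reg 2\<^esub> d11 h"
  proof -
    have D: "D1 h \<in> carrier (Reg 2)" by (rule hom_in_carrier [OF hom_D(1) assms(3)])
    have "(D1 h \<otimes>\<^bsub>Reg 2\<^esub> \<beta>) \<otimes>\<^bsub>Reg 2\<^esub> d11 h = (D1 h \<otimes>\<^bsub>Reg 2\<^esub> d11 h) \<otimes>\<^bsub>Reg 2\<^esub> \<beta>"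
      using D c assms by (simp only: G2.m_ac G2.m_closed)
    also have "D1 h \<otimes>\<^bsub>Reg 2\<^esub> d11 h = d10 h \<otimes>\<^bsub>Reg 2\<^esub> d12 h"
      unfolding D1_def using c by (rule G2.mult_inv_mult_cancel)
    finally show ?thesis using c assms by (simp only: G2.m_ac G2.m_closed)
  qed
  also have "\<alpha> \<otimes>\<^bsub>Reg 2\<^esub> d11 h = (D1 h \<otimes>\<^bsub>Reg 2\<^esub> \<beta>) \<otimes>\<^bsub>Reg 2\<^esub> d11 h \<longleftrightarrow> \<alpha> = D1 h \<otimes>\<^bsub>Reg 2\<^esub> \<beta>"
    using c assms hom_in_carrier [OF hom_D(1) assms(3)] by (intro G2.right_cancel) simp_all
  finally show ?thesis .
qed

lemma preunit_eq: "cp_preunit (weak_crossed_product f) = Tw U \<cdot> (\<eta>\<^sub>A \<^bold>\<otimes> \<eta>\<^sub>H)"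
  by (simp add: weak_crossed_product_def nabla_eq)

lemma conjugate:
  assumes "\<omega> \<in> Hom C AxH AxH"
  shows "Tw U \<cdot> (i_AH \<cdot> \<omega> \<cdot> p_AH) = i_AH \<cdot> \<omega> \<cdot> p_AH" "(i_AH \<cdot> \<omega> \<cdot> p_AH) \<cdot> Tw U = i_AH \<cdot> \<omega> \<cdot> p_AH"
proof -
  note [simp] = assms [unfolded Hom_iff]
  have 1: "p_AH \<cdot> (i_AH \<cdot> f) = f" if "f \<in> Arr C" "Cod C f = AxH" for f
    using comp_assoc' [of f i_AH p_AH] that by (simp add: p_i)
  show "Tw U \<cdot> (i_AH \<cdot> \<omega> \<cdot> p_AH) = i_AH \<cdot> \<omega> \<cdot> p_AH" "(i_AH \<cdot> \<omega> \<cdot> p_AH) \<cdot> Tw U = i_AH \<cdot> \<omega> \<cdot> p_AH"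
    unfolding i_p [symmetric] by (simp_all add: 1)
qed

text \<open>Transported to \<open>A \<otimes> H\<close>, linearity says that the morphism is
  determined by its restriction \<open>k\<close> to \<open>H\<close>, and colinearity that
  \<open>k\<close> is recovered from its \<open>A\<close>-component \<open>h\<close> by pairing with
  the identity of \<open>H\<close>.\<close>

lemma linear_colinear_imp_Tw:
  assumes \<omega>: "\<omega> \<in> Hom C AxH AxH"
    and lin: "\<omega> \<cdot> left_action = left_action \<cdot> (A \<^bold>\<otimes> \<omega>)"
    and colin: "right_coaction \<cdot> \<omega> = (\<omega> \<^bold>\<otimes> H) \<cdot> right_coaction"
  obtains h where "R1.el h" "R1.cv U h = h" "i_AH \<cdot> \<omega> \<cdot> p_AH = Tw h"
proof -
  note [simp] = \<omega> [unfolded Hom_iff]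
  define W where "W = i_AH \<cdot> \<omega> \<cdot> p_AH"
  have [simp]: "W \<in> Arr C" "Dom C W = A \<^bold>\<otimes> H" "Cod C W = A \<^bold>\<otimes> H" by (simp_all add: W_def)
  have UW: "Tw U \<cdot> W = W" and WU: "W \<cdot> Tw U = W"
    unfolding W_def by (rule conjugate [OF \<omega>])+
  have Tlin: "Tw U \<cdot> (\<mu>\<^sub>A \<^bold>\<otimes> H) = (\<mu>\<^sub>A \<^bold>\<otimes> H) \<cdot> (A \<^bold>\<otimes> Tw U)"
    unfolding Tw_def by (rule Lin_mult) simp_all
  \<comment> \<open>Placed between \<open>i_AH\<close> and \<open>p_AH\<close>, linearity of
    \<open>\<omega>\<close> becomes linearity of \<open>W\<close> up to copies of
    \<open>Tw U\<close>, which \<open>W\<close> absorbs. Colinearity is treated in the same way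
    below.\<close>
  have "i_AH \<cdot> (\<omega> \<cdot> left_action) \<cdot> (A \<^bold>\<otimes> p_AH) = i_AH \<cdot> (left_action \<cdot> (A \<^bold>\<otimes> \<omega>)) \<cdot> (A \<^bold>\<otimes> p_AH)"
    unfolding lin ..
  moreover have "i_AH \<cdot> (\<omega> \<cdot> left_action) \<cdot> (A \<^bold>\<otimes> p_AH) = W \<cdot> ((\<mu>\<^sub>A \<^bold>\<otimes> H) \<cdot> ((A \<^bold>\<otimes> i_AH) \<cdot> (A \<^bold>\<otimes> p_AH)))"
    by (simp add: left_action_def W_def)
  moreover have "i_AH \<cdot> (left_action \<cdot> (A \<^bold>\<otimes> \<omega>)) \<cdot> (A \<^bold>\<otimes> p_AH)
      = (i_AH \<cdot> p_AH) \<cdot> (\<mu>\<^sub>A \<^bold>\<otimes> H) \<cdot> ((A \<^bold>\<otimes> i_AH) \<cdot> (A \<^bold>\<otimes> \<omega>) \<cdot> (A \<^bold>\<otimes> p_AH))"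
    by (simp add: left_action_def)
  moreover have "(A \<^bold>\<otimes> i_AH) \<cdot> (A \<^bold>\<otimes> p_AH) = A \<^bold>\<otimes> Tw U"
    by (simp add: interchange' i_p)
  moreover have "(A \<^bold>\<otimes> i_AH) \<cdot> (A \<^bold>\<otimes> \<omega>) \<cdot> (A \<^bold>\<otimes> p_AH) = A \<^bold>\<otimes> W"
    by (simp add: interchange' W_def)
  ultimately have "W \<cdot> ((\<mu>\<^sub>A \<^bold>\<otimes> H) \<cdot> (A \<^bold>\<otimes> Tw U)) = Tw U \<cdot> (\<mu>\<^sub>A \<^bold>\<otimes> H) \<cdot> (A \<^bold>\<otimes> W)"
    by (simp only: i_p)
  then have "(W \<cdot> Tw U) \<cdot> (\<mu>\<^sub>A \<^bold>\<otimes> H) = (Tw U \<cdot> (\<mu>\<^sub>A \<^bold>\<otimes> H)) \<cdot> (A \<^bold>\<otimes> W)"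
    unfolding Tlin [symmetric] by simp
  also have "(Tw U \<cdot> (\<mu>\<^sub>A \<^bold>\<otimes> H)) \<cdot> (A \<^bold>\<otimes> W) = (\<mu>\<^sub>A \<^bold>\<otimes> H) \<cdot> (A \<^bold>\<otimes> (Tw U \<cdot> W))"
    unfolding Tlin by (simp add: interchange')
  finally have Wlin: "W \<cdot> (\<mu>\<^sub>A \<^bold>\<otimes> H) = (\<mu>\<^sub>A \<^bold>\<otimes> H) \<cdot> (A \<^bold>\<otimes> W)"
    unfolding UW WU .
  have "(i_AH \<^bold>\<otimes> H) \<cdot> (right_coaction \<cdot> \<omega>) \<cdot> p_AH = (i_AH \<^bold>\<otimes> H) \<cdot> ((\<omega> \<^bold>\<otimes> H) \<cdot> right_coaction) \<cdot> p_AH"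
    unfolding colin ..
  moreover have "(i_AH \<^bold>\<otimes> H) \<cdot> (right_coaction \<cdot> \<omega>) \<cdot> p_AH = ((i_AH \<^bold>\<otimes> H) \<cdot> (p_AH \<^bold>\<otimes> H)) \<cdot> (A \<^bold>\<otimes> \<delta>\<^sub>H) \<cdot> W"
    by (simp add: right_coaction_def W_def)
  moreover have "(i_AH \<^bold>\<otimes> H) \<cdot> ((\<omega> \<^bold>\<otimes> H) \<cdot> right_coaction) \<cdot> p_AH
     = ((i_AH \<^bold>\<otimes> H) \<cdot> (\<omega> \<^bold>\<otimes> H) \<cdot> (p_AH \<^bold>\<otimes> H)) \<cdot> (A \<^bold>\<otimes> \<delta>\<^sub>H) \<cdot> (i_AH \<cdot> p_AH)"
    by (simp add: right_coaction_def)
  moreover have "(i_AH \<^bold>\<otimes> H) \<cdot> (p_AH \<^bold>\<otimes> H) = Tw U \<^bold>\<otimes> H"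
    by (simp add: interchange' i_p)
  moreover have "(i_AH \<^bold>\<otimes> H) \<cdot> (\<omega> \<^bold>\<otimes> H) \<cdot> (p_AH \<^bold>\<otimes> H) = W \<^bold>\<otimes> H"
    by (simp add: interchange' W_def)
  ultimately have "(Tw U \<^bold>\<otimes> H) \<cdot> (A \<^bold>\<otimes> \<delta>\<^sub>H) \<cdot> W = (W \<^bold>\<otimes> H) \<cdot> (A \<^bold>\<otimes> \<delta>\<^sub>H) \<cdot> Tw U"
    by (simp only: i_p)
  moreover have "(Tw U \<^bold>\<otimes> H) \<cdot> (A \<^bold>\<otimes> \<delta>\<^sub>H) \<cdot> W = (A \<^bold>\<otimes> \<delta>\<^sub>H) \<cdot> (Tw U \<cdot> W)"
  proof -
    have "(Tw U \<^bold>\<otimes> H) \<cdot> (A \<^bold>\<otimes> \<delta>\<^sub>H) \<cdot> W = ((Tw U \<^bold>\<otimes> H) \<cdot> (A \<^bold>\<otimes> \<delta>\<^sub>H)) \<cdot> W" by simp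
    also have "(Tw U \<^bold>\<otimes> H) \<cdot> (A \<^bold>\<otimes> \<delta>\<^sub>H) = (A \<^bold>\<otimes> \<delta>\<^sub>H) \<cdot> Tw U"
      by (rule Tw_comult [symmetric]) simp
    finally show ?thesis by simp
  qed
  moreover have "(W \<^bold>\<otimes> H) \<cdot> (A \<^bold>\<otimes> \<delta>\<^sub>H) \<cdot> Tw U = ((W \<cdot> Tw U) \<^bold>\<otimes> H) \<cdot> (A \<^bold>\<otimes> \<delta>\<^sub>H)"
    using Tw_comult [of U] interchange_comp [of "Tw U" W H H "A \<^bold>\<otimes> \<delta>\<^sub>H"] by simp
  ultimately have Wcolin: "(A \<^bold>\<otimes> \<delta>\<^sub>H) \<cdot> W = (W \<^bold>\<otimes> H) \<cdot> (A \<^bold>\<otimes> \<delta>\<^sub>H)"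
    unfolding UW WU by simp
  define k where "k = W \<cdot> (\<eta>\<^sub>A \<^bold>\<otimes> H)"
  have [simp]: "k \<in> Arr C" "Dom C k = H" "Cod C k = A \<^bold>\<otimes> H" by (simp_all add: k_def)
  define h where "h = (A \<^bold>\<otimes> \<epsilon>\<^sub>H) \<cdot> k"
  have h [simp]: "h \<in> Arr C" "Dom C h = H" "Cod C h = A" by (simp_all add: h_def)
  have "Lin k = ((\<mu>\<^sub>A \<^bold>\<otimes> H) \<cdot> (A \<^bold>\<otimes> W)) \<cdot> (A \<^bold>\<otimes> \<eta>\<^sub>A \<^bold>\<otimes> H)"
    by (simp add: Lin_def k_def interchange')
  also have "\<dots> = W \<cdot> ((\<mu>\<^sub>A \<^bold>\<otimes> H) \<cdot> ((A \<^bold>\<otimes> \<eta>\<^sub>A) \<^bold>\<otimes> H))"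
    unfolding Wlin [symmetric] by simp
  also have "(\<mu>\<^sub>A \<^bold>\<otimes> H) \<cdot> ((A \<^bold>\<otimes> \<eta>\<^sub>A) \<^bold>\<otimes> H) = A \<^bold>\<otimes> H"
    using A_laws(2) by (subst interchange') simp_all
  finally have Wk: "W = Lin k" by simp
  have "pr \<delta>\<^sub>H h H = ((A \<^bold>\<otimes> \<epsilon>\<^sub>H \<^bold>\<otimes> H) \<cdot> (k \<^bold>\<otimes> H)) \<cdot> \<delta>\<^sub>H"
    using interchange' [of k "A \<^bold>\<otimes> \<epsilon>\<^sub>H" H H] by (simp add: pr_def h_def)
  also have "\<dots> = (A \<^bold>\<otimes> \<epsilon>\<^sub>H \<^bold>\<otimes> H) \<cdot> ((W \<^bold>\<otimes> H) \<cdot> ((\<eta>\<^sub>A \<^bold>\<otimes> H) \<^bold>\<otimes> H)) \<cdot> \<delta>\<^sub>H"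
    using interchange' [of "\<eta>\<^sub>A \<^bold>\<otimes> H" W H H] by (simp add: k_def)
  also have "\<dots> = (A \<^bold>\<otimes> \<epsilon>\<^sub>H \<^bold>\<otimes> H) \<cdot> (W \<^bold>\<otimes> H) \<cdot> ((\<eta>\<^sub>A \<^bold>\<otimes> H \<^bold>\<otimes> H) \<cdot> \<delta>\<^sub>H)"
    by simp
  also have "(\<eta>\<^sub>A \<^bold>\<otimes> H \<^bold>\<otimes> H) \<cdot> \<delta>\<^sub>H = (A \<^bold>\<otimes> \<delta>\<^sub>H) \<cdot> (\<eta>\<^sub>A \<^bold>\<otimes> H)"
    using interchange' [of \<eta>\<^sub>A A H \<delta>\<^sub>H] interchange' [of K \<eta>\<^sub>A \<delta>\<^sub>H "H \<^bold>\<otimes> H"] by simp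
  also have "(A \<^bold>\<otimes> \<epsilon>\<^sub>H \<^bold>\<otimes> H) \<cdot> (W \<^bold>\<otimes> H) \<cdot> ((A \<^bold>\<otimes> \<delta>\<^sub>H) \<cdot> (\<eta>\<^sub>A \<^bold>\<otimes> H))
      = (A \<^bold>\<otimes> \<epsilon>\<^sub>H \<^bold>\<otimes> H) \<cdot> ((W \<^bold>\<otimes> H) \<cdot> (A \<^bold>\<otimes> \<delta>\<^sub>H)) \<cdot> (\<eta>\<^sub>A \<^bold>\<otimes> H)"
    by simp
  also have "\<dots> = ((A \<^bold>\<otimes> \<epsilon>\<^sub>H \<^bold>\<otimes> H) \<cdot> (A \<^bold>\<otimes> \<delta>\<^sub>H)) \<cdot> k"
    unfolding Wcolin [symmetric] by (simp add: k_def)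
  also have "(A \<^bold>\<otimes> \<epsilon>\<^sub>H \<^bold>\<otimes> H) \<cdot> (A \<^bold>\<otimes> \<delta>\<^sub>H) = A \<^bold>\<otimes> H"
    by (simp add: interchange' W.counit)
  finally have "pr \<delta>\<^sub>H h H = k" by simp
  then have WT: "W = Tw h" unfolding Wk Tw_def by simp
  have "Tw (R1.cv U h) = Tw h"
    using WU Tw_comp [of U h] unfolding WT by simp
  from Tw_inj [OF _ _ this] have Uh: "R1.cv U h = h" by simp
  show thesis
  proof (rule that)
    show "R1.el h" by simp
    show "R1.cv U h = h" by (rule Uh)
    show "i_AH \<cdot> \<omega> \<cdot> p_AH = Tw h" using WT unfolding W_def .
  qed
qed

text \<open>Equivalences and twists \<open>Tw h\<close> correspond under the splitting, and
  \<open>comparison_iff\<close> handles the products. The remaining conditions are invertibility of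
  \<open>h\<close>, read off from the inverse isomorphism, and preservation of the unit, supplied by
  \<open>normal_coboundary_target\<close>.\<close>

lemma equivalent_iff:
  assumes \<alpha>: "\<alpha> \<in> normal_cocycles" and \<beta>: "\<beta> \<in> normal_cocycles"
  shows "equivalent (weak_crossed_product \<alpha>) (weak_crossed_product \<beta>) \<longleftrightarrow>
    (\<exists>h \<in> carrier (Reg 1). \<alpha> = D1 h \<otimes>\<^bsub>Reg 2\<^esub> \<beta>)"
proof
  have a: "\<alpha> \<in> carrier (Reg 2)" and b: "\<beta> \<in> carrier (Reg 2)"
    using \<alpha> \<beta> by (simp_all add: normal_cocycles_def)
  note [simp] = cpm_typing [OF Reg_el(1) [OF a]] cpm_typing [OF Reg_el(1) [OF b]]
  have i_p_comp: "i_AH \<cdot> p_AH \<cdot> f = Tw U \<cdot> f" if "f \<in> Arr C" "Cod C f = A \<^bold>\<otimes> H" for f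
    using comp_assoc' [of f p_AH i_AH] that by (simp add: i_p)
  have p_U: "p_AH \<cdot> Tw U = p_AH" and U_i: "Tw U \<cdot> i_AH = i_AH"
    unfolding i_p [symmetric] using comp_assoc' [of p_AH i_AH p_AH] comp_assoc' [of i_AH p_AH i_AH]
    by (simp_all add: p_i)
  {
    assume "equivalent (weak_crossed_product \<alpha>) (weak_crossed_product \<beta>)"
    then obtain \<omega> where iso: "is_iso AxH AxH \<omega>"
      and alg: "algebra_morphism (associated_algebra (weak_crossed_product \<alpha>)) (associated_algebra (weak_crossed_product \<beta>)) \<omega>"
      and lin: "\<omega> \<cdot> left_action = left_action \<cdot> (A \<^bold>\<otimes> \<omega>)"
      and colin: "right_coaction \<cdot> \<omega> = (\<omega> \<^bold>\<otimes> H) \<cdot> right_coaction"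
      by (auto simp: equivalent_def)
    obtain g where \<omega>: "\<omega> \<in> Hom C AxH AxH" and g: "g \<in> Hom C AxH AxH" and inv: "g \<cdot> \<omega> = AxH" "\<omega> \<cdot> g = AxH"
      using iso by (auto simp: is_iso_def)
    note [simp] = \<omega> [unfolded Hom_iff] g [unfolded Hom_iff]
    have [simp]: "left_action \<in> Arr C" "Dom C left_action = A \<^bold>\<otimes> AxH" "Cod C left_action = AxH"
      "right_coaction \<in> Arr C" "Dom C right_coaction = AxH" "Cod C right_coaction = AxH \<^bold>\<otimes> H"
      by (simp_all add: left_action_def right_coaction_def)
    \<comment> \<open>The inverse is linear and colinear too, hence a twist; its coefficient will be
      the inverse of \<open>h\<close>, which places \<open>h\<close> in
      \<open>Reg 1\<close>.\<close>
    have glin: "g \<cdot> left_action = left_action \<cdot> (A \<^bold>\<otimes> g)"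
    proof -
      have "g \<cdot> left_action = g \<cdot> (left_action \<cdot> (A \<^bold>\<otimes> \<omega>)) \<cdot> (A \<^bold>\<otimes> g)"
        using inv(2) by (simp add: interchange')
      also have "\<dots> = (g \<cdot> \<omega>) \<cdot> left_action \<cdot> (A \<^bold>\<otimes> g)"
        unfolding lin [symmetric] by simp
      finally show ?thesis unfolding inv by simp
    qed
    have gcolin: "right_coaction \<cdot> g = (g \<^bold>\<otimes> H) \<cdot> right_coaction"
    proof -
      have "right_coaction \<cdot> g = (g \<^bold>\<otimes> H) \<cdot> ((\<omega> \<^bold>\<otimes> H) \<cdot> right_coaction) \<cdot> g"
        using inv(1) by (simp add: interchange_comp)
      also have "\<dots> = (g \<^bold>\<otimes> H) \<cdot> right_coaction \<cdot> (\<omega> \<cdot> g)"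
        unfolding colin [symmetric] by simp
      finally show ?thesis unfolding inv by simp
    qed
    obtain h where h: "R1.el h" "R1.cv U h = h" "i_AH \<cdot> \<omega> \<cdot> p_AH = Tw h"
      by (rule linear_colinear_imp_Tw [OF \<omega> lin colin])
    obtain h' where h': "R1.el h'" "R1.cv U h' = h'" "i_AH \<cdot> g \<cdot> p_AH = Tw h'"
      by (rule linear_colinear_imp_Tw [OF g glin gcolin])
    have "Tw h' \<cdot> Tw h = i_AH \<cdot> g \<cdot> (p_AH \<cdot> i_AH) \<cdot> \<omega> \<cdot> p_AH"
      unfolding h(3) [symmetric] h'(3) [symmetric] by simp
    also have "\<dots> = i_AH \<cdot> (g \<cdot> \<omega>) \<cdot> p_AH" unfolding p_i by simp
    also have "\<dots> = Tw U" unfolding inv by (simp add: i_p)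
    finally have "Tw (R1.cv h h') = Tw U" unfolding Tw_comp [OF h(1) h'(1)] .
    from Tw_inj [OF _ _ this] have "R1.cv h h' = U" using h(1) h'(1) by simp
    then have hR: "h \<in> carrier (Reg 1)" using h h' unfolding Reg_1(2) by blast
    note [simp] = Tw_typing [OF h(1)]
    have e: "\<omega> \<cdot> p_AH \<cdot> cpm \<alpha> \<cdot> (i_AH \<^bold>\<otimes> i_AH) = (p_AH \<cdot> cpm \<beta> \<cdot> (i_AH \<^bold>\<otimes> i_AH)) \<cdot> (\<omega> \<^bold>\<otimes> \<omega>)"
      using alg by (simp add: algebra_morphism_def associated_algebra_def)
    have "(i_AH \<cdot> \<omega> \<cdot> p_AH) \<cdot> cpm \<alpha> \<cdot> ((i_AH \<^bold>\<otimes> i_AH) \<cdot> (p_AH \<^bold>\<otimes> p_AH))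
       = i_AH \<cdot> (\<omega> \<cdot> p_AH \<cdot> cpm \<alpha> \<cdot> (i_AH \<^bold>\<otimes> i_AH)) \<cdot> (p_AH \<^bold>\<otimes> p_AH)"
      by simp
    also have "\<dots> = (i_AH \<cdot> p_AH) \<cdot> cpm \<beta> \<cdot> ((i_AH \<^bold>\<otimes> i_AH) \<cdot> (\<omega> \<^bold>\<otimes> \<omega>) \<cdot> (p_AH \<^bold>\<otimes> p_AH))"
      unfolding e by simp
    finally have "(i_AH \<cdot> \<omega> \<cdot> p_AH) \<cdot> cpm \<alpha> \<cdot> ((i_AH \<^bold>\<otimes> i_AH) \<cdot> (p_AH \<^bold>\<otimes> p_AH))
       = (i_AH \<cdot> p_AH) \<cdot> cpm \<beta> \<cdot> ((i_AH \<^bold>\<otimes> i_AH) \<cdot> (\<omega> \<^bold>\<otimes> \<omega>) \<cdot> (p_AH \<^bold>\<otimes> p_AH))" .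
    moreover have "(i_AH \<^bold>\<otimes> i_AH) \<cdot> (p_AH \<^bold>\<otimes> p_AH) = Tw U \<^bold>\<otimes> Tw U"
      by (simp add: interchange' i_p)
    moreover have "(i_AH \<^bold>\<otimes> i_AH) \<cdot> (\<omega> \<^bold>\<otimes> \<omega>) \<cdot> (p_AH \<^bold>\<otimes> p_AH) = Tw h \<^bold>\<otimes> Tw h"
      by (simp add: interchange' h(3))
    ultimately have eq: "Tw h \<cdot> (cpm \<alpha> \<cdot> (Tw U \<^bold>\<otimes> Tw U)) = Tw U \<cdot> (cpm \<beta> \<cdot> (Tw h \<^bold>\<otimes> Tw h))"
      unfolding h(3) i_p by (simp only:)
    \<comment> \<open>The copies of \<open>Tw U\<close> left by the splitting disappear because the
      cochains absorb \<open>u 2\<close>.\<close>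
    have aU: "cpm \<alpha> \<cdot> (Tw U \<^bold>\<otimes> Tw U) = cpm \<alpha>"
    proof -
      have "R2.cv (u 2) \<alpha> = \<alpha>" using a Reg_2(2) by blast
      then show ?thesis unfolding cpm_Tw_Tw [OF U_Reg a] d1_U by (simp only:)
    qed
    have "Tw U \<cdot> (cpm \<beta> \<cdot> (Tw h \<^bold>\<otimes> Tw h)) = cpm \<beta> \<cdot> (Tw h \<^bold>\<otimes> Tw h)"
    proof -
      note c = hom_d1 [THEN hom_in_carrier, OF hR]
      let ?f = "R2.cv (d12 h) (R2.cv (d10 h) \<beta>)"
      have f: "?f \<in> carrier (Reg 2)"
        using c b G2.m_closed [of "d12 h" "d10 h \<otimes>\<^bsub>Reg 2\<^esub> \<beta>"] unfolding mult_Reg [symmetric] by simp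
      have "R2.cv ?f (u 2) = ?f" using G2.r_one [OF f] unfolding mult_Reg .
      moreover have "Tw U \<cdot> cpm ?f = cpm (R2.cv ?f (u 2))"
        using Tw_cpm [OF Reg_el(2) [OF U_Reg] Reg_el(1) [OF f]] unfolding d1_U .
      ultimately show ?thesis unfolding cpm_Tw_Tw [OF hR b] by (simp only:)
    qed
    then have "Tw h \<cdot> cpm \<alpha> = cpm \<beta> \<cdot> (Tw h \<^bold>\<otimes> Tw h)"
      using eq unfolding aU by (simp only:)
    then have "\<alpha> = D1 h \<otimes>\<^bsub>Reg 2\<^esub> \<beta>" using comparison_iff [OF a b hR] by blast
    then show "\<exists>h \<in> carrier (Reg 1). \<alpha> = D1 h \<otimes>\<^bsub>Reg 2\<^esub> \<beta>" using hR by blast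
  next
    assume "\<exists>h \<in> carrier (Reg 1). \<alpha> = D1 h \<otimes>\<^bsub>Reg 2\<^esub> \<beta>"
    then obtain h where h: "h \<in> carrier (Reg 1)" and eq: "\<alpha> = D1 h \<otimes>\<^bsub>Reg 2\<^esub> \<beta>" by blast
    have hT: "h \<cdot> W.target = U" by (rule normal_coboundary_target [OF \<alpha> \<beta> h eq])
    have mult: "Tw h \<cdot> cpm \<alpha> = cpm \<beta> \<cdot> (Tw h \<^bold>\<otimes> Tw h)"
      using comparison_iff [OF a b h] eq by blast
    define h' where "h' = inv\<^bsub>Reg 1\<^esub> h"
    have h': "h' \<in> carrier (Reg 1)" unfolding h'_def by (rule G1.inv_closed [OF h])
    have hh': "R1.cv h h' = U" "R1.cv h' h = U"
      using G1.r_inv [OF h] G1.l_inv [OF h] unfolding h'_def mult_Reg_1 by blast+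
    note el = Reg_el(2) [OF h] Reg_el(2) [OF h']
    note [simp] = Tw_typing [OF el(1)] Tw_typing [OF el(2)] el(1) [unfolded Hom_iff]
    \<comment> \<open>\<open>Tw h\<close> absorbs \<open>Tw U\<close> on both sides and so descends
      to the common splitting object.\<close>
    define \<omega> where "\<omega> = p_AH \<cdot> Tw h \<cdot> i_AH"
    define \<omega>' where "\<omega>' = p_AH \<cdot> Tw h' \<cdot> i_AH"
    have [simp]: "\<omega> \<in> Arr C" "Dom C \<omega> = AxH" "Cod C \<omega> = AxH" "\<omega>' \<in> Arr C" "Dom C \<omega>' = AxH" "Cod C \<omega>' = AxH"
      by (simp_all add: \<omega>_def \<omega>'_def)
    have i_\<omega>: "i_AH \<cdot> \<omega> = Tw h \<cdot> i_AH"
      unfolding \<omega>_def using comp_assoc' [of i_AH "Tw h" "Tw U"] Tw_U_Tw(1) [OF h] by (simp add: i_p_comp)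
    have \<omega>_p: "\<omega> \<cdot> p_AH = p_AH \<cdot> Tw h"
      unfolding \<omega>_def using Tw_U_Tw(2) [OF h] by (simp add: i_p)
    have i_\<omega>': "i_AH \<cdot> \<omega>' = Tw h' \<cdot> i_AH"
      unfolding \<omega>'_def using comp_assoc' [of i_AH "Tw h'" "Tw U"] Tw_U_Tw(1) [OF h'] by (simp add: i_p_comp)
    have \<omega>_p': "\<omega>' \<cdot> p_AH = p_AH \<cdot> Tw h'"
      unfolding \<omega>'_def using Tw_U_Tw(2) [OF h'] by (simp add: i_p)
    have "is_iso AxH AxH \<omega>"
    proof -
      have "\<omega>' \<cdot> \<omega> = (\<omega>' \<cdot> p_AH) \<cdot> Tw h \<cdot> i_AH" unfolding \<omega>_def by simp
      also have "\<dots> = p_AH \<cdot> (Tw h' \<cdot> Tw h) \<cdot> i_AH" unfolding \<omega>_p' by simp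
      also have "\<dots> = AxH" unfolding Tw_comp [OF el] hh' by (simp add: U_i p_i)
      finally have 1: "\<omega>' \<cdot> \<omega> = AxH" .
      have "\<omega> \<cdot> \<omega>' = (\<omega> \<cdot> p_AH) \<cdot> Tw h' \<cdot> i_AH" unfolding \<omega>'_def by simp
      also have "\<dots> = p_AH \<cdot> (Tw h \<cdot> Tw h') \<cdot> i_AH" unfolding \<omega>_p by simp
      also have "\<dots> = AxH" unfolding Tw_comp [OF el(2,1)] hh' by (simp add: U_i p_i)
      finally have 2: "\<omega> \<cdot> \<omega>' = AxH" .
      show ?thesis using 1 2 by (auto simp: is_iso_def intro!: exI [of _ \<omega>'])
    qed
    moreover have "algebra_morphism (associated_algebra (weak_crossed_product \<alpha>)) (associated_algebra (weak_crossed_product \<beta>)) \<omega>"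
    proof -
      \<comment> \<open>Since the first leg of the coproduct of 1 is fixed by \<open>target\<close>,
        a twist sees at the unit only the restriction of its coefficient along
        \<open>target\<close>.\<close>
      have unit: "Tw f \<cdot> (\<eta>\<^sub>A \<^bold>\<otimes> \<eta>\<^sub>H) = ((f \<cdot> W.target) \<^bold>\<otimes> H) \<cdot> \<delta>\<^sub>H \<cdot> \<eta>\<^sub>H" if f: "R1.el f" for f
      proof -
        note [simp] = f [unfolded Hom_iff] Tw_typing [OF f]
        have "Tw f \<cdot> (\<eta>\<^sub>A \<^bold>\<otimes> \<eta>\<^sub>H) = (Tw f \<cdot> (\<eta>\<^sub>A \<^bold>\<otimes> H)) \<cdot> \<eta>\<^sub>H"
          using interchange' [of K \<eta>\<^sub>A \<eta>\<^sub>H H] by simp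
        also have "Tw f \<cdot> (\<eta>\<^sub>A \<^bold>\<otimes> H) = pr \<delta>\<^sub>H f H"
          unfolding Tw_def by (rule Lin_unit) simp_all
        also have "pr \<delta>\<^sub>H f H \<cdot> \<eta>\<^sub>H = (f \<^bold>\<otimes> H) \<cdot> ((W.target \<^bold>\<otimes> H) \<cdot> \<delta>\<^sub>H \<cdot> \<eta>\<^sub>H)"
          unfolding W.comult_unit_target' by (simp add: pr_def)
        also have "\<dots> = ((f \<cdot> W.target) \<^bold>\<otimes> H) \<cdot> \<delta>\<^sub>H \<cdot> \<eta>\<^sub>H"
          by (simp add: interchange_comp)
        finally show ?thesis .
      qed
      have unit': "Tw h \<cdot> (\<eta>\<^sub>A \<^bold>\<otimes> \<eta>\<^sub>H) = Tw U \<cdot> (\<eta>\<^sub>A \<^bold>\<otimes> \<eta>\<^sub>H)"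
        unfolding unit [OF el(1)] unit [OF Reg_el(2) [OF U_Reg]] hT U_target ..
      have pU: "p_AH \<cdot> Tw U \<cdot> f = p_AH \<cdot> f" if "f \<in> Arr C" "Cod C f = A \<^bold>\<otimes> H" for f
        using comp_assoc' [of f "Tw U" p_AH] that by (simp add: p_U)
      have "\<omega> \<cdot> (p_AH \<cdot> Tw U \<cdot> (\<eta>\<^sub>A \<^bold>\<otimes> \<eta>\<^sub>H)) = (\<omega> \<cdot> p_AH) \<cdot> (\<eta>\<^sub>A \<^bold>\<otimes> \<eta>\<^sub>H)"
        by (simp add: pU)
      also have "\<dots> = p_AH \<cdot> Tw U \<cdot> (\<eta>\<^sub>A \<^bold>\<otimes> \<eta>\<^sub>H)"
        unfolding \<omega>_p using unit' by simp
      finally have 1: "\<omega> \<cdot> (p_AH \<cdot> Tw U \<cdot> (\<eta>\<^sub>A \<^bold>\<otimes> \<eta>\<^sub>H)) = p_AH \<cdot> Tw U \<cdot> (\<eta>\<^sub>A \<^bold>\<otimes> \<eta>\<^sub>H)" .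
      have "\<omega> \<cdot> (p_AH \<cdot> cpm \<alpha> \<cdot> (i_AH \<^bold>\<otimes> i_AH)) = (\<omega> \<cdot> p_AH) \<cdot> cpm \<alpha> \<cdot> (i_AH \<^bold>\<otimes> i_AH)"
        by simp
      also have "\<dots> = p_AH \<cdot> (Tw h \<cdot> cpm \<alpha>) \<cdot> (i_AH \<^bold>\<otimes> i_AH)"
        unfolding \<omega>_p by simp
      also have "\<dots> = p_AH \<cdot> cpm \<beta> \<cdot> ((Tw h \<^bold>\<otimes> Tw h) \<cdot> (i_AH \<^bold>\<otimes> i_AH))"
        unfolding mult by simp
      also have "(Tw h \<^bold>\<otimes> Tw h) \<cdot> (i_AH \<^bold>\<otimes> i_AH) = (i_AH \<^bold>\<otimes> i_AH) \<cdot> (\<omega> \<^bold>\<otimes> \<omega>)"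
        using i_\<omega> by (simp add: interchange')
      finally have 2: "\<omega> \<cdot> (p_AH \<cdot> cpm \<alpha> \<cdot> (i_AH \<^bold>\<otimes> i_AH)) = (p_AH \<cdot> cpm \<beta> \<cdot> (i_AH \<^bold>\<otimes> i_AH)) \<cdot> (\<omega> \<^bold>\<otimes> \<omega>)"
        by simp
      show ?thesis
        unfolding algebra_morphism_def associated_algebra_def
        using 1 2 by (simp only: alg.simps preunit_eq Hom_iff) simp
    qed
    moreover have "\<omega> \<cdot> left_action = left_action \<cdot> (A \<^bold>\<otimes> \<omega>)"
    proof -
      have "Tw h \<cdot> (\<mu>\<^sub>A \<^bold>\<otimes> H) = (\<mu>\<^sub>A \<^bold>\<otimes> H) \<cdot> (A \<^bold>\<otimes> Tw h)"
        unfolding Tw_def by (rule Lin_mult) simp_all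
      then have "\<omega> \<cdot> left_action = p_AH \<cdot> (\<mu>\<^sub>A \<^bold>\<otimes> H) \<cdot> ((A \<^bold>\<otimes> Tw h) \<cdot> (A \<^bold>\<otimes> i_AH))"
        unfolding left_action_def using \<omega>_p comp_assoc' [of "(\<mu>\<^sub>A \<^bold>\<otimes> H) \<cdot> (A \<^bold>\<otimes> i_AH)" p_AH \<omega>]
          comp_assoc' [of "A \<^bold>\<otimes> i_AH" "\<mu>\<^sub>A \<^bold>\<otimes> H" "Tw h"] by simp
      also have "(A \<^bold>\<otimes> Tw h) \<cdot> (A \<^bold>\<otimes> i_AH) = (A \<^bold>\<otimes> i_AH) \<cdot> (A \<^bold>\<otimes> \<omega>)"
        using i_\<omega> by (simp add: interchange')
      finally show ?thesis by (simp add: left_action_def)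
    qed
    moreover have "right_coaction \<cdot> \<omega> = (\<omega> \<^bold>\<otimes> H) \<cdot> right_coaction"
    proof -
      have "right_coaction \<cdot> \<omega> = (p_AH \<^bold>\<otimes> H) \<cdot> ((A \<^bold>\<otimes> \<delta>\<^sub>H) \<cdot> Tw h) \<cdot> i_AH"
        unfolding right_coaction_def using i_\<omega> by simp
      also have "\<dots> = ((p_AH \<^bold>\<otimes> H) \<cdot> (Tw h \<^bold>\<otimes> H)) \<cdot> (A \<^bold>\<otimes> \<delta>\<^sub>H) \<cdot> i_AH"
        unfolding Tw_comult [OF el(1)] by simp
      also have "(p_AH \<^bold>\<otimes> H) \<cdot> (Tw h \<^bold>\<otimes> H) = (\<omega> \<^bold>\<otimes> H) \<cdot> (p_AH \<^bold>\<otimes> H)"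
        using \<omega>_p by (simp add: interchange')
      finally show ?thesis by (simp add: right_coaction_def)
    qed
    ultimately show "equivalent (weak_crossed_product \<alpha>) (weak_crossed_product \<beta>)"
      unfolding equivalent_def by blast
  }
qed

section \<open>Cohomology classes and equivalence classes\<close>

lemma B2_subgroup: "subgroup B2 (Reg 2)"
proof -
  interpret group_hom "Reg 1" "Reg 2" D1 by unfold_locales (rule hom_D)
  show ?thesis unfolding B2_def by (rule img_is_subgroup)
qed

lemma carrier_Z2: "carrier Z2 = {\<sigma> \<in> carrier (Reg 2). is_cocycle \<sigma>}"
  using cocycle_iff by (auto simp: Z2_def kernel_def)

lemma r_coset_Z2: "B2 #>\<^bsub>Z2\<^esub> \<sigma> = B2 #>\<^bsub>Reg 2\<^esub> \<sigma>"
  by (simp add: r_coset_def Z2_def)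

lemma carrier_H2: "carrier H2 = (\<lambda>\<sigma>. B2 #>\<^bsub>Reg 2\<^esub> \<sigma>) ` carrier Z2"
  by (auto simp: H2_def FactGroup_def RCOSETS_def r_coset_Z2)

lemma mem_coset_iff: "\<alpha> \<in> B2 #>\<^bsub>Reg 2\<^esub> \<beta> \<longleftrightarrow> (\<exists>h \<in> carrier (Reg 1). \<alpha> = D1 h \<otimes>\<^bsub>Reg 2\<^esub> \<beta>)"
  by (auto simp: r_coset_def B2_def)

lemma coset_eq_iff:
  assumes "\<alpha> \<in> carrier (Reg 2)" "\<beta> \<in> carrier (Reg 2)"
  shows "B2 #>\<^bsub>Reg 2\<^esub> \<alpha> = B2 #>\<^bsub>Reg 2\<^esub> \<beta> \<longleftrightarrow> \<alpha> \<in> B2 #>\<^bsub>Reg 2\<^esub> \<beta>"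
  using G2.repr_independence [OF _ assms(2) B2_subgroup] G2.rcos_self [OF assms(1) B2_subgroup] by auto

lemma normal_cocycles_subset: "normal_cocycles \<subseteq> carrier Z2" "normal_cocycles \<subseteq> carrier (Reg 2)"
  by (auto simp: normal_cocycles_def carrier_Z2)

text \<open>\<open>ex_normal\<close> provides a normal representative in every class.\<close>

lemma carrier_H2_normal: "carrier H2 = (\<lambda>\<sigma>. B2 #>\<^bsub>Reg 2\<^esub> \<sigma>) ` normal_cocycles"
proof
  show "carrier H2 \<subseteq> (\<lambda>\<sigma>. B2 #>\<^bsub>Reg 2\<^esub> \<sigma>) ` normal_cocycles"
  proof
    fix S assume "S \<in> carrier H2"
    then obtain \<sigma> where S: "S = B2 #>\<^bsub>Reg 2\<^esub> \<sigma>" and \<sigma>: "\<sigma> \<in> carrier (Reg 2)" "is_cocycle \<sigma>"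
      by (auto simp: carrier_H2 carrier_Z2)
    obtain h where h: "h \<in> carrier (Reg 1)" "D1 h \<otimes>\<^bsub>Reg 2\<^esub> \<sigma> \<in> normal_cocycles"
      using ex_normal [OF \<sigma>] by blast
    then have "D1 h \<otimes>\<^bsub>Reg 2\<^esub> \<sigma> \<in> B2 #>\<^bsub>Reg 2\<^esub> \<sigma>" by (auto simp only: mem_coset_iff)
    then have "B2 #>\<^bsub>Reg 2\<^esub> (D1 h \<otimes>\<^bsub>Reg 2\<^esub> \<sigma>) = S"
      unfolding S using h(2) normal_cocycles_subset \<sigma>(1) coset_eq_iff by blast
    then show "S \<in> (\<lambda>\<sigma>. B2 #>\<^bsub>Reg 2\<^esub> \<sigma>) ` normal_cocycles" using h(2) by blast
  qed
  show "(\<lambda>\<sigma>. B2 #>\<^bsub>Reg 2\<^esub> \<sigma>) ` normal_cocycles \<subseteq> carrier H2"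
    unfolding carrier_H2 using normal_cocycles_subset by blast
qed

text \<open>Equivalence becomes equality of cosets, which also shows that
  \<open>equivalence_rel\<close> is an equivalence relation on
  \<open>crossed_products\<close>.\<close>

lemma equivalence_rel_iff:
  assumes "\<alpha> \<in> normal_cocycles" "\<beta> \<in> normal_cocycles"
  shows "(weak_crossed_product \<alpha>, weak_crossed_product \<beta>) \<in> equivalence_rel \<longleftrightarrow>
    B2 #>\<^bsub>Reg 2\<^esub> \<alpha> = B2 #>\<^bsub>Reg 2\<^esub> \<beta>"
proof -
  have "\<alpha> \<in> carrier (Reg 2)" "\<beta> \<in> carrier (Reg 2)"
    using assms normal_cocycles_subset by blast+
  then show ?thesis
    using assms equivalent_iff [OF assms]
    by (simp add: equivalence_rel_def crossed_products_def coset_eq_iff mem_coset_iff)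
qed

lemma equivalence_class:
  assumes "\<alpha> \<in> normal_cocycles"
  shows "equivalence_rel `` {weak_crossed_product \<alpha>} =
    weak_crossed_product ` {\<beta> \<in> normal_cocycles. B2 #>\<^bsub>Reg 2\<^esub> \<alpha> = B2 #>\<^bsub>Reg 2\<^esub> \<beta>}"
  using equivalence_rel_iff [OF assms]
  by (force simp: equivalence_rel_def crossed_products_def)

theorem cohomology_classifies:
  "\<exists>\<Phi>. bij_betw \<Phi> (carrier H2) crossed_product_classes \<and>
    (\<forall>\<alpha> \<in> normal_cocycles. \<Phi> (B2 #>\<^bsub>Z2\<^esub> \<alpha>) = equivalence_rel `` {weak_crossed_product \<alpha>})"
proof -
  \<comment> \<open>No representative is chosen: a coset is sent to the set of crossed products of
    all normal cocycles in it, which is a full equivalence class by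
    \<open>equivalence_class\<close>.\<close>
  define \<Phi> where "\<Phi> S = weak_crossed_product ` {\<beta> \<in> normal_cocycles. S = B2 #>\<^bsub>Reg 2\<^esub> \<beta>}" for S
  have \<Phi>: "\<Phi> (B2 #>\<^bsub>Reg 2\<^esub> \<alpha>) = equivalence_rel `` {weak_crossed_product \<alpha>}" if "\<alpha> \<in> normal_cocycles" for \<alpha>
    unfolding \<Phi>_def using equivalence_class [OF that] ..
  have "inj_on \<Phi> (carrier H2)"
  proof (rule inj_onI)
    fix S S' assume "S \<in> carrier H2" "S' \<in> carrier H2" and eq: "\<Phi> S = \<Phi> S'"
    then obtain \<alpha> \<beta> where \<alpha>: "\<alpha> \<in> normal_cocycles" "S = B2 #>\<^bsub>Reg 2\<^esub> \<alpha>"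
      and \<beta>: "\<beta> \<in> normal_cocycles" "S' = B2 #>\<^bsub>Reg 2\<^esub> \<beta>"
      by (auto simp: carrier_H2_normal)
    have "weak_crossed_product \<beta> \<in> \<Phi> S'" using \<beta> by (auto simp: \<Phi>_def)
    then have "(weak_crossed_product \<alpha>, weak_crossed_product \<beta>) \<in> equivalence_rel"
      using \<Phi> [OF \<alpha>(1)] eq \<alpha>(2) by auto
    then show "S = S'" using equivalence_rel_iff \<alpha> \<beta> by blast
  qed
  moreover have "\<Phi> ` carrier H2 = crossed_product_classes"
    using \<Phi> by (auto simp: carrier_H2_normal crossed_product_classes_def quotient_def crossed_products_def)
  ultimately show ?thesis
    using \<Phi> by (auto simp: bij_betw_def r_coset_Z2)
qed

end

theorem theorem3p12:
  fixes C :: "'m smcat" and \<H> :: "'m bialg" and \<A> :: "'m module_alg"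
  assumes "ssm_category_with_equalizers C"
    and "cocommutative_weak_hopf_algebra C \<H>"
    and "commutative_left_module_algebra C \<H> \<A>"
  shows "\<exists>\<Phi>. bij_betw \<Phi> (carrier (module_data.H2 C \<H> \<A>))
                          (module_data.crossed_product_classes C \<H> \<A>) \<and>
             (\<forall>\<alpha> \<in> module_data.normal_cocycles C \<H> \<A>.
                \<Phi> (module_data.B2 C \<H> \<A> #>\<^bsub>module_data.Z2 C \<H> \<A>\<^esub> \<alpha>) =
                module_data.equivalence_rel C \<H> \<A> `` {module_data.weak_crossed_product C \<H> \<A> \<alpha>})"
proof -
  interpret sweedler_powers C \<H> \<A>
    using assms(2,3) by (intro sweedler_powers.intro sweedler.intro)
  show ?thesis by (rule cohomology_classifies)
qed

end
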